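(* Under the standing hypotheses (H1)–(H6) below, let $S$ be a self-adjoint restriction of $T_{\max}$ of the form $$S=\{f\in T_{\max}: W(f,v_a^\ast)(a)=0\text{ if }\tau\text{ is l.c. at }a,\ \ W(f,v_b^\ast)(b)=0\text{ if }\tau\text{ is l.c. at }b\},$$ where, for each endpoint $e\in\{a,b\}$ at which $\tau$ is l.c., $v_e\in T_{\max}\setminus T_{\min}$ with $W(v_e,v_e^\ast)(e)=0$. Let $z\in\rho(S)$ and let $u_a,u_b$ be non-trivial solutions of $(\tau-z)u=0$ such that $u_a$ satisfies $W(u_a,v_a^\ast)(a)=0$ if $\tau$ is l.c. at $a$, resp. lies in $L^2((a,c);\varrho)$ for all $c\in(a,b)$ if $\tau$ is l.p. at $a$; and $u_b$ satisfies $W(u_b,v_b^\ast)(b)=0$ if $\tau$ is l.c. at $b$, resp. lies in $L^2((c,b);\varrho)$ for all $c\in(a,b)$ if $\tau$ is l.p. at $b$. Then $$R_zg(x)=\int_a^bG_z(x,y)g(y)\,d\varrho(y),\quad x\in(a,b),\ g\in L^2((a,b);\varrho),$$ where $$G_z(x,y)=\frac{1}{W(u_b,u_a)}\begin{cases}u_a(y)u_b(x),& y<x,\\ u_a(x)u_b(y),& y\ge x.\end{cases}$$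
   Context: Let $-\infty\le a<b\le\infty$ and $\varrho,\varsigma,\chi$ locally finite Borel measures on $(a,b)$ with: (H1) $\varrho$ positive; (H2) $\chi$ real-valued; (H3) $\varsigma$ real-valued with $\operatorname{supp}\varsigma=(a,b)$; (H4) $\varsigma(\{x\})\chi(\{x\})=\varsigma(\{x\})\varrho(\{x\})=0$ for all $x$; (H5) for every gap $(\alpha,\beta)$ of $\operatorname{supp}\varrho$ (open interval in the complement with $\alpha,\beta\in\operatorname{supp}\varrho$) and every $f\in\mathfrak{D}_\tau$ with $f(\alpha-)=f(\beta+)=0$ one has $f=0$ on $(\alpha,\beta)$; (H6) $\operatorname{supp}\varrho$ has more than one point. Notation: $\int_c^x h\,d\mu=\int_{[c,x)}h\,d\mu$ ($x>c$), $0$ ($x=c$), $-\int_{[x,c)}h\,d\mu$ ($x<c$); $AC_{loc}((a,b);\mu)$: functions $f(x)=f(c)+\int_c^x h\,d\mu$, $h=\frac{df}{d\mu}\in L^1_{loc}$. $\mathfrak{D}_\tau$: $f\in AC_{loc}((a,b);\varsigma)$ for which there is $F\in AC_{loc}((a,b);\varrho)$ with $F=-\frac{df}{d\varsigma}+\int_c^{\cdot}f\,d\chi$ $|\varsigma|$-a.e.; $\tau f:=\frac{dF}{d\varrho}$, $f^{[1]}:=\int_c^{\cdot}f\,d\chi-F$, $W(f,g)=fg^{[1]}-f^{[1]}g$ (constant in $x$ for two solutions of the same equation $\tau u=zu$). In $L^2((a,b);\varrho)$: $T_{\max}=\{(f,\tau f): f\in\mathfrak{D}_\tau,\ f,\tau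 f\in L^2\}$, elements identified with functions in $\mathfrak{D}_\tau$; $f^\ast$ complex conjugation; $T_{\min}$ is the closure of $\{f\in T_{\max}:\operatorname{supp}f\text{ compact}\}$. For functions $f,g\in\mathfrak{D}_\tau$ with $f,\tau f,g,\tau g$ square-integrable near $a$, $W(f,g)(a)=\lim_{x\downarrow a}W(f,g)(x)$ exists (similarly at $b$). $\tau$ is l.c. at an endpoint if for all $z$ all solutions of $\tau u=zu$ are square-integrable w.r.t. $\varrho$ near it, l.p. otherwise. A self-adjoint restriction of $T_{\max}$ is $S\subseteq T_{\max}$ with $S=S^\ast$. $\rho(S)$ is the set of $z$ with $R_z=(S-z)^{-1}=\{(g-zf,f):(f,g)\in S\}$ an everywhere defined operator. *)

theory Defs
  imports "HOL-Analysis.Analysis"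
begin

text \<open>A real-valued (signed) locally finite Borel measure on the interval (a,b) is
  represented by its Jordan decomposition: a pair (mu_plus, mu_minus) of positive,
  locally finite Borel measures which are mutually singular on (a,b).
  Then |mu| = mu_plus + mu_minus.  Functions are complex valued on the reals; only
  their values on (a,b) matter.\<close>

type_synonym smeasure = "real measure \<times> real measure"

definition ival :: "ereal \<Rightarrow> ereal \<Rightarrow> real set" where
  "ival a b = {x. a < ereal x \<and> ereal x < b}"

definition locfin :: "real set \<Rightarrow> real measure \<Rightarrow> bool" where
  "locfin I M \<longleftrightarrow> sets M = sets borel \<and> (\<forall>x\<in>I. \<forall>y\<in>I. emeasure M {x..y} < \<infinity>)"

definition real_meas :: "real set \<Rightarrow> smeasure \<Rightarrow> bool" where
  "real_meas I \<mu> \<longleftrightarrow> locfin I (fst \<mu>) \<and> locfin I (snd \<mu>) \<and>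
     (\<exists>A\<in>sets borel. emeasure (fst \<mu>) (I - A) = 0 \<and> emeasure (snd \<mu>) (I \<inter> A) = 0)"

definition pmass :: "smeasure \<Rightarrow> real \<Rightarrow> real" where
  "pmass \<mu> x = measure (fst \<mu>) {x} - measure (snd \<mu>) {x}"

definition psupp :: "real set \<Rightarrow> real measure \<Rightarrow> real set" where
  "psupp I M = {x\<in>I. \<forall>e>0. emeasure M (ball x e \<inter> I) > 0}"

definition ssupp :: "real set \<Rightarrow> smeasure \<Rightarrow> real set" where
  "ssupp I \<mu> = {x\<in>I. \<forall>e>0. emeasure (fst \<mu>) (ball x e \<inter> I) > 0 \<or> emeasure (snd \<mu>) (ball x e \<inter> I) > 0}"

definition pint :: "real measure \<Rightarrow> real \<Rightarrow> real \<Rightarrow> (real \<Rightarrow> complex) \<Rightarrow> complex" where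
  "pint M c x h = (if c < x then set_lebesgue_integral M {c..<x} h
                   else if x = c then 0 else - set_lebesgue_integral M {x..<c} h)"

definition sint :: "smeasure \<Rightarrow> real \<Rightarrow> real \<Rightarrow> (real \<Rightarrow> complex) \<Rightarrow> complex" where
  "sint \<mu> c x h = pint (fst \<mu>) c x h - pint (snd \<mu>) c x h"

definition locint :: "real set \<Rightarrow> real measure \<Rightarrow> (real \<Rightarrow> complex) \<Rightarrow> bool" where
  "locint I M h \<longleftrightarrow> (\<forall>x\<in>I. \<forall>y\<in>I. set_integrable M {x..y} h)"

definition slocint :: "real set \<Rightarrow> smeasure \<Rightarrow> (real \<Rightarrow> complex) \<Rightarrow> bool" where
  "slocint I \<mu> h \<longleftrightarrow> locint I (fst \<mu>) h \<and> locint I (snd \<mu>) h"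

text \<open>tau_data: f is in AC_loc(varsigma) with df/dvarsigma = h (base point c),
  F is in AC_loc(varrho) with dF/dvarrho = g, and
  F = - df/dvarsigma + int_c f dchi  |varsigma|-a.e. on (a,b).
  Thus f in D_tau with tau f = g.\<close>
definition tau_data :: "ereal \<Rightarrow> ereal \<Rightarrow> real measure \<Rightarrow> smeasure \<Rightarrow> smeasure \<Rightarrow>
    (real \<Rightarrow> complex) \<Rightarrow> (real \<Rightarrow> complex) \<Rightarrow> real \<Rightarrow> (real \<Rightarrow> complex) \<Rightarrow> (real \<Rightarrow> complex) \<Rightarrow> bool" where
  "tau_data a b \<rho> \<sigma> chi f g c h F \<longleftrightarrow>
     c \<in> ival a b \<and>
     slocint (ival a b) \<sigma> h \<and> (\<forall>x\<in>ival a b. f x = f c + sint \<sigma> c x h) \<and>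
     locint (ival a b) \<rho> g \<and> (\<forall>x\<in>ival a b. F x = F c + pint \<rho> c x g) \<and>
     (AE y in fst \<sigma>. y \<in> ival a b \<longrightarrow> F y = - h y + sint chi c y f) \<and>
     (AE y in snd \<sigma>. y \<in> ival a b \<longrightarrow> F y = - h y + sint chi c y f)"

text \<open>f in D_tau and tau f = g (g is determined varrho-a.e.)\<close>
definition tau_rel :: "ereal \<Rightarrow> ereal \<Rightarrow> real measure \<Rightarrow> smeasure \<Rightarrow> smeasure \<Rightarrow>
    (real \<Rightarrow> complex) \<Rightarrow> (real \<Rightarrow> complex) \<Rightarrow> bool" where
  "tau_rel a b \<rho> \<sigma> chi f g \<longleftrightarrow> (\<exists>c h F. tau_data a b \<rho> \<sigma> chi f g c h F)"

definition Dtau :: "ereal \<Rightarrow> ereal \<Rightarrow> real measure \<Rightarrow> smeasure \<Rightarrow> smeasure \<Rightarrow> (real \<Rightarrow> complex) \<Rightarrow> bool" where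
  "Dtau a b \<rho> \<sigma> chi f \<longleftrightarrow> (\<exists>g. tau_rel a b \<rho> \<sigma> chi f g)"

text \<open>quasi-derivative f^[1] = int_c f dchi - F (independent of the choices, under H3)\<close>
definition qd :: "ereal \<Rightarrow> ereal \<Rightarrow> real measure \<Rightarrow> smeasure \<Rightarrow> smeasure \<Rightarrow> (real \<Rightarrow> complex) \<Rightarrow> real \<Rightarrow> complex" where
  "qd a b \<rho> \<sigma> chi f = (THE q. \<exists>g c h F. tau_data a b \<rho> \<sigma> chi f g c h F \<and>
       q = (\<lambda>x. if x \<in> ival a b then sint chi c x f - F x else 0))"

definition wron :: "ereal \<Rightarrow> ereal \<Rightarrow> real measure \<Rightarrow> smeasure \<Rightarrow> smeasure \<Rightarrow>
    (real \<Rightarrow> complex) \<Rightarrow> (real \<Rightarrow> complex) \<Rightarrow> real \<Rightarrow> complex" where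
  "wron a b \<rho> \<sigma> chi f g x = f x * qd a b \<rho> \<sigma> chi g x - qd a b \<rho> \<sigma> chi f x * g x"

definition left_end :: "ereal \<Rightarrow> real filter" where
  "left_end a = (if a = -\<infinity> then at_bot else at_right (real_of_ereal a))"

definition right_end :: "ereal \<Rightarrow> real filter" where
  "right_end b = (if b = \<infinity> then at_top else at_left (real_of_ereal b))"

definition L2_on :: "real measure \<Rightarrow> real set \<Rightarrow> (real \<Rightarrow> complex) \<Rightarrow> bool" where
  "L2_on M A f \<longleftrightarrow> set_borel_measurable M A f \<and>
     (\<integral>\<^sup>+x. indicator A x * ennreal ((cmod (f x))\<^sup>2) \<partial>M) < \<infinity>"

definition l2dist :: "real measure \<Rightarrow> real set \<Rightarrow> (real \<Rightarrow> complex) \<Rightarrow> (real \<Rightarrow> complex) \<Rightarrow> ennreal" where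
  "l2dist M A f g = (\<integral>\<^sup>+x. indicator A x * ennreal ((cmod (f x - g x))\<^sup>2) \<partial>M)"

definition l2inner :: "real measure \<Rightarrow> real set \<Rightarrow> (real \<Rightarrow> complex) \<Rightarrow> (real \<Rightarrow> complex) \<Rightarrow> complex" where
  "l2inner M A f g = set_lebesgue_integral M A (\<lambda>x. f x * cnj (g x))"

definition aeq :: "real measure \<Rightarrow> real set \<Rightarrow> (real \<Rightarrow> complex) \<Rightarrow> (real \<Rightarrow> complex) \<Rightarrow> bool" where
  "aeq M A f g \<longleftrightarrow> (AE x in M. x \<in> A \<longrightarrow> f x = g x)"

definition Tmax :: "ereal \<Rightarrow> ereal \<Rightarrow> real measure \<Rightarrow> smeasure \<Rightarrow> smeasure \<Rightarrow>
    ((real \<Rightarrow> complex) \<times> (real \<Rightarrow> complex)) set" where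
  "Tmax a b \<rho> \<sigma> chi = {(f, g). tau_rel a b \<rho> \<sigma> chi f g \<and> L2_on \<rho> (ival a b) f \<and> L2_on \<rho> (ival a b) g}"

definition cpt_supp :: "real set \<Rightarrow> (real \<Rightarrow> complex) \<Rightarrow> bool" where
  "cpt_supp I f \<longleftrightarrow> (\<exists>K. compact K \<and> K \<subseteq> I \<and> (\<forall>x\<in>I - K. f x = 0))"

text \<open>T_min: closure (in L^2 x L^2) of the compactly supported elements of T_max;
  since T_max is closed, its elements are again identified with elements of T_max.\<close>
definition Tmin :: "ereal \<Rightarrow> ereal \<Rightarrow> real measure \<Rightarrow> smeasure \<Rightarrow> smeasure \<Rightarrow>
    ((real \<Rightarrow> complex) \<times> (real \<Rightarrow> complex)) set" where
  "Tmin a b \<rho> \<sigma> chi = {(f, g). (f, g) \<in> Tmax a b \<rho> \<sigma> chi \<and>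
     (\<exists>fs gs. (\<forall>n. (fs n, gs n) \<in> Tmax a b \<rho> \<sigma> chi \<and> cpt_supp (ival a b) (fs n)) \<and>
        ((\<lambda>n. l2dist \<rho> (ival a b) (fs n) f) \<longlongrightarrow> 0) sequentially \<and>
        ((\<lambda>n. l2dist \<rho> (ival a b) (gs n) g) \<longlongrightarrow> 0) sequentially)}"

definition lc_left :: "ereal \<Rightarrow> ereal \<Rightarrow> real measure \<Rightarrow> smeasure \<Rightarrow> smeasure \<Rightarrow> bool" where
  "lc_left a b \<rho> \<sigma> chi \<longleftrightarrow> (\<forall>z u. tau_rel a b \<rho> \<sigma> chi u (\<lambda>x. z * u x) \<longrightarrow>
       (\<exists>c\<in>ival a b. L2_on \<rho> {x\<in>ival a b. x < c} u))"

definition lc_right :: "ereal \<Rightarrow> ereal \<Rightarrow> real measure \<Rightarrow> smeasure \<Rightarrow> smeasure \<Rightarrow> bool" where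
  "lc_right a b \<rho> \<sigma> chi \<longleftrightarrow> (\<forall>z u. tau_rel a b \<rho> \<sigma> chi u (\<lambda>x. z * u x) \<longrightarrow>
       (\<exists>c\<in>ival a b. L2_on \<rho> {x\<in>ival a b. c < x} u))"

definition self_adjoint_rel :: "real measure \<Rightarrow> real set \<Rightarrow>
    ((real \<Rightarrow> complex) \<times> (real \<Rightarrow> complex)) set \<Rightarrow> bool" where
  "self_adjoint_rel M A S \<longleftrightarrow>
     (\<forall>(u, v)\<in>S. L2_on M A u \<and> L2_on M A v) \<and>
     (\<forall>f g. L2_on M A f \<and> L2_on M A g \<longrightarrow>
        ((\<forall>(u, v)\<in>S. l2inner M A g u = l2inner M A f v) \<longleftrightarrow>
         (\<exists>(u, v)\<in>S. aeq M A u f \<and> aeq M A v g)))"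

text \<open>z in rho(S): R_z = {(g - z f, f) : (f,g) in S} is an everywhere defined operator.\<close>
definition resolvent_set :: "real measure \<Rightarrow> real set \<Rightarrow>
    ((real \<Rightarrow> complex) \<times> (real \<Rightarrow> complex)) set \<Rightarrow> complex set" where
  "resolvent_set M A S = {z.
     (\<forall>g. L2_on M A g \<longrightarrow> (\<exists>(f, h)\<in>S. aeq M A (\<lambda>x. h x - z * f x) g)) \<and>
     (\<forall>f1 h1 f2 h2. (f1, h1) \<in> S \<and> (f2, h2) \<in> S \<and>
        aeq M A (\<lambda>x. h1 x - z * f1 x) (\<lambda>x. h2 x - z * f2 x) \<longrightarrow> aeq M A f1 f2)}"

end

theory Submission
  imports Defs
begin

text \<open>
  All five measures have densities with respect to one dominating measure \<open>\<mu>\<close>; writing \<open>s\<close>, \<open>k\<close>, \<open>r\<close>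
  for the densities of \<open>\<sigma>\<close>, \<open>\<chi>\<close>, \<open>\<rho>\<close>, the relation \<open>\<tau> f = g\<close> becomes the system \<open>df = s q d\<mu>\<close>,
  \<open>dq = (k f - r g) d\<mu>\<close> with \<open>q\<close> the quasi-derivative, and the atom condition (H4) makes the jump terms
  of the product rule cancel, which gives the Lagrange identity \<open>dW(f,u) = (u \<tau>f - f \<tau>u) d\<rho>\<close>.
  For \<open>f = R\<^sub>z g\<close> it yields \<open>W(f,u\<^sub>a)(x) = \<integral>\<^bsub>y<x\<^esub> u\<^sub>a g d\<rho>\<close> and
  \<open>W(f,u\<^sub>b)(x) = - \<integral>\<^bsub>y\<ge>x\<^esub> u\<^sub>b g d\<rho>\<close> as soon as \<open>W(f,u\<^sub>a)\<close> and \<open>W(f,u\<^sub>b)\<close> vanish at \<open>a\<close> and \<open>b\<close>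
  respectively, and the formula is \<open>f W(u\<^sub>b,u\<^sub>a) = u\<^sub>b W(f,u\<^sub>a) - u\<^sub>a W(f,u\<^sub>b)\<close>.

  In the limit circle case the vanishing at \<open>a\<close> follows from the Pluecker identity for \<open>f, u\<^sub>a, u\<^sub>b, v\<^sub>a\<^sup>*\<close>:
  \<open>W(u\<^sub>b,v\<^sub>a\<^sup>*)\<close> cannot tend to 0, since otherwise \<open>u\<^sub>b\<close> would be an eigenvector of \<open>S\<close> for \<open>z\<close>.
  In the limit point case no theory of deficiency indices is needed: there is a function that agrees
  with \<open>u\<^sub>a\<close> near \<open>a\<close> and vanishes near \<open>b\<close> and whose conjugate lies in \<open>S\<close>, so symmetry of \<open>S\<close>
  forces \<open>W(f,u\<^sub>a)(a) = 0\<close>.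
\<close>

section \<open>Functions with a density with respect to a locally finite measure\<close>

text \<open>Two features of the setting shape the proof. First, every integral runs over a half-open
  interval \<open>[x,y)\<close>, so a primitive of \<open>\<alpha>\<close> is left-continuous and
  jumps by \<open>\<mu>{x} * \<alpha> x\<close> to the right of \<open>x\<close>. Products therefore
  acquire a diagonal term, and the left and right sides of a point need separate arguments. With a
  single dominating measure one product rule serves \<rho>, \<sigma> and chi at once. Second,
  equality in \<open>L\<^sup>2(\<rho>)\<close> holds only \<rho>-a.e., and \<rho> may have gaps in
  which it sees nothing of a function, whereas the formula is claimed at every point. (H5) closes
  the gaps between support points; together with (H6) and the full support of \<sigma> it turns a
  solution that vanishes a.e. into one that vanishes identically. This excludes eigenvectors for
  \<open>z\<close> and makes the cutoff solvable. Finally, the coefficients are real, so conjugating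
  a cutoff stays within the system; the conjugation in the second slot of the inner product undoes
  this, and symmetry of \<open>S\<close> becomes a statement about the bilinear Wronskian with
  \<open>ua\<close> itself.\<close>

lemma norm_set_integral_le:
  fixes f :: "real \<Rightarrow> 'b::{banach, second_countable_topology}"
  assumes "set_integrable M A f" "set_integrable M A w" "\<And>t. t \<in> A \<Longrightarrow> norm (f t) \<le> w t"
  shows "norm (set_lebesgue_integral M A f) \<le> (set_lebesgue_integral M A w :: real)"
  using assms unfolding set_lebesgue_integral_def set_integrable_def
  by - (rule Bochner_Integration.integral_norm_bound_integral, auto simp: indicator_def)

text \<open>Fubini for \<open>\<alpha> s * \<beta> t\<close>, with the plane cut into
  \<open>s < t\<close>, \<open>s > t\<close> and the diagonal. Atoms give the diagonal positive
  product measure, whence the term with \<open>measure M {t}\<close>. Applied to truncated densities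
  this is the product rule in integrated form.\<close>

lemma integral_prod_split:
  fixes M :: "real measure" and \<alpha> \<beta> :: "real \<Rightarrow> complex"
  assumes sf: "sigma_finite_measure M" and sets[measurable_cong]: "sets M = sets borel"
    and \<alpha>: "integrable M \<alpha>" and \<beta>: "integrable M \<beta>"
  shows "integrable M (\<lambda>t. \<beta> t * (LINT s:{..<t}|M. \<alpha> s))"
    and "integrable M (\<lambda>t. \<alpha> t * (LINT s:{..<t}|M. \<beta> s))"
    and "integrable M (\<lambda>t. \<alpha> t * \<beta> t * measure M {t})"
    and "integral\<^sup>L M \<alpha> * integral\<^sup>L M \<beta> =
       (LINT t|M. \<beta> t * (LINT s:{..<t}|M. \<alpha> s)) + (LINT t|M. \<alpha> t * (LINT s:{..<t}|M. \<beta> s))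
       + (LINT t|M. \<alpha> t * \<beta> t * measure M {t})"
proof -
  interpret sigma_finite_measure M by (rule sf)
  interpret pair_sigma_finite M M by standard
  have [measurable]: "\<alpha> \<in> borel_measurable M" "\<beta> \<in> borel_measurable M" using \<alpha> \<beta> by auto
  define \<Phi> where "\<Phi> = (\<lambda>p. \<alpha> (fst p) * \<beta> (snd p))"
  define P where "P = (\<lambda>Q::real\<Rightarrow>real\<Rightarrow>bool. \<lambda>p. if Q (fst p) (snd p) then \<Phi> p else 0)"
  have \<Phi>: "integrable (M \<Otimes>\<^sub>M M) \<Phi>"
  proof (rule Fubini_integrable)
    show "\<Phi> \<in> borel_measurable (M \<Otimes>\<^sub>M M)" unfolding \<Phi>_def by measurable
    have "(\<lambda>x. \<integral>y. norm (\<Phi> (x,y)) \<partial>M) = (\<lambda>x. norm (\<alpha> x) * (\<integral>y. norm (\<beta> y) \<partial>M))"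
      by (simp add: \<Phi>_def norm_mult)
    then show "integrable M (\<lambda>x. \<integral>y. norm (\<Phi> (x,y)) \<partial>M)"
      using integrable_norm[OF \<alpha>] by simp
    show "AE x in M. integrable M (\<lambda>y. \<Phi> (x,y))" using \<beta> by (simp add: \<Phi>_def)
  qed
  have meas: "P (<) \<in> borel_measurable (M \<Otimes>\<^sub>M M)" "P (>) \<in> borel_measurable (M \<Otimes>\<^sub>M M)"
    "P (=) \<in> borel_measurable (M \<Otimes>\<^sub>M M)"
    unfolding P_def \<Phi>_def by measurable
  have int: "integrable (M \<Otimes>\<^sub>M M) (P (<))" "integrable (M \<Otimes>\<^sub>M M) (P (>))" "integrable (M \<Otimes>\<^sub>M M) (P (=))"
    by (rule Bochner_Integration.integrable_bound[OF \<Phi>], rule meas, simp add: P_def)+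
  have 1: "(\<lambda>t. LINT s|M. P (<) (s,t)) = (\<lambda>t. \<beta> t * (LINT s:{..<t}|M. \<alpha> s))"
  proof
    fix t
    have "(LINT s|M. P (<) (s,t)) = (LINT s|M. \<beta> t * (indicator {..<t} s *\<^sub>R \<alpha> s))"
      by (rule Bochner_Integration.integral_cong) (auto simp: P_def \<Phi>_def)
    then show "(LINT s|M. P (<) (s,t)) = \<beta> t * (LINT s:{..<t}|M. \<alpha> s)"
      unfolding set_lebesgue_integral_def integral_mult_right_zero .
  qed
  have 2: "(\<lambda>s. LINT t|M. P (>) (s,t)) = (\<lambda>s. \<alpha> s * (LINT t:{..<s}|M. \<beta> t))"
  proof
    fix s
    have "(LINT t|M. P (>) (s,t)) = (LINT t|M. \<alpha> s * (indicator {..<s} t *\<^sub>R \<beta> t))"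
      by (rule Bochner_Integration.integral_cong) (auto simp: P_def \<Phi>_def)
    then show "(LINT t|M. P (>) (s,t)) = \<alpha> s * (LINT t:{..<s}|M. \<beta> t)"
      unfolding set_lebesgue_integral_def integral_mult_right_zero .
  qed
  have 3: "(\<lambda>t. LINT s|M. P (=) (s,t)) = (\<lambda>t. \<alpha> t * \<beta> t * measure M {t})"
  proof
    fix t
    have "(LINT s|M. P (=) (s,t)) = (LINT s|M. (\<alpha> t * \<beta> t) * complex_of_real (indicator {t} s))"
      by (rule Bochner_Integration.integral_cong) (auto simp: P_def \<Phi>_def)
    also have "\<dots> = \<alpha> t * \<beta> t * (LINT s|M. complex_of_real (indicator {t} s))"
      by (rule integral_mult_right_zero)
    also have "(LINT s|M. complex_of_real (indicator {t} s)) = measure M {t}"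
      using sets_eq_imp_space_eq[OF sets] by simp
    finally show "(LINT s|M. P (=) (s,t)) = \<alpha> t * \<beta> t * measure M {t}" .
  qed
  show "integrable M (\<lambda>t. \<beta> t * (LINT s:{..<t}|M. \<alpha> s))"
    using integrable_snd[of "\<lambda>s t. P (<) (s,t)"] int(1) 1 by simp
  show "integrable M (\<lambda>t. \<alpha> t * (LINT s:{..<t}|M. \<beta> s))"
    using integrable_fst'[OF int(2)] 2 by simp
  show "integrable M (\<lambda>t. \<alpha> t * \<beta> t * measure M {t})"
    using integrable_snd[of "\<lambda>s t. P (=) (s,t)"] int(3) 3 by simp
  have "\<Phi> = (\<lambda>p. P (<) p + P (>) p + P (=) p)"
    by (auto simp: P_def fun_eq_iff)
  then have "integral\<^sup>L (M \<Otimes>\<^sub>M M) \<Phi> = integral\<^sup>L (M \<Otimes>\<^sub>M M) (P (<)) + integral\<^sup>L (M \<Otimes>\<^sub>M M) (P (>)) + integral\<^sup>L (M \<Otimes>\<^sub>M M) (P (=))"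
    using int by simp
  moreover have "integral\<^sup>L (M \<Otimes>\<^sub>M M) \<Phi> = integral\<^sup>L M \<alpha> * integral\<^sup>L M \<beta>"
    using integral_fst'[OF \<Phi>] by (simp add: \<Phi>_def)
  moreover have "integral\<^sup>L (M \<Otimes>\<^sub>M M) (P (<)) = (LINT t|M. \<beta> t * (LINT s:{..<t}|M. \<alpha> s))"
    using integral_snd[of "\<lambda>s t. P (<) (s,t)"] int(1) 1 by simp
  moreover have "integral\<^sup>L (M \<Otimes>\<^sub>M M) (P (>)) = (LINT t|M. \<alpha> t * (LINT s:{..<t}|M. \<beta> s))"
    using integral_fst'[OF int(2)] 2 by simp
  moreover have "integral\<^sup>L (M \<Otimes>\<^sub>M M) (P (=)) = (LINT t|M. \<alpha> t * \<beta> t * measure M {t})"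
    using integral_snd[of "\<lambda>s t. P (=) (s,t)"] int(3) 3 by simp
  ultimately show "integral\<^sup>L M \<alpha> * integral\<^sup>L M \<beta> =
       (LINT t|M. \<beta> t * (LINT s:{..<t}|M. \<alpha> s)) + (LINT t|M. \<alpha> t * (LINT s:{..<t}|M. \<beta> s))
       + (LINT t|M. \<alpha> t * \<beta> t * measure M {t})" by simp
qed

lemma set_integrable_norm:
  fixes f :: "'a \<Rightarrow> 'b::{banach, second_countable_topology}"
  shows "set_integrable M A f \<Longrightarrow> set_integrable M A (\<lambda>t. norm (f t))"
  unfolding set_integrable_def by (drule Bochner_Integration.integrable_norm) simp

text \<open>\<mu> is controlled only on compact subintervals of \<open>I\<close> and may be anything
  outside, so sigma-finiteness, needed for Fubini, is a separate assumption.\<close>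

locale locfin_ivl =
  fixes I :: "real set" and \<mu> :: "real measure"
  assumes open_I: "open I" and ivl_I: "is_interval I"
    and sets_mu[measurable_cong, simp]: "sets \<mu> = sets borel"
    and sfin: "sigma_finite_measure \<mu>"
    and lf: "\<And>x y. x \<in> I \<Longrightarrow> y \<in> I \<Longrightarrow> emeasure \<mu> {x..y} < \<infinity>"
begin

lemma space_mu[simp]: "space \<mu> = UNIV"
  using sets_eq_imp_space_eq[OF sets_mu] by simp

lemma I_sets[measurable, simp]: "I \<in> sets borel" using open_I by auto

lemma Icc_sub: "x \<in> I \<Longrightarrow> y \<in> I \<Longrightarrow> {x..y} \<subseteq> I"
  using ivl_I unfolding is_interval_1 by (meson atLeastAtMost_iff subsetI)

lemma between_I: "x \<in> I \<Longrightarrow> y \<in> I \<Longrightarrow> x \<le> t \<Longrightarrow> t \<le> y \<Longrightarrow> t \<in> I"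
  using Icc_sub by fastforce

lemma nbhd_I:
  assumes "x \<in> I" obtains y z where "y \<in> I" "z \<in> I" "y < x" "x < z"
proof -
  obtain e where e: "e > 0" "cball x e \<subseteq> I" using open_I assms open_contains_cball by blast
  then have "x - e \<in> I" "x + e \<in> I" by (auto simp: dist_real_def subset_iff)
  then show ?thesis using that e by force
qed

lemma set_integrable_sub:
  fixes \<alpha> :: "real \<Rightarrow> 'b::{banach, second_countable_topology}"
  assumes "\<forall>x\<in>I. \<forall>y\<in>I. set_integrable \<mu> {x..y} \<alpha>" "x \<in> I" "y \<in> I" "A \<in> sets borel" "A \<subseteq> {x..y}"
  shows "set_integrable \<mu> A \<alpha>"
  by (rule set_integrable_subset[of \<mu> "{x..y}"]) (use assms in auto)

section \<open>One-sided limits of integrals over shrinking intervals\<close>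

lemma lim_left_integral:
  fixes \<alpha> :: "real \<Rightarrow> 'b::{banach, second_countable_topology}"
  assumes \<alpha>: "\<forall>x\<in>I. \<forall>y\<in>I. set_integrable \<mu> {x..y} \<alpha>" and x: "x \<in> I"
  shows "((\<lambda>y. LINT t:{y..<x}|\<mu>. \<alpha> t) \<longlongrightarrow> 0) (at_left x)"
proof -
  obtain c where c: "c \<in> I" "c < x" using nbhd_I[OF x] by metis
  have i: "set_integrable \<mu> {c..<x} \<alpha>" by (rule set_integrable_sub[OF \<alpha> c(1) x]) auto
  show ?thesis
  proof (rule tendsto_at_left_sequentially[OF c(2)])
    fix S :: "nat \<Rightarrow> real" assume S: "\<And>n. S n < x" "\<And>n. c < S n" "incseq S" "S \<longlonglongrightarrow> x"
    have "(\<lambda>n. LINT t|\<mu>. indicator {S n..<x} t *\<^sub>R \<alpha> t) \<longlonglongrightarrow> (LINT t|\<mu>. 0)"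
    proof (rule integral_dominated_convergence)
      show "integrable \<mu> (\<lambda>t. norm (indicator {c..<x} t *\<^sub>R \<alpha> t))"
        using i unfolding set_integrable_def by (rule integrable_norm)
      have "{S n..<x} \<subseteq> {c..x}" for n using less_imp_le[OF S(2)[of n]] by auto
      then show "(\<lambda>t. indicator {S n..<x} t *\<^sub>R \<alpha> t) \<in> borel_measurable \<mu>" for n
        using set_integrable_sub[OF \<alpha> c(1) x, of "{S n..<x}"] unfolding set_integrable_def
        by auto
      show "AE t in \<mu>. (\<lambda>n. indicator {S n..<x} t *\<^sub>R \<alpha> t) \<longlonglongrightarrow> 0"
      proof (rule AE_I2)
        fix t
        have "\<forall>\<^sub>F n in sequentially. indicator {S n..<x} t *\<^sub>R \<alpha> t = 0"
        proof (cases "t < x")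
          case True
          then have "\<forall>\<^sub>F n in sequentially. t < S n" using order_tendstoD(1)[OF S(4)] by simp
          then show ?thesis by (rule eventually_mono) simp
        qed auto
        then show "(\<lambda>n. indicator {S n..<x} t *\<^sub>R \<alpha> t) \<longlonglongrightarrow> 0" by (rule tendsto_eventually)
      qed
      show "AE t in \<mu>. norm (indicator {S n..<x} t *\<^sub>R \<alpha> t) \<le> norm (indicator {c..<x} t *\<^sub>R \<alpha> t)" for n
        using less_imp_le[OF S(2)[of n]] by (intro AE_I2) (auto simp: indicator_def)
    qed auto
    then show "(\<lambda>n. LINT t:{S n..<x}|\<mu>. \<alpha> t) \<longlonglongrightarrow> 0" by (simp add: set_lebesgue_integral_def)
  qed
qed

text \<open>The point \<open>x\<close> itself is excluded, so the domain shrinks to the empty set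
  and dominated convergence gives 0 even if \<open>x\<close> is an atom.\<close>

lemma lim_right_integral:
  fixes \<alpha> :: "real \<Rightarrow> 'b::{banach, second_countable_topology}"
  assumes \<alpha>: "\<forall>x\<in>I. \<forall>y\<in>I. set_integrable \<mu> {x..y} \<alpha>" and x: "x \<in> I"
  shows "((\<lambda>y. LINT t:{x<..<y}|\<mu>. \<alpha> t) \<longlongrightarrow> 0) (at_right x)"
proof -
  obtain c where c: "c \<in> I" "x < c" using nbhd_I[OF x] by metis
  have i: "set_integrable \<mu> {x..<c} \<alpha>" by (rule set_integrable_sub[OF \<alpha> x c(1)]) auto
  show ?thesis
  proof (rule tendsto_at_right_sequentially[OF c(2)])
    fix S :: "nat \<Rightarrow> real" assume S: "\<And>n. x < S n" "\<And>n. S n < c" "decseq S" "S \<longlonglongrightarrow> x"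
    have "(\<lambda>n. LINT t|\<mu>. indicator {x<..<S n} t *\<^sub>R \<alpha> t) \<longlonglongrightarrow> (LINT t|\<mu>. 0)"
    proof (rule integral_dominated_convergence)
      show "integrable \<mu> (\<lambda>t. norm (indicator {x..<c} t *\<^sub>R \<alpha> t))"
        using i unfolding set_integrable_def by (rule integrable_norm)
      have "{x<..<S n} \<subseteq> {x..c}" for n using less_imp_le[OF S(2)[of n]] by auto
      then show "(\<lambda>t. indicator {x<..<S n} t *\<^sub>R \<alpha> t) \<in> borel_measurable \<mu>" for n
        using set_integrable_sub[OF \<alpha> x c(1), of "{x<..<S n}"] unfolding set_integrable_def
        by auto
      show "AE t in \<mu>. (\<lambda>n. indicator {x<..<S n} t *\<^sub>R \<alpha> t) \<longlonglongrightarrow> 0"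
      proof (rule AE_I2)
        fix t
        have "\<forall>\<^sub>F n in sequentially. indicator {x<..<S n} t *\<^sub>R \<alpha> t = 0"
        proof (cases "x < t")
          case True
          then have "\<forall>\<^sub>F n in sequentially. S n < t" using order_tendstoD(2)[OF S(4)] by simp
          then show ?thesis by (rule eventually_mono) simp
        qed auto
        then show "(\<lambda>n. indicator {x<..<S n} t *\<^sub>R \<alpha> t) \<longlonglongrightarrow> 0" by (rule tendsto_eventually)
      qed
      show "AE t in \<mu>. norm (indicator {x<..<S n} t *\<^sub>R \<alpha> t) \<le> norm (indicator {x..<c} t *\<^sub>R \<alpha> t)" for n
        using less_imp_le[OF S(2)[of n]] by (intro AE_I2) (auto simp: indicator_def)
    qed auto
    then show "(\<lambda>n. LINT t:{x<..<S n}|\<mu>. \<alpha> t) \<longlonglongrightarrow> 0" by (simp add: set_lebesgue_integral_def)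
  qed
qed

lemma finite_singleton_mu: "x \<in> I \<Longrightarrow> emeasure \<mu> {x} < \<infinity>"
  using lf[of x x] by simp

lemma integral_sing:
  fixes \<alpha> :: "real \<Rightarrow> 'b::{banach, second_countable_topology}"
  assumes x: "x \<in> I"
  shows "set_integrable \<mu> {x} \<alpha>" "(LINT t:{x}|\<mu>. \<alpha> t) = measure \<mu> {x} *\<^sub>R \<alpha> x"
proof -
  have e: "(\<lambda>t. indicator {x} t *\<^sub>R \<alpha> t) = (\<lambda>t. indicat_real {x} t *\<^sub>R \<alpha> x)"
    by (auto simp: indicator_def fun_eq_iff)
  have i: "integrable \<mu> (indicat_real {x})" using finite_singleton_mu[OF x] by auto
  show "set_integrable \<mu> {x} \<alpha>" unfolding set_integrable_def e using i by simp
  show "(LINT t:{x}|\<mu>. \<alpha> t) = measure \<mu> {x} *\<^sub>R \<alpha> x" unfolding set_lebesgue_integral_def e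
    using i by simp
qed

text \<open>Over \<open>[x,y)\<close> the atom at \<open>x\<close> survives in the limit; this is
  the source of all jumps.\<close>

lemma lim_right_integral':
  fixes \<alpha> :: "real \<Rightarrow> 'b::{banach, second_countable_topology}"
  assumes \<alpha>: "\<forall>x\<in>I. \<forall>y\<in>I. set_integrable \<mu> {x..y} \<alpha>" and x: "x \<in> I"
  shows "((\<lambda>y. LINT t:{x..<y}|\<mu>. \<alpha> t) \<longlongrightarrow> measure \<mu> {x} *\<^sub>R \<alpha> x) (at_right x)"
proof -
  obtain c where c: "c \<in> I" "x < c" using nbhd_I[OF x] by metis
  have "((\<lambda>y. measure \<mu> {x} *\<^sub>R \<alpha> x + (LINT t:{x<..<y}|\<mu>. \<alpha> t)) \<longlongrightarrow> measure \<mu> {x} *\<^sub>R \<alpha> x + 0) (at_right x)"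
    by (intro tendsto_intros lim_right_integral[OF \<alpha> x])
  moreover have "\<forall>\<^sub>F y in at_right x. measure \<mu> {x} *\<^sub>R \<alpha> x + (LINT t:{x<..<y}|\<mu>. \<alpha> t) = (LINT t:{x..<y}|\<mu>. \<alpha> t)"
    using eventually_at_right_less[of x] eventually_at_right_real[OF c(2)]
  proof eventually_elim
    case (elim y)
    have u: "{x..<y} = {x} \<union> {x<..<y}" using elim by auto
    have "{x<..<y} \<subseteq> {x..c}" using elim by auto
    then have "(LINT t:{x..<y}|\<mu>. \<alpha> t) = (LINT t:{x}|\<mu>. \<alpha> t) + (LINT t:{x<..<y}|\<mu>. \<alpha> t)"
      unfolding u using integral_sing[OF x] set_integrable_sub[OF \<alpha> x c(1)] by (intro set_integral_Un) auto
    then show ?case using integral_sing[OF x, of \<alpha>] by simp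
  qed
  ultimately show ?thesis by (simp add: tendsto_cong)
qed

text \<open>Absolute continuity without a base point: only increments are prescribed. The half-open
  interval reproduces the convention of \<open>pint\<close>; it makes \<open>A\<close>
  left-continuous with a possible jump on the right.\<close>

definition ac :: "(real \<Rightarrow> complex) \<Rightarrow> (real \<Rightarrow> complex) \<Rightarrow> bool" where
  "ac A \<alpha> \<longleftrightarrow> locint I \<mu> \<alpha> \<and>
     (\<forall>x\<in>I. \<forall>y\<in>I. x \<le> y \<longrightarrow> A y - A x = set_lebesgue_integral \<mu> {x..<y} \<alpha>)"

lemma acD:
  assumes "ac A \<alpha>" "x \<in> I" "y \<in> I" "x \<le> y"
  shows "A y - A x = (LINT t:{x..<y}|\<mu>. \<alpha> t)"
  using assms unfolding ac_def by blast

lemma ac_locint: "ac A \<alpha> \<Longrightarrow> locint I \<mu> \<alpha>" unfolding ac_def by blast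

lemma locint_ico: "locint I \<mu> \<alpha> \<Longrightarrow> x \<in> I \<Longrightarrow> y \<in> I \<Longrightarrow> set_integrable \<mu> {x..<y} \<alpha>"
  by (rule set_integrable_sub[of _ x y]) (auto simp: locint_def)

lemma locint_add: "locint I \<mu> \<alpha> \<Longrightarrow> locint I \<mu> \<beta> \<Longrightarrow> locint I \<mu> (\<lambda>t. \<alpha> t + \<beta> t)"
  unfolding locint_def by (blast intro: set_integral_add)

lemma locint_cmult: "locint I \<mu> \<alpha> \<Longrightarrow> locint I \<mu> (\<lambda>t. c * \<alpha> t)"
  unfolding locint_def by (blast intro: set_integrable_mult_right)

lemma set_integrable_cnj:
  "set_integrable M A \<alpha> \<Longrightarrow> set_integrable M A (\<lambda>t. cnj (\<alpha> t))"
  unfolding set_integrable_def complex_cnj_scaleR[symmetric] complex_integrable_cnj .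

lemma set_integral_cnj:
  "(LINT t:A|M. cnj (\<alpha> t)) = cnj (LINT t:A|M. \<alpha> t)"
  unfolding set_lebesgue_integral_def complex_cnj_scaleR[symmetric] by (rule Bochner_Integration.integral_cnj)

lemma ac_cmult: "ac A \<alpha> \<Longrightarrow> ac (\<lambda>t. c * A t) (\<lambda>t. c * \<alpha> t)"
  unfolding ac_def by (simp add: locint_cmult right_diff_distrib[symmetric])

lemma ac_const: "ac (\<lambda>t. c) (\<lambda>t. 0)"
  unfolding ac_def by (auto simp: locint_def set_integrable_def)

lemma ac_add: "ac A \<alpha> \<Longrightarrow> ac B \<beta> \<Longrightarrow> ac (\<lambda>t. A t + B t) (\<lambda>t. \<alpha> t + \<beta> t)"
  unfolding ac_def by (simp add: locint_add locint_ico set_integral_add(2) add_diff_add)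

lemma ac_diff: "ac A \<alpha> \<Longrightarrow> ac B \<beta> \<Longrightarrow> ac (\<lambda>t. A t - B t) (\<lambda>t. \<alpha> t - \<beta> t)"
  using ac_add[of A \<alpha> "\<lambda>t. -1 * B t" "\<lambda>t. -1 * \<beta> t"] ac_cmult[of B \<beta> "-1"] by simp

lemma ac_cnj: "ac A \<alpha> \<Longrightarrow> ac (\<lambda>t. cnj (A t)) (\<lambda>t. cnj (\<alpha> t))"
  unfolding ac_def locint_def complex_cnj_diff[symmetric] set_integral_cnj
  by (simp add: set_integrable_cnj)

lemma ac_cong:
  assumes "ac A \<alpha>" "\<And>t. t \<in> I \<Longrightarrow> A t = B t" "\<And>t. t \<in> I \<Longrightarrow> \<alpha> t = \<beta> t"
  shows "ac B \<beta>"
  unfolding ac_def locint_def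
proof (intro conjI ballI impI)
  fix x y assume xy: "x \<in> I" "y \<in> I"
  show "set_integrable \<mu> {x..y} \<beta>"
    using assms(1) xy Icc_sub[OF xy] assms(3) unfolding ac_def locint_def
    by (subst set_integrable_cong[OF refl refl, of _ _ \<alpha>]) auto
  have "(LINT t:{x..<y}|\<mu>. \<beta> t) = (LINT t:{x..<y}|\<mu>. \<alpha> t)"
    by (rule set_lebesgue_integral_cong) (use Icc_sub[OF xy] assms(3) in \<open>auto simp: subset_iff\<close>)
  then show "B y - B x = (LINT t:{x..<y}|\<mu>. \<beta> t)" if "x \<le> y"
    using acD[OF assms(1) xy that] assms(2) xy by simp
qed

text \<open>Lets a derivative known only up to null sets be replaced by the quasi-derivative.
  Integrability of \<open>\<beta>\<close> is assumed because a.e. equality does not supply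
  measurability.\<close>

lemma ac_cong_AE:
  assumes "ac A \<alpha>" "locint I \<mu> \<beta>" "AE t in \<mu>. t \<in> I \<longrightarrow> \<alpha> t = \<beta> t"
  shows "ac A \<beta>"
  unfolding ac_def
proof (intro conjI ballI impI assms)
  fix x y assume xy: "x \<in> I" "y \<in> I" "x \<le> y"
  have "(LINT t:{x..<y}|\<mu>. \<beta> t) = (LINT t:{x..<y}|\<mu>. \<alpha> t)"
    unfolding set_lebesgue_integral_def
  proof (rule integral_cong_AE)
    show "AE t in \<mu>. indicat_real {x..<y} t *\<^sub>R \<beta> t = indicat_real {x..<y} t *\<^sub>R \<alpha> t"
      by (rule AE_mp[OF assms(3)], rule AE_I2)
        (use Icc_sub[OF xy(1,2)] in \<open>auto simp: indicator_def subset_iff\<close>)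
  qed (use locint_ico[OF assms(2) xy(1,2)] locint_ico[OF ac_locint[OF assms(1)] xy(1,2)] in
        \<open>auto simp: set_integrable_def\<close>)
  then show "A y - A x = (LINT t:{x..<y}|\<mu>. \<beta> t)" using acD[OF assms(1) xy] by simp
qed

lemma ac_unique:
  assumes "ac A \<alpha>" "ac B \<alpha>" "c \<in> I" "A c = B c" "x \<in> I"
  shows "A x = B x"
proof (cases "c \<le> x")
  case True
  then show ?thesis using acD[OF assms(1,3,5)] acD[OF assms(2,3,5)] assms(4) by (simp add: algebra_simps)
next
  case False
  then have "A c - A x = B c - B x" using acD[OF assms(1,5,3)] acD[OF assms(2,5,3)] by simp
  then show ?thesis using assms(4) by simp
qed

lemma ac_left:
  assumes "ac A \<alpha>" "x \<in> I" shows "(A \<longlongrightarrow> A x) (at_left x)"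
proof -
  obtain c where c: "c \<in> I" "c < x" using nbhd_I[OF assms(2)] by metis
  have "((\<lambda>y. A x - (LINT t:{y..<x}|\<mu>. \<alpha> t)) \<longlongrightarrow> A x - 0) (at_left x)"
    by (intro tendsto_intros lim_left_integral) (use assms in \<open>auto simp: ac_def locint_def\<close>)
  moreover have "\<forall>\<^sub>F y in at_left x. A x - (LINT t:{y..<x}|\<mu>. \<alpha> t) = A y"
    using eventually_at_left_real[OF c(2)]
  proof eventually_elim
    case (elim y)
    then have "A x - A y = (LINT t:{y..<x}|\<mu>. \<alpha> t)"
      by (intro acD[OF assms(1) _ assms(2)]) (use between_I[OF c(1) assms(2), of y] in auto)
    then show ?case by (metis add_diff_cancel diff_diff_eq2 add.commute)
  qed
  ultimately show ?thesis by (simp add: tendsto_cong)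
qed

lemma ac_right:
  assumes "ac A \<alpha>" "x \<in> I" shows "(A \<longlongrightarrow> A x + of_real (measure \<mu> {x}) * \<alpha> x) (at_right x)"
proof -
  obtain c where c: "c \<in> I" "x < c" using nbhd_I[OF assms(2)] by metis
  have "((\<lambda>y. A x + (LINT t:{x..<y}|\<mu>. \<alpha> t)) \<longlongrightarrow> A x + measure \<mu> {x} *\<^sub>R \<alpha> x) (at_right x)"
    by (intro tendsto_add tendsto_const lim_right_integral') (use assms in \<open>auto simp: ac_def locint_def\<close>)
  moreover have "\<forall>\<^sub>F y in at_right x. A x + (LINT t:{x..<y}|\<mu>. \<alpha> t) = A y"
    using eventually_at_right_real[OF c(2)]
  proof eventually_elim
    case (elim y)
    have "A y - A x = (LINT t:{x..<y}|\<mu>. \<alpha> t)"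
      by (rule acD[OF assms(1) assms(2)]) (use between_I[OF assms(2) c(1), of y] elim in auto)
    then show ?case by (metis add_diff_cancel_left' diff_add_cancel add.commute)
  qed
  ultimately show ?thesis by (simp add: tendsto_cong scaleR_conv_of_real)
qed

lemma ac_bounded:
  assumes "ac A \<alpha>" "x \<in> I" "y \<in> I"
  shows "\<exists>K. \<forall>t\<in>{x..y}. cmod (A t) \<le> K"
proof -
  have w: "set_integrable \<mu> {x..y} (\<lambda>t. norm (\<alpha> t))"
    by (rule set_integrable_norm) (use assms in \<open>auto simp: ac_def locint_def\<close>)
  define K where "K = norm (A x) + (LINT t:{x..y}|\<mu>. norm (\<alpha> t))"
  have "norm (A t) \<le> K" if t: "t \<in> {x..y}" for t
  proof -
    have tI: "t \<in> I" using t between_I[OF assms(2,3), of t] by simp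
    have "{x..<t} \<subseteq> {x..y}" using t by auto
    then have s: "set_integrable \<mu> {x..<t} (\<lambda>t. norm (\<alpha> t))"
      using set_integrable_subset[OF w] by auto
    have xt: "x \<le> t" using t by simp
    have "norm (A t - A x) = norm (LINT t:{x..<t}|\<mu>. \<alpha> t)"
      by (subst acD[OF assms(1,2) tI xt]) (rule refl)
    also have "\<dots> \<le> (LINT t:{x..<t}|\<mu>. norm (\<alpha> t))"
      by (rule norm_set_integral_le[OF locint_ico[OF ac_locint[OF assms(1)] assms(2) tI] s]) simp
    also have "\<dots> \<le> (LINT t:{x..y}|\<mu>. norm (\<alpha> t))"
      using s w t unfolding set_lebesgue_integral_def set_integrable_def
      by (intro integral_mono) (auto simp: indicator_def)
    finally show ?thesis unfolding K_def using norm_triangle_ineq2[of "A t" "A x"] by simp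
  qed
  then show ?thesis by blast
qed

end

lemma set_integrable_bdd_mult:
  fixes f g :: "real \<Rightarrow> complex"
  assumes M[measurable_cong]: "sets M = sets borel" and f: "set_borel_measurable borel A f"
    and K: "\<And>t. t \<in> A \<Longrightarrow> norm (f t) \<le> K" and g: "set_integrable M A g"
  shows "set_integrable M A (\<lambda>t. f t * g t)"
proof -
  have f0: "(\<lambda>t. indicator A t *\<^sub>R f t) \<in> borel_measurable M"
    using f unfolding set_borel_measurable_def by measurable
  have g0: "(\<lambda>t. indicator A t *\<^sub>R g t) \<in> borel_measurable M"
    using g unfolding set_integrable_def by simp
  have "integrable M (\<lambda>t. (indicator A t *\<^sub>R f t) * (indicator A t *\<^sub>R g t))"
  proof (rule Bochner_Integration.integrable_bound)
    show "integrable M (\<lambda>t. K * norm (indicator A t *\<^sub>R g t))"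
      using g unfolding set_integrable_def by (intro integrable_mult_right Bochner_Integration.integrable_norm)
    show "(\<lambda>t. (indicator A t *\<^sub>R f t) * (indicator A t *\<^sub>R g t)) \<in> borel_measurable M"
      by (rule borel_measurable_times[OF f0 g0])
    show "AE t in M. norm ((indicator A t *\<^sub>R f t) * (indicator A t *\<^sub>R g t)) \<le> norm (K * norm (indicator A t *\<^sub>R g t))"
    proof (rule AE_I2)
      fix t
      have "norm (f t) * norm (g t) \<le> \<bar>K\<bar> * norm (g t)" if "t \<in> A"
        using K[OF that] by (intro mult_right_mono) auto
      then show "norm ((indicator A t *\<^sub>R f t) * (indicator A t *\<^sub>R g t)) \<le> norm (K * norm (indicator A t *\<^sub>R g t))"
        by (auto simp: indicator_def norm_mult abs_mult)
    qed
  qed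
  moreover have "(\<lambda>t. (indicator A t *\<^sub>R f t) * (indicator A t *\<^sub>R g t)) = (\<lambda>t. indicat_real A t *\<^sub>R (f t * g t))"
    by (auto simp: indicator_def)
  ultimately show ?thesis unfolding set_integrable_def by simp
qed

context locfin_ivl
begin

section \<open>Measurability of primitives and the product rule\<close>

lemma set_borel_measurable_I:
  fixes f :: "real \<Rightarrow> complex"
  assumes "\<And>x y. x \<in> I \<Longrightarrow> y \<in> I \<Longrightarrow> set_borel_measurable borel {x..y} f"
  shows "set_borel_measurable borel I f"
  unfolding set_borel_measurable_def
proof (rule measurable_piecewise_restrict)
  \<comment> \<open>Intervals with rational endpoints in \<open>I\<close> cover the open set
    \<open>I\<close>; with the complement they form a countable cover of the line.\<close>
  define C where "C = insert (- I) ((\<lambda>(p,q). {p..q}) ` ((\<rat> \<inter> I) \<times> (\<rat> \<inter> I)))"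
  have "countable (\<rat> \<inter> I)" using countable_rat by (rule countable_subset[rotated]) auto
  then show "countable C" unfolding C_def by auto
  show "\<Omega> \<inter> space borel \<in> sets borel" if "\<Omega> \<in> C" for \<Omega> using that unfolding C_def by auto
  show "space borel \<subseteq> \<Union>C"
  proof
    fix x :: real
    show "x \<in> \<Union>C"
    proof (cases "x \<in> I")
      case True
      obtain y z where yz: "y \<in> I" "z \<in> I" "y < x" "x < z" using nbhd_I[OF True] .
      obtain p where p: "p \<in> \<rat>" "y < p" "p < x" using Rats_dense_in_real[OF yz(3)] by auto
      obtain q where q: "q \<in> \<rat>" "x < q" "q < z" using Rats_dense_in_real[OF yz(4)] by auto
      have "p \<in> I" "q \<in> I" using between_I[OF yz(1,2)] p q yz by auto
      then have "{p..q} \<in> C" using p q unfolding C_def by auto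
      then show ?thesis using p q by (intro UnionI[of "{p..q}"]) auto
    qed (auto simp: C_def)
  qed
  show "(\<lambda>x. indicat_real I x *\<^sub>R f x) \<in> borel_measurable (restrict_space borel \<Omega>)" if "\<Omega> \<in> C" for \<Omega>
  proof (cases "\<Omega> = - I")
    case True
    then show ?thesis
      by (subst measurable_cong[of _ _ "\<lambda>_. 0"]) (auto simp: space_restrict_space)
  next
    case False
    then obtain p q where pq: "p \<in> I" "q \<in> I" "\<Omega> = {p..q}" using \<open>\<Omega> \<in> C\<close> unfolding C_def by blast
    have "(\<lambda>x. indicat_real {p..q} x *\<^sub>R (indicat_real I x *\<^sub>R f x)) = (\<lambda>x. indicat_real {p..q} x *\<^sub>R f x)"
      using Icc_sub[OF pq(1,2)] by (auto simp: indicator_def fun_eq_iff)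
    then show ?thesis using assms[OF pq(1,2)] pq(3)
      by (subst borel_measurable_restrict_space_iff) (auto simp: set_borel_measurable_def)
  qed
qed

text \<open>On \<open>{x..y}\<close> the primitive is a parameter integral with jointly measurable
  integrand, hence Borel; the compact pieces are then assembled.\<close>

lemma ac_measurable:
  assumes "ac A \<alpha>" shows "set_borel_measurable borel I A"
proof (rule set_borel_measurable_I)
  fix x y assume xy: "x \<in> I" "y \<in> I"
  interpret sigma_finite_measure \<mu> by (rule sfin)
  define \<alpha>1 where "\<alpha>1 = (\<lambda>t. indicat_real {x..y} t *\<^sub>R \<alpha> t)"
  have [measurable]: "\<alpha>1 \<in> borel_measurable borel"
    using ac_locint[OF assms] xy unfolding locint_def set_integrable_def \<alpha>1_def
    by (metis (no_types, lifting) borel_measurable_integrable measurable_cong_sets sets_mu)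
  define B where "B = (\<lambda>t. A x + (LINT s|\<mu>. (if s < t then \<alpha>1 s else 0)))"
  have "B \<in> borel_measurable borel" unfolding B_def by measurable
  moreover have "(\<lambda>t. indicat_real {x..y} t *\<^sub>R A t) = (\<lambda>t. indicat_real {x..y} t *\<^sub>R B t)"
  proof
    fix t
    have "A t = B t" if t: "t \<in> {x..y}"
    proof -
      have tI: "t \<in> I" using between_I[OF xy, of t] t by auto
      have "A t - A x = (LINT s:{x..<t}|\<mu>. \<alpha> s)" using acD[OF assms xy(1) tI] t by auto
      also have "\<dots> = (LINT s|\<mu>. (if s < t then \<alpha>1 s else 0))"
        unfolding set_lebesgue_integral_def \<alpha>1_def using t
        by (intro Bochner_Integration.integral_cong) (auto simp: indicator_def)
      finally show ?thesis unfolding B_def by (simp add: algebra_simps)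
    qed
    then show "indicat_real {x..y} t *\<^sub>R A t = indicat_real {x..y} t *\<^sub>R B t" by (auto simp: indicator_def)
  qed
  ultimately show "set_borel_measurable borel {x..y} A" unfolding set_borel_measurable_def by simp
qed

lemma set_measurable_sub:
  fixes f :: "real \<Rightarrow> complex"
  shows "set_borel_measurable borel A f \<Longrightarrow> B \<in> sets borel \<Longrightarrow> B \<subseteq> A \<Longrightarrow> set_borel_measurable borel B f"
  by (rule set_borel_measurable_subset) auto

lemma ac_locint_mult:
  assumes "ac A \<alpha>" "sets M = sets borel" "locint I M \<beta>"
  shows "locint I M (\<lambda>t. A t * \<beta> t)"
  unfolding locint_def
proof (intro ballI)
  fix x y assume xy: "x \<in> I" "y \<in> I"
  obtain K where K: "\<And>t. t \<in> {x..y} \<Longrightarrow> cmod (A t) \<le> K" using ac_bounded[OF assms(1) xy] by blast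
  show "set_integrable M {x..y} (\<lambda>t. A t * \<beta> t)"
    by (rule set_integrable_bdd_mult[OF assms(2) set_measurable_sub[OF ac_measurable[OF assms(1)] _ Icc_sub[OF xy]] K])
      (use assms(3) xy in \<open>auto simp: locint_def\<close>)
qed

lemma locfin_locint_1:
  assumes "locfin I M" shows "locint I M (\<lambda>_. 1)"
  using assms unfolding locint_def locfin_def set_integrable_def
  by (auto simp: integrable_indicator_iff scaleR_conv_of_real less_top simp del: of_real_indicator)

lemma ac_locint_self:
  assumes "ac A \<alpha>" "locfin I M" shows "locint I M A"
  using ac_locint_mult[OF assms(1) _ locfin_locint_1[OF assms(2)]] assms(2) by (simp add: locfin_def)

text \<open>After truncation to \<open>[x,y)\<close> the inner integrals in
  \<open>integral_prod_split\<close> are the increments \<open>A t - A x\<close> and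
  \<open>B t - B x\<close>; the terms with \<open>A x\<close> and \<open>B x\<close> complete the
  product of increments to \<open>A y * B y - A x * B x\<close>. The last summand of the density is
  the contribution of simultaneous jumps.\<close>

lemma ac_mult:
  assumes A: "ac A \<alpha>" and B: "ac B \<beta>"
  shows "ac (\<lambda>t. A t * B t) (\<lambda>t. A t * \<beta> t + B t * \<alpha> t + of_real (measure \<mu> {t}) * \<alpha> t * \<beta> t)"
proof -
  have l3: "set_integrable \<mu> J (\<lambda>t. of_real (measure \<mu> {t}) * \<alpha> t * \<beta> t)"
    if J: "set_integrable \<mu> J \<alpha>" "set_integrable \<mu> J \<beta>" for J
  proof -
    have "integrable \<mu> (\<lambda>t. (indicat_real J t *\<^sub>R \<alpha> t) * (indicat_real J t *\<^sub>R \<beta> t) * measure \<mu> {t})"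
      by (rule integral_prod_split(3)[OF sfin]) (use J in \<open>auto simp: set_integrable_def\<close>)
    moreover have "(\<lambda>t. (indicat_real J t *\<^sub>R \<alpha> t) * (indicat_real J t *\<^sub>R \<beta> t) * measure \<mu> {t}) =
      (\<lambda>t. indicat_real J t *\<^sub>R (of_real (measure \<mu> {t}) * \<alpha> t * \<beta> t))"
      by (auto simp: indicator_def)
    ultimately show ?thesis unfolding set_integrable_def by simp
  qed
  have l1: "locint I \<mu> (\<lambda>t. A t * \<beta> t)" by (rule ac_locint_mult[OF A sets_mu ac_locint[OF B]])
  have l2: "locint I \<mu> (\<lambda>t. B t * \<alpha> t)" by (rule ac_locint_mult[OF B sets_mu ac_locint[OF A]])
  have l3': "locint I \<mu> (\<lambda>t. of_real (measure \<mu> {t}) * \<alpha> t * \<beta> t)"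
    using ac_locint[OF A] ac_locint[OF B] l3 unfolding locint_def by blast
  show ?thesis unfolding ac_def
  proof (intro conjI ballI impI)
    show "locint I \<mu> (\<lambda>t. A t * \<beta> t + B t * \<alpha> t + of_real (measure \<mu> {t}) * \<alpha> t * \<beta> t)"
      by (intro locint_add l1 l2 l3')
    fix x y assume xy: "x \<in> I" "y \<in> I" "x \<le> y"
    let ?J = "{x..<y}"
    define a0 where "a0 = (\<lambda>t. indicat_real ?J t *\<^sub>R \<alpha> t)"
    define b0 where "b0 = (\<lambda>t. indicat_real ?J t *\<^sub>R \<beta> t)"
    note ia = locint_ico[OF ac_locint[OF A] xy(1,2)] and ib = locint_ico[OF ac_locint[OF B] xy(1,2)]
    have cut: "(LINT s:{..<t}|\<mu>. indicat_real ?J s *\<^sub>R \<gamma> s) = C t - C x" if C: "ac C \<gamma>" and t: "t \<in> ?J" for C \<gamma> t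
    proof -
      have "(LINT s:{..<t}|\<mu>. indicat_real ?J s *\<^sub>R \<gamma> s) = (LINT s:{x..<t}|\<mu>. \<gamma> s)"
        unfolding set_lebesgue_integral_def using t
        by (intro Bochner_Integration.integral_cong) (auto simp: indicator_def)
      also have "\<dots> = C t - C x"
        by (rule acD[OF C xy(1), symmetric]) (use between_I[OF xy(1,2), of t] t in auto)
      finally show ?thesis .
    qed
    have e1: "(\<lambda>t. b0 t * (LINT s:{..<t}|\<mu>. a0 s)) = (\<lambda>t. indicat_real ?J t *\<^sub>R (A t * \<beta> t - A x * \<beta> t))"
      unfolding a0_def b0_def
    proof
      fix t show "indicat_real ?J t *\<^sub>R \<beta> t * (LINT s:{..<t}|\<mu>. indicat_real ?J s *\<^sub>R \<alpha> s) = indicat_real ?J t *\<^sub>R (A t * \<beta> t - A x * \<beta> t)"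
      proof (cases "t \<in> ?J")
        case True
        show ?thesis unfolding cut[OF A True] by (simp add: algebra_simps)
      qed simp
    qed
    have e2: "(\<lambda>t. a0 t * (LINT s:{..<t}|\<mu>. b0 s)) = (\<lambda>t. indicat_real ?J t *\<^sub>R (B t * \<alpha> t - B x * \<alpha> t))"
      unfolding a0_def b0_def
    proof
      fix t show "indicat_real ?J t *\<^sub>R \<alpha> t * (LINT s:{..<t}|\<mu>. indicat_real ?J s *\<^sub>R \<beta> s) = indicat_real ?J t *\<^sub>R (B t * \<alpha> t - B x * \<alpha> t)"
      proof (cases "t \<in> ?J")
        case True
        show ?thesis unfolding cut[OF B True] by (simp add: algebra_simps)
      qed simp
    qed
    have e3: "(\<lambda>t. a0 t * b0 t * measure \<mu> {t}) = (\<lambda>t. indicat_real ?J t *\<^sub>R (of_real (measure \<mu> {t}) * \<alpha> t * \<beta> t))"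
      unfolding a0_def b0_def by (auto simp: indicator_def)
    have "integrable \<mu> a0" "integrable \<mu> b0" using ia ib unfolding a0_def b0_def set_integrable_def by auto
    from integral_prod_split(4)[OF sfin sets_mu this]
    have "(LINT t:?J|\<mu>. \<alpha> t) * (LINT t:?J|\<mu>. \<beta> t) =
      (LINT t:?J|\<mu>. A t * \<beta> t - A x * \<beta> t) + (LINT t:?J|\<mu>. B t * \<alpha> t - B x * \<alpha> t)
      + (LINT t:?J|\<mu>. of_real (measure \<mu> {t}) * \<alpha> t * \<beta> t)"
      unfolding e1 e2 e3 by (simp add: set_lebesgue_integral_def a0_def b0_def)
    also have "(LINT t:?J|\<mu>. A t * \<beta> t - A x * \<beta> t) = (LINT t:?J|\<mu>. A t * \<beta> t) - A x * (LINT t:?J|\<mu>. \<beta> t)"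
      using locint_ico[OF l1 xy(1,2)] ib by (subst set_integral_diff(2)) auto
    also have "(LINT t:?J|\<mu>. B t * \<alpha> t - B x * \<alpha> t) = (LINT t:?J|\<mu>. B t * \<alpha> t) - B x * (LINT t:?J|\<mu>. \<alpha> t)"
      using locint_ico[OF l2 xy(1,2)] ia by (subst set_integral_diff(2)) auto
    finally have "A y * B y - A x * B x = (LINT t:?J|\<mu>. A t * \<beta> t) + (LINT t:?J|\<mu>. B t * \<alpha> t)
      + (LINT t:?J|\<mu>. of_real (measure \<mu> {t}) * \<alpha> t * \<beta> t)"
      unfolding acD[OF A xy, symmetric] acD[OF B xy, symmetric] by (simp add: algebra_simps)
    also have "\<dots> = (LINT t:?J|\<mu>. A t * \<beta> t + B t * \<alpha> t + of_real (measure \<mu> {t}) * \<alpha> t * \<beta> t)"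
      using locint_ico[OF l1 xy(1,2)] locint_ico[OF l2 xy(1,2)] locint_ico[OF l3' xy(1,2)]
      by (simp add: set_integral_add)
    finally show "A y * B y - A x * B x = (LINT t:?J|\<mu>. A t * \<beta> t + B t * \<alpha> t + of_real (measure \<mu> {t}) * \<alpha> t * \<beta> t)" .
  qed
qed

lemma Int_atLeast_max: "{a..} \<inter> {b..} = {max a b :: real..}"
  by auto

text \<open>The half-lines \<open>{t..}\<close> are stable under intersection and generate the Borel
  sets, so vanishing of the tail integrals extends by a Dynkin argument to all Borel sets, which
  forces the function to be zero a.e.\<close>

lemma zero_integral_AE:
  assumes l: "locint I \<mu> \<alpha>" and xy: "x \<in> I" "y \<in> I"
    and z: "\<And>x'. x \<le> x' \<Longrightarrow> x' \<le> y \<Longrightarrow> (LINT t:{x'..<y}|\<mu>. \<alpha> t) = 0"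
  shows "AE t in \<mu>. t \<in> {x..<y} \<longrightarrow> \<alpha> t = 0"
proof -
  interpret sigma_finite_measure \<mu> by (rule sfin)
  define a0 where "a0 = (\<lambda>t. indicat_real {x..<y} t *\<^sub>R \<alpha> t)"
  have i0: "integrable \<mu> a0" using locint_ico[OF l xy] unfolding a0_def set_integrable_def .
  have "AE t in \<mu>. a0 t = 0"
  proof (rule density_zero[OF i0])
    fix A assume "A \<in> sets \<mu>"
    then have A: "A \<in> sigma_sets UNIV (range (\<lambda>t. {t..}))" by (simp add: borel_Ici sets_measure_of_conv)
    have "Int_stable (range (\<lambda>t::real. {t..}))" "range (\<lambda>t::real. {t..}) \<subseteq> Pow UNIV"
      by (simp_all add: Int_stable_def Int_atLeast_max)
    from this A show "(LINT t:A|\<mu>. a0 t) = 0"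
    proof (induction rule: sigma_sets_induct_disjoint)
      case (basic A)
      then obtain t where A: "A = {t..}" by auto
      have "(LINT t:A|\<mu>. a0 t) = (LINT s:{max x t..<y}|\<mu>. \<alpha> s)"
        unfolding set_lebesgue_integral_def a0_def A
        by (intro Bochner_Integration.integral_cong) (auto simp: indicator_def)
      also have "\<dots> = 0"
      proof (cases "max x t \<le> y")
        case True
        then show ?thesis by (intro z) auto
      next
        case False
        then have "{max x t..<y} = {}" by (intro atLeastLessThan_empty) linarith
        then show ?thesis by (simp only: set_lebesgue_integral_def) simp
      qed
      finally show ?case .
    next
      case empty then show ?case by (simp add: set_lebesgue_integral_def)
    next
      case (compl A)
      have "A \<in> sets \<mu>" using compl by (simp add: borel_Ici sets_measure_of_conv)
      then have "set_integrable \<mu> A a0" "set_integrable \<mu> (UNIV - A) a0"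
        using i0 unfolding set_integrable_def by (auto intro!: integrable_mult_indicator)
      then have "(LINT t:A \<union> (UNIV - A)|\<mu>. a0 t) = (LINT t:A|\<mu>. a0 t) + (LINT t:UNIV - A|\<mu>. a0 t)"
        by (intro set_integral_Un) auto
      moreover have "(LINT t:UNIV|\<mu>. a0 t) = 0"
      proof (cases "x \<le> y")
        case True then show ?thesis using z[OF order_refl True] by (simp add: set_lebesgue_integral_def a0_def)
      qed (simp add: set_lebesgue_integral_def a0_def)
      ultimately show ?case using compl by (simp add: Un_UNIV_right)
    next
      case (union A)
      have s: "A i \<in> sets \<mu>" for i using union(2) by (auto simp: borel_Ici sets_measure_of_conv)
      have "set_integrable \<mu> (\<Union>i. A i) a0"
        using s i0 unfolding set_integrable_def by (intro integrable_mult_indicator) auto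
      then have "(LINT t:(\<Union>i. A i)|\<mu>. a0 t) = (\<Sum>i. (LINT t:A i|\<mu>. a0 t))"
        using union(1) s by (intro lebesgue_integral_countable_add) (auto simp: disjoint_family_on_def)
      then show ?case using union(3) by simp
    qed
  qed
  then show ?thesis by (rule AE_mp) (auto simp: a0_def intro!: AE_I2)
qed

end

section \<open>The first-order system\<close>

text \<open>\<open>sk\<close> and \<open>sr\<close> are (H4) at the atoms of \<mu>, expressed
  through densities. \<open>supp_s\<close> says that \<sigma> has full support, in the form used
  later: \<open>s\<close> is not a.e. zero on any subinterval.\<close>

locale sl_system = locfin_ivl +
  fixes s k r :: "real \<Rightarrow> real"
  assumes loc_s: "locint I \<mu> (\<lambda>t. of_real (s t))"
    and loc_k: "locint I \<mu> (\<lambda>t. of_real (k t))"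
    and loc_r: "locint I \<mu> (\<lambda>t. of_real (r t))"
    and sk: "\<And>t. t \<in> I \<Longrightarrow> s t * k t * measure \<mu> {t} = 0"
    and sr: "\<And>t. t \<in> I \<Longrightarrow> s t * r t * measure \<mu> {t} = 0"
    and supp_s: "\<And>x y. x \<in> I \<Longrightarrow> y \<in> I \<Longrightarrow> x < y \<Longrightarrow> \<not> (AE t in \<mu>. t \<in> {x<..<y} \<longrightarrow> s t = 0)"
begin

definition sys :: "(real \<Rightarrow> complex) \<Rightarrow> (real \<Rightarrow> complex) \<Rightarrow> (real \<Rightarrow> complex) \<Rightarrow> bool" where
  "sys f q g \<longleftrightarrow> ac f (\<lambda>t. of_real (s t) * q t) \<and>
     ac q (\<lambda>t. of_real (k t) * f t - of_real (r t) * g t)"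

lemma sys_add:
  assumes "sys f q g" "sys f' q' g'"
  shows "sys (\<lambda>t. f t + f' t) (\<lambda>t. q t + q' t) (\<lambda>t. g t + g' t)"
  unfolding sys_def
proof
  show "ac (\<lambda>t. f t + f' t) (\<lambda>t. of_real (s t) * (q t + q' t))"
    by (rule ac_cong[OF ac_add[of f _ f'] refl]) (use assms in \<open>auto simp: sys_def algebra_simps\<close>)
  show "ac (\<lambda>t. q t + q' t) (\<lambda>t. of_real (k t) * (f t + f' t) - of_real (r t) * (g t + g' t))"
    by (rule ac_cong[OF ac_add[of q _ q'] refl]) (use assms in \<open>auto simp: sys_def algebra_simps\<close>)
qed

lemma sys_cmult:
  assumes "sys f q g"
  shows "sys (\<lambda>t. c * f t) (\<lambda>t. c * q t) (\<lambda>t. c * g t)"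
  unfolding sys_def
proof
  show "ac (\<lambda>t. c * f t) (\<lambda>t. of_real (s t) * (c * q t))"
    by (rule ac_cong[OF ac_cmult[of f _ c] refl]) (use assms in \<open>auto simp: sys_def algebra_simps\<close>)
  show "ac (\<lambda>t. c * q t) (\<lambda>t. of_real (k t) * (c * f t) - of_real (r t) * (c * g t))"
    by (rule ac_cong[OF ac_cmult[of q _ c] refl]) (use assms in \<open>auto simp: sys_def algebra_simps\<close>)
qed

lemma sys_diff: "sys f q g \<Longrightarrow> sys f' q' g' \<Longrightarrow> sys (\<lambda>t. f t - f' t) (\<lambda>t. q t - q' t) (\<lambda>t. g t - g' t)"
  using sys_add[of f q g "\<lambda>t. -1 * f' t" "\<lambda>t. -1 * q' t" "\<lambda>t. -1 * g' t"] sys_cmult[of f' q' g' "-1"] by simp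

lemma sys_cnj: "sys f q g \<Longrightarrow> sys (\<lambda>t. cnj (f t)) (\<lambda>t. cnj (q t)) (\<lambda>t. cnj (g t))"
  unfolding sys_def
  using ac_cnj[of f "\<lambda>t. of_real (s t) * q t"] ac_cnj[of q "\<lambda>t. of_real (k t) * f t - of_real (r t) * g t"]
  by simp

lemma sys_zero: "sys (\<lambda>_. 0) (\<lambda>_. 0) (\<lambda>_. 0)"
  unfolding sys_def using ac_const[of 0] by simp

text \<open>In each of the products \<open>f * p\<close> and \<open>q * g\<close> one density has
  the factor \<open>s\<close> and the other is built from \<open>k\<close> and \<open>r\<close>.
  Hence every simultaneous jump carries \<open>s * k\<close> or \<open>s * r\<close> at an atom and
  vanishes; the remaining \<open>s\<close>- and \<open>k\<close>-terms of the two products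
  cancel.\<close>

lemma lagrange:
  assumes f: "sys f q u" and g: "sys g p v"
  shows "ac (\<lambda>t. f t * p t - q t * g t) (\<lambda>t. of_real (r t) * (g t * u t - f t * v t))"
proof (rule ac_cong)
  show "ac (\<lambda>t. f t * p t - q t * g t) (\<lambda>t.
    (f t * (of_real (k t) * g t - of_real (r t) * v t) + p t * (of_real (s t) * q t) +
      of_real (measure \<mu> {t}) * (of_real (s t) * q t) * (of_real (k t) * g t - of_real (r t) * v t)) -
    (q t * (of_real (s t) * p t) + g t * (of_real (k t) * f t - of_real (r t) * u t) +
      of_real (measure \<mu> {t}) * (of_real (k t) * f t - of_real (r t) * u t) * (of_real (s t) * p t)))"
    using f g unfolding sys_def by (intro ac_diff ac_mult) auto
next
  fix t assume t: "t \<in> I"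
  have 1: "complex_of_real (measure \<mu> {t}) * of_real (s t) * of_real (k t) = 0"
    "complex_of_real (measure \<mu> {t}) * of_real (s t) * of_real (r t) = 0"
    using sk[OF t] sr[OF t] by auto
  have "(f t * (of_real (k t) * g t - of_real (r t) * v t) + p t * (of_real (s t) * q t) +
      of_real (measure \<mu> {t}) * (of_real (s t) * q t) * (of_real (k t) * g t - of_real (r t) * v t)) -
    (q t * (of_real (s t) * p t) + g t * (of_real (k t) * f t - of_real (r t) * u t) +
      of_real (measure \<mu> {t}) * (of_real (k t) * f t - of_real (r t) * u t) * (of_real (s t) * p t))
    = of_real (r t) * (g t * u t - f t * v t)
      + of_real (measure \<mu> {t}) * of_real (s t) * of_real (k t) * (q t * g t - p t * f t)
      + of_real (measure \<mu> {t}) * of_real (s t) * of_real (r t) * (p t * u t - q t * v t)"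
    by (simp add: algebra_simps)
  then show "(f t * (of_real (k t) * g t - of_real (r t) * v t) + p t * (of_real (s t) * q t) +
      of_real (measure \<mu> {t}) * (of_real (s t) * q t) * (of_real (k t) * g t - of_real (r t) * v t)) -
    (q t * (of_real (s t) * p t) + g t * (of_real (k t) * f t - of_real (r t) * u t) +
      of_real (measure \<mu> {t}) * (of_real (k t) * f t - of_real (r t) * u t) * (of_real (s t) * p t))
    = of_real (r t) * (g t * u t - f t * v t)"
    unfolding 1 by simp
qed simp

text \<open>Since \<open>f\<close> does not change, \<open>s * q\<close> is zero a.e. If
  \<open>q t\<close> were nonzero, left-continuity would keep \<open>q\<close> nonzero just to the
  left of \<open>t\<close>, forcing \<open>s = 0\<close> a.e. there against
  \<open>supp_s\<close>.\<close>

lemma q_zero: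
  assumes f: "sys f q u" and xy: "x \<in> I" "y \<in> I" and z: "\<And>t. t \<in> {x..y} \<Longrightarrow> f t = 0"
    and t: "t \<in> {x<..<y}"
  shows "q t = 0"
proof (rule ccontr)
  assume n: "q t \<noteq> 0"
  have af: "ac f (\<lambda>t. of_real (s t) * q t)" and aq: "ac q (\<lambda>t. of_real (k t) * f t - of_real (r t) * u t)"
    using f unfolding sys_def by auto
  have tI: "t \<in> I" using between_I[OF xy, of t] t by auto
  have A: "AE t in \<mu>. t \<in> {x..<y} \<longrightarrow> of_real (s t) * q t = 0"
  proof (rule zero_integral_AE[OF ac_locint[OF af] xy])
    fix x' assume x': "x \<le> x'" "x' \<le> y"
    have "x' \<in> I" using between_I[OF xy, of x'] x' by auto
    from acD[OF af this xy(2) x'(2)] z[of x'] z[of y] x'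
    show "(LINT t:{x'..<y}|\<mu>. of_real (s t) * q t) = 0" by simp
  qed
  have "\<forall>\<^sub>F y in at_left t. q y \<noteq> 0"
    using tendsto_imp_eventually_ne[OF ac_left[OF aq tI] n] .
  then obtain b where b: "b < t" "\<And>y. b < y \<Longrightarrow> y < t \<Longrightarrow> q y \<noteq> 0"
    using eventually_at_left[of x t] t by auto
  define y0 where "y0 = max b x"
  have "y0 \<in> I" "y0 < t" using between_I[OF xy, of y0] b(1) t unfolding y0_def by auto
  moreover have "AE v in \<mu>. v \<in> {y0<..<t} \<longrightarrow> s v = 0"
    by (rule AE_mp[OF A], rule AE_I2) (use b(2) t in \<open>auto simp: y0_def\<close>)
  ultimately show False using supp_s[OF _ tI] by blast
qed

text \<open>The companion \<open>q\<close> depends on \<open>f\<close> alone, even for different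
  right-hand sides; this is what gives the definite description in \<open>qd\<close> a unique
  solution.\<close>

lemma q_unique:
  assumes "sys f q u" "sys f q' u'" "t \<in> I"
  shows "q t = q' t"
proof -
  obtain y z where yz: "y \<in> I" "z \<in> I" "y < t" "t < z" using nbhd_I[OF assms(3)] .
  have "q t - q' t = 0" by (rule q_zero[OF sys_diff[OF assms(1,2)] yz(1,2)]) (use yz in auto)
  then show ?thesis by simp
qed

text \<open>If both moduli are at most \<open>B\<close> on \<open>J\<close>, one pass through the
  integral equations bounds them by \<open>B / 2\<close>, so the a priori bound \<open>K\<close> can
  be halved indefinitely. The equations are stated for moduli and an unspecified \<open>E\<close>,
  so that integration from the left and from the right are covered at once.\<close>

lemma contraction:
  fixes f q :: "real \<Rightarrow> complex" and \<beta> :: "real \<Rightarrow> complex"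
  assumes w: "set_integrable \<mu> J w" "(LINT t:J|\<mu>. w t) \<le> 1/2" "\<And>t. t \<in> J \<Longrightarrow> cmod (\<gamma> t) \<le> w t" "\<And>t. t \<in> J \<Longrightarrow> cmod (\<beta> t) \<le> w t"
    and E: "\<And>t. t \<in> J \<Longrightarrow> \<exists>E\<in>sets borel. E \<subseteq> J \<and> set_integrable \<mu> E (\<lambda>t. \<gamma> t * q t) \<and> set_integrable \<mu> E (\<lambda>t. \<beta> t * f t)
       \<and> cmod (f t) = cmod (LINT t:E|\<mu>. \<gamma> t * q t) \<and> cmod (q t) = cmod (LINT t:E|\<mu>. \<beta> t * f t)"
    and K: "\<And>t. t \<in> J \<Longrightarrow> cmod (f t) \<le> K \<and> cmod (q t) \<le> K"
    and t: "t \<in> J"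
  shows "f t = 0 \<and> q t = 0"
proof -
  have "K \<ge> 0" using K[OF t] norm_ge_zero order_trans by blast
  have w0: "w t \<ge> 0" if "t \<in> J" for t using w(3)[OF that] norm_ge_zero order_trans by blast
  have *: "cmod (f t) \<le> K / 2^n \<and> cmod (q t) \<le> K / 2^n" if "t \<in> J" for n t
    using that
  proof (induction n arbitrary: t)
    case 0 then show ?case using K by simp
  next
    case (Suc n)
    define B where "B = K / 2^n"
    have "B \<ge> 0" unfolding B_def using \<open>K \<ge> 0\<close> by simp
    obtain E where E: "E \<in> sets borel" "E \<subseteq> J" "set_integrable \<mu> E (\<lambda>t. \<gamma> t * q t)" "set_integrable \<mu> E (\<lambda>t. \<beta> t * f t)"
       "cmod (f t) = cmod (LINT t:E|\<mu>. \<gamma> t * q t)" "cmod (q t) = cmod (LINT t:E|\<mu>. \<beta> t * f t)"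
      using E[OF Suc.prems] by blast
    have wE: "set_integrable \<mu> E w" by (rule set_integrable_subset[OF w(1)]) (use E in auto)
    have "(LINT t:E|\<mu>. w t) \<le> (LINT t:J|\<mu>. w t)"
      using wE w(1) w0 E(2) unfolding set_lebesgue_integral_def set_integrable_def
      by (intro integral_mono) (auto simp: indicator_def)
    then have "(LINT t:E|\<mu>. B * w t) \<le> B * (1/2)"
      using w(2) \<open>B \<ge> 0\<close> by (simp add: mult_left_mono del: times_divide_eq_right)
    moreover have "cmod (LINT t:E|\<mu>. \<gamma> t * q t) \<le> (LINT t:E|\<mu>. B * w t)"
    proof (rule norm_set_integral_le[OF E(3)])
      fix t assume "t \<in> E"
      then show "cmod (\<gamma> t * q t) \<le> B * w t"
        using Suc.IH[of t] w(3)[of t] E(2) w0[of t] mult_mono[of "cmod (\<gamma> t)" "w t" "cmod (q t)" B]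
        by (auto simp: norm_mult B_def mult.commute)
    qed (use wE in auto)
    moreover have "cmod (LINT t:E|\<mu>. \<beta> t * f t) \<le> (LINT t:E|\<mu>. B * w t)"
    proof (rule norm_set_integral_le[OF E(4)])
      fix t assume "t \<in> E"
      then show "cmod (\<beta> t * f t) \<le> B * w t"
        using Suc.IH[of t] w(4)[of t] E(2) w0[of t] mult_mono[of "cmod (\<beta> t)" "w t" "cmod (f t)" B]
        by (auto simp: norm_mult B_def mult.commute)
    qed (use wE in auto)
    ultimately show ?case using E(5,6) unfolding B_def by (simp add: mult.commute)
  qed
  have "(\<lambda>n. K / 2^n) \<longlonglongrightarrow> 0"
    using tendsto_mult_right_zero[OF LIMSEQ_realpow_zero[of "1/2::real"], of K] by (simp add: power_divide)
  then have "cmod (f t) \<le> 0" "cmod (q t) \<le> 0"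
    using *[OF t] by (intro LIMSEQ_le_const[OF \<open>(\<lambda>n. K / 2^n) \<longlonglongrightarrow> 0\<close>]; blast)+
  then show ?thesis by simp
qed

text \<open>The common zero set of \<open>f\<close> and \<open>q\<close> is open (by contraction) and so is its complement; to the right
  of a point this uses (H4), which makes the jump matrix at an atom invertible.\<close>

lemma ivp_zero:
  assumes f: "sys f q (\<lambda>t. z * f t)" and c: "c \<in> I" "f c = 0" "q c = 0" and x: "x \<in> I"
  shows "f x = 0" "q x = 0"
proof -
  define \<gamma> where "\<gamma> = (\<lambda>t. complex_of_real (s t))"
  define \<beta> where "\<beta> = (\<lambda>t. of_real (k t) - z * of_real (r t))"
  define w where "w = (\<lambda>t. cmod (\<gamma> t) + cmod (\<beta> t))"
  have af: "ac f (\<lambda>t. \<gamma> t * q t)" and aq: "ac q (\<lambda>t. \<beta> t * f t)"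
    using f unfolding sys_def \<gamma>_def \<beta>_def by (auto simp: algebra_simps)
  have l\<beta>: "locint I \<mu> \<beta>" unfolding \<beta>_def using locint_add[OF loc_k locint_cmult[OF loc_r, of "-z"]] by simp
  have lw: "\<forall>x\<in>I. \<forall>y\<in>I. set_integrable \<mu> {x..y} w"
    using l\<beta> loc_s unfolding w_def locint_def \<gamma>_def
    by (intro ballI set_integral_add(1) set_integrable_norm) blast+
  have w1: "cmod (\<gamma> t) \<le> w t" "cmod (\<beta> t) \<le> w t" for t unfolding w_def by auto
  define P where "P = (\<lambda>x. f x = 0 \<and> q x = 0)"
  have sb: "\<gamma> t * \<beta> t * of_real (measure \<mu> {t}) = 0" if "t \<in> I" for t
    using sk[OF that] sr[OF that] unfolding \<gamma>_def \<beta>_def by (auto simp: algebra_simps)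
  \<comment> \<open>On this side the interval must omit \<open>x\<close>, where an atom could have
    large mass. Since \<open>f\<close> and \<open>q\<close> vanish at \<open>x\<close>, the
    integrals over \<open>[x,t)\<close> and \<open>(x,t)\<close> agree, so the contraction can run
    on \<open>{x<..<y}\<close>.\<close>
  have A1: "\<forall>\<^sub>F y in at_right x. P y" if x: "x \<in> I" and Px: "P x" for x
  proof -
    obtain d where d: "d \<in> I" "x < d" using nbhd_I[OF x] by blast
    have "\<forall>\<^sub>F y in at_right x. (LINT t:{x<..<y}|\<mu>. w t) < 1/2"
      by (rule order_tendstoD(2)[OF lim_right_integral[OF lw x]]) simp
    then have "\<forall>\<^sub>F y in at_right x. (LINT t:{x<..<y}|\<mu>. w t) < 1/2 \<and> y \<in> {x<..<d}"
      using eventually_at_right_real[OF d(2)] by (rule eventually_conj)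
    then obtain y where y: "(LINT t:{x<..<y}|\<mu>. w t) < 1/2" "x < y" "y < d"
      using eventually_happens'[OF trivial_limit_at_right_real, of _ x] by auto
    have yI: "y \<in> I" using between_I[OF x d(1), of y] y by auto
    obtain K1 where K1: "\<And>t. t \<in> {x..y} \<Longrightarrow> cmod (f t) \<le> K1" using ac_bounded[OF af x yI] by blast
    obtain K2 where K2: "\<And>t. t \<in> {x..y} \<Longrightarrow> cmod (q t) \<le> K2" using ac_bounded[OF aq x yI] by blast
    have sub: "{x<..<y} \<subseteq> {x..y}" by auto
    have "P t" if t: "t \<in> {x<..<y}" for t
      unfolding P_def
    proof (rule contraction[where J="{x<..<y}" and w=w and \<gamma>=\<gamma> and \<beta>=\<beta> and K="max K1 K2", OF _ _ _ _ _ _ t])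
      show "set_integrable \<mu> {x<..<y} w" by (rule set_integrable_sub[OF lw x yI _ sub]) simp
      show "(LINT t:{x<..<y}|\<mu>. w t) \<le> 1/2" using y by simp
      show "cmod (f t) \<le> max K1 K2 \<and> cmod (q t) \<le> max K1 K2" if "t \<in> {x<..<y}" for t
        using K1[of t] K2[of t] that by auto
      fix t assume t: "t \<in> {x<..<y}"
      then have tI: "t \<in> I" "x \<le> t" using between_I[OF x yI, of t] by auto
      have tsub: "{x<..<t} \<subseteq> {x..t}" by auto
      have 1: "(LINT v:{x..<t}|\<mu>. \<gamma> v * q v) = (LINT v:{x<..<t}|\<mu>. \<gamma> v * q v)"
        unfolding set_lebesgue_integral_def using Px
        by (intro Bochner_Integration.integral_cong) (auto simp: indicator_def P_def)
      have 2: "(LINT v:{x..<t}|\<mu>. \<beta> v * f v) = (LINT v:{x<..<t}|\<mu>. \<beta> v * f v)"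
        unfolding set_lebesgue_integral_def using Px
        by (intro Bochner_Integration.integral_cong) (auto simp: indicator_def P_def)
      show "\<exists>E\<in>sets borel. E \<subseteq> {x<..<y} \<and> set_integrable \<mu> E (\<lambda>t. \<gamma> t * q t) \<and> set_integrable \<mu> E (\<lambda>t. \<beta> t * f t)
       \<and> cmod (f t) = cmod (LINT t:E|\<mu>. \<gamma> t * q t) \<and> cmod (q t) = cmod (LINT t:E|\<mu>. \<beta> t * f t)"
      proof (intro bexI[of _ "{x<..<t}"] conjI)
        show "set_integrable \<mu> {x<..<t} (\<lambda>t. \<gamma> t * q t)" "set_integrable \<mu> {x<..<t} (\<lambda>t. \<beta> t * f t)"
          using ac_locint[OF af] ac_locint[OF aq] unfolding locint_def
          by (auto intro: set_integrable_sub[OF _ x tI(1) _ tsub])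
        show "cmod (f t) = cmod (LINT t:{x<..<t}|\<mu>. \<gamma> t * q t)"
          using acD[OF af x tI] Px 1 by (simp add: P_def)
        show "cmod (q t) = cmod (LINT t:{x<..<t}|\<mu>. \<beta> t * f t)"
          using acD[OF aq x tI] Px 2 by (simp add: P_def)
      qed (use t in auto)
    qed (use w1 in auto)
    then show ?thesis by (rule eventually_mono[OF eventually_at_right_real[OF y(2)]])
  qed
  have A2: "\<forall>\<^sub>F y in at_left x. P y" if x: "x \<in> I" and Px: "P x" for x
  proof -
    obtain d where d: "d \<in> I" "d < x" using nbhd_I[OF x] by blast
    have "\<forall>\<^sub>F y in at_left x. (LINT t:{y..<x}|\<mu>. w t) < 1/2"
      by (rule order_tendstoD(2)[OF lim_left_integral[OF lw x]]) simp
    then have "\<forall>\<^sub>F y in at_left x. (LINT t:{y..<x}|\<mu>. w t) < 1/2 \<and> y \<in> {d<..<x}"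
      using eventually_at_left_real[OF d(2)] by (rule eventually_conj)
    then obtain y where y: "(LINT t:{y..<x}|\<mu>. w t) < 1/2" "y < x" "d < y"
      using eventually_happens'[OF trivial_limit_at_left_real, of _ x] by auto
    have yI: "y \<in> I" using between_I[OF d(1) x, of y] y by auto
    obtain K1 where K1: "\<And>t. t \<in> {y..x} \<Longrightarrow> cmod (f t) \<le> K1" using ac_bounded[OF af yI x] by blast
    obtain K2 where K2: "\<And>t. t \<in> {y..x} \<Longrightarrow> cmod (q t) \<le> K2" using ac_bounded[OF aq yI x] by blast
    have "P t" if t: "t \<in> {y<..<x}" for t
      unfolding P_def
    proof (rule contraction[where J="{y..<x}" and w=w and \<gamma>=\<gamma> and \<beta>=\<beta> and K="max K1 K2"])
      show "set_integrable \<mu> {y..<x} w" by (rule set_integrable_sub[OF lw yI x]) auto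
      show "(LINT t:{y..<x}|\<mu>. w t) \<le> 1/2" using y by simp
      show "t \<in> {y..<x}" using t by auto
      show "cmod (f t) \<le> max K1 K2 \<and> cmod (q t) \<le> max K1 K2" if "t \<in> {y..<x}" for t
        using K1[of t] K2[of t] that by auto
      fix t assume t: "t \<in> {y..<x}"
      then have tI: "t \<in> I" "t \<le> x" using between_I[OF yI x, of t] by auto
      show "\<exists>E\<in>sets borel. E \<subseteq> {y..<x} \<and> set_integrable \<mu> E (\<lambda>t. \<gamma> t * q t) \<and> set_integrable \<mu> E (\<lambda>t. \<beta> t * f t)
       \<and> cmod (f t) = cmod (LINT t:E|\<mu>. \<gamma> t * q t) \<and> cmod (q t) = cmod (LINT t:E|\<mu>. \<beta> t * f t)"
      proof (intro bexI[of _ "{t..<x}"] conjI)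
        show "set_integrable \<mu> {t..<x} (\<lambda>t. \<gamma> t * q t)" "set_integrable \<mu> {t..<x} (\<lambda>t. \<beta> t * f t)"
          using locint_ico[OF ac_locint[OF af] tI(1) x] locint_ico[OF ac_locint[OF aq] tI(1) x] by auto
        show "cmod (f t) = cmod (LINT t:{t..<x}|\<mu>. \<gamma> t * q t)"
          using acD[OF af tI(1) x tI(2), symmetric] Px by (simp add: P_def)
        show "cmod (q t) = cmod (LINT t:{t..<x}|\<mu>. \<beta> t * f t)"
          using acD[OF aq tI(1) x tI(2), symmetric] Px by (simp add: P_def)
      qed (use t in auto)
    qed (use w1 in auto)
    then show ?thesis by (rule eventually_mono[OF eventually_at_left_real[OF y(2)]])
  qed
  \<comment> \<open>Left-continuity: whichever of \<open>f\<close> and \<open>q\<close> is nonzero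
    at \<open>x\<close> stays nonzero just to the left.\<close>
  have A3: "\<forall>\<^sub>F y in at_left x. \<not> P y" if x: "x \<in> I" and Px: "\<not> P x" for x
  proof (cases "f x = 0")
    case False
    show ?thesis by (rule eventually_mono[OF tendsto_imp_eventually_ne[OF ac_left[OF af x] False]]) (simp add: P_def)
  next
    case True
    then have "q x \<noteq> 0" using Px by (simp add: P_def)
    from tendsto_imp_eventually_ne[OF ac_left[OF aq x] this]
    show ?thesis by (rule eventually_mono) (simp add: P_def)
  qed
  have A4: "\<forall>\<^sub>F y in at_right x. \<not> P y" if x: "x \<in> I" and Px: "\<not> P x" for x
  proof (cases "f x + of_real (measure \<mu> {x}) * (\<gamma> x * q x) = 0")
    case False
    show ?thesis by (rule eventually_mono[OF tendsto_imp_eventually_ne[OF ac_right[OF af x] False]]) (simp add: P_def)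
  next
    case True
    \<comment> \<open>If both right limits were zero, \<open>(f x, q x)\<close> would solve a
      homogeneous 2x2 system with determinant \<open>1 - \<gamma> x * \<beta> x * m^2\<close>, where
      \<open>m\<close> is the mass of the atom; by (H4) this determinant is 1.\<close>
    have "q x + of_real (measure \<mu> {x}) * (\<beta> x * f x) \<noteq> 0"
    proof
      assume 0: "q x + of_real (measure \<mu> {x}) * (\<beta> x * f x) = 0"
      have f: "f x = - (of_real (measure \<mu> {x}) * (\<gamma> x * q x))" using True by (simp add: add_eq_0_iff2)
      have "q x = of_real (measure \<mu> {x}) * q x * (\<gamma> x * \<beta> x * of_real (measure \<mu> {x}))"
        using 0 unfolding f by (simp add: algebra_simps)
      then have "q x = 0" using sb[OF x] by simp
      then show False using f Px by (simp add: P_def)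
    qed
    from tendsto_imp_eventually_ne[OF ac_right[OF aq x] this]
    show ?thesis by (rule eventually_mono) (simp add: P_def)
  qed
  have op: "open {x\<in>I. Q x}" if Q: "\<And>x. x \<in> I \<Longrightarrow> Q x \<Longrightarrow> eventually Q (at_left x) \<and> eventually Q (at_right x)" for Q
    unfolding open_subopen[of "{x\<in>I. Q x}"]
  proof
    fix x assume x: "x \<in> {x\<in>I. Q x}"
    then have "eventually Q (at x)" using Q[of x] by (simp add: eventually_at_split)
    then have "\<forall>\<^sub>F y in nhds x. Q y" using x by (auto simp: eventually_at_filter elim!: eventually_mono)
    moreover have "\<forall>\<^sub>F y in nhds x. y \<in> I" using open_I x by (auto intro: eventually_nhds_in_open)
    ultimately have "\<forall>\<^sub>F y in nhds x. y \<in> I \<and> Q y" by (simp add: eventually_conj)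
    then obtain T where "open T" "x \<in> T" "\<forall>y\<in>T. y \<in> I \<and> Q y" unfolding eventually_nhds by blast
    then show "\<exists>T. open T \<and> x \<in> T \<and> T \<subseteq> {x\<in>I. Q x}" by blast
  qed
  have "connected I" using ivl_I is_interval_connected_1 by blast
  from connectedD[OF this op[of P] op[of "\<lambda>x. \<not> P x"]]
  have "{x\<in>I. P x} \<inter> I = {} \<or> {x\<in>I. \<not> P x} \<inter> I = {}"
    using A1 A2 A3 A4 by blast
  then have "P x" using c x unfolding P_def by blast
  then show "f x = 0" "q x = 0" unfolding P_def by auto
qed

text \<open>Variation of constants with coefficients \<open>P\<close> and \<open>Q\<close>. Their
  densities are chosen so that the contributions of \<open>\<kappa>\<close> cancel in the first
  component and leave \<open>- r * w * \<kappa>\<close> in the second, \<open>w\<close> being the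
  constant Wronskian.\<close>

lemma variation_of_constants:
  assumes u: "sys u p (\<lambda>t. z * u t)" and v: "sys v p' (\<lambda>t. z * v t)"
    and w: "\<And>t. t \<in> I \<Longrightarrow> v t * p t - p' t * u t = w"
    and P: "ac P (\<lambda>t. of_real (r t) * (u t * \<kappa> t))" and Q: "ac Q (\<lambda>t. - (of_real (r t) * (v t * \<kappa> t)))"
  shows "sys (\<lambda>t. v t * P t + u t * Q t) (\<lambda>t. p' t * P t + p t * Q t) (\<lambda>t. z * (v t * P t + u t * Q t) + w * \<kappa> t)"
  unfolding sys_def
proof
  have au: "ac u (\<lambda>t. of_real (s t) * p t)" and ap: "ac p (\<lambda>t. of_real (k t) * u t - of_real (r t) * (z * u t))"
   and av: "ac v (\<lambda>t. of_real (s t) * p' t)" and ap': "ac p' (\<lambda>t. of_real (k t) * v t - of_real (r t) * (z * v t))"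
    using u v unfolding sys_def by auto
  have z: "of_real (measure \<mu> {t}) * complex_of_real (s t) * of_real (r t) = 0" if "t \<in> I" for t
    using sr[OF that] by auto
  show "ac (\<lambda>t. v t * P t + u t * Q t) (\<lambda>t. of_real (s t) * (p' t * P t + p t * Q t))"
  proof (rule ac_cong[OF ac_add[OF ac_mult[OF av P] ac_mult[OF au Q]] refl])
    fix t assume t: "t \<in> I"
    \<comment> \<open>All jump products of the first component carry \<open>s * r\<close> and vanish
      by (H4).\<close>
    have "v t * (of_real (r t) * (u t * \<kappa> t)) + P t * (of_real (s t) * p' t) +
       of_real (measure \<mu> {t}) * (of_real (s t) * p' t) * (of_real (r t) * (u t * \<kappa> t)) +
       (u t * - (of_real (r t) * (v t * \<kappa> t)) + Q t * (of_real (s t) * p t) +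
       of_real (measure \<mu> {t}) * (of_real (s t) * p t) * - (of_real (r t) * (v t * \<kappa> t))) =
       of_real (s t) * (p' t * P t + p t * Q t) +
       (of_real (measure \<mu> {t}) * of_real (s t) * of_real (r t)) * (p' t * (u t * \<kappa> t) - p t * (v t * \<kappa> t))"
      by (simp add: algebra_simps)
    then show "v t * (of_real (r t) * (u t * \<kappa> t)) + P t * (of_real (s t) * p' t) +
       of_real (measure \<mu> {t}) * (of_real (s t) * p' t) * (of_real (r t) * (u t * \<kappa> t)) +
       (u t * - (of_real (r t) * (v t * \<kappa> t)) + Q t * (of_real (s t) * p t) +
       of_real (measure \<mu> {t}) * (of_real (s t) * p t) * - (of_real (r t) * (v t * \<kappa> t))) =
       of_real (s t) * (p' t * P t + p t * Q t)"
      unfolding z[OF t] by simp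
  qed
  show "ac (\<lambda>t. p' t * P t + p t * Q t) (\<lambda>t. of_real (k t) * (v t * P t + u t * Q t) - of_real (r t) * (z * (v t * P t + u t * Q t) + w * \<kappa> t))"
  proof (rule ac_cong[OF ac_add[OF ac_mult[OF ap' P] ac_mult[OF ap Q]] refl])
    fix t assume t: "t \<in> I"
    \<comment> \<open>Here the jump products contain \<open>k * r\<close> and \<open>r * r\<close>,
      which (H4) does not remove. They cancel between the two summands, because \<open>P\<close> is
      driven by \<open>u\<close> and \<open>Q\<close> by \<open>- v\<close>.\<close>
    show "p' t * (of_real (r t) * (u t * \<kappa> t)) + P t * (of_real (k t) * v t - of_real (r t) * (z * v t)) +
       of_real (measure \<mu> {t}) * (of_real (k t) * v t - of_real (r t) * (z * v t)) * (of_real (r t) * (u t * \<kappa> t)) +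
       (p t * - (of_real (r t) * (v t * \<kappa> t)) + Q t * (of_real (k t) * u t - of_real (r t) * (z * u t)) +
       of_real (measure \<mu> {t}) * (of_real (k t) * u t - of_real (r t) * (z * u t)) * - (of_real (r t) * (v t * \<kappa> t))) =
       of_real (k t) * (v t * P t + u t * Q t) - of_real (r t) * (z * (v t * P t + u t * Q t) + w * \<kappa> t)"
      unfolding w[OF t, symmetric] by (simp add: algebra_simps)
  qed
qed

end

section \<open>Reduction to a single dominating measure\<close>

lemma ennreal_indicat: "ennreal (indicat_real A x) = indicator A x"
  by (simp add: indicator_def)

lemma emeasure_restr:
  assumes "sets M = sets borel" "I \<in> sets borel" "A \<in> sets borel"
  shows "emeasure (density M (\<lambda>x. ennreal (indicat_real I x))) A = emeasure M (A \<inter> I)"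
proof -
  have "emeasure (density M (indicator I)) A = (\<integral>\<^sup>+x. indicator I x * indicator A x \<partial>M)"
    using assms by (intro emeasure_density) auto
  also have "\<dots> = (\<integral>\<^sup>+x. indicator (A \<inter> I) x \<partial>M)"
    by (intro nn_integral_cong) (auto simp: indicator_def)
  also have "\<dots> = emeasure M (A \<inter> I)" using assms by (intro nn_integral_indicator) auto
  finally show ?thesis by (simp add: ennreal_indicat)
qed

lemma sigma_finite_ivl:
  fixes K :: "real measure"
  assumes I: "open I" "is_interval I" and s: "sets K = sets borel" and n: "emeasure K (- I) = 0"
    and f: "\<And>x y. x \<in> I \<Longrightarrow> y \<in> I \<Longrightarrow> emeasure K {x..y} < \<infinity>"
  shows "sigma_finite_measure K"
proof
  define C where "C = insert (- I) ((\<lambda>(p,q). {p..q}) ` ((\<rat> \<inter> I) \<times> (\<rat> \<inter> I)))"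
  have "countable (\<rat> \<inter> I)" using countable_rat by (rule countable_subset[rotated]) auto
  then have "countable C" unfolding C_def by auto
  moreover have "- I \<in> sets borel" using I(1) by (intro borel_comp borel_open)
  then have "C \<subseteq> sets K" unfolding C_def s by (auto simp only: insert_subset image_subset_iff split: prod.splits) auto
  moreover have "\<Union>C = space K"
  proof -
    have "x \<in> \<Union>C" for x
    proof (cases "x \<in> I")
      case True
      obtain e where e: "e > 0" "ball x e \<subseteq> I" using I(1) True open_contains_ball by blast
      obtain p where p: "p \<in> \<rat>" "x - e < p" "p < x" using Rats_dense_in_real[of "x - e" x] e by auto
      obtain q where q: "q \<in> \<rat>" "x < q" "q < x + e" using Rats_dense_in_real[of x "x + e"] e by auto
      have "p \<in> ball x e" "q \<in> ball x e" using p q by (auto simp: dist_real_def)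
      then have "p \<in> I" "q \<in> I" using e by blast+
      then have "{p..q} \<in> C" using p q unfolding C_def by auto
      then show ?thesis using p q by (intro UnionI[of "{p..q}"]) auto
    qed (auto simp: C_def)
    then show ?thesis using sets_eq_imp_space_eq[OF s] by auto
  qed
  moreover have "\<forall>a\<in>C. emeasure K a \<noteq> \<infinity>"
    using n f unfolding C_def by (auto simp: less_top)
  ultimately show "\<exists>A. countable A \<and> A \<subseteq> sets K \<and> \<Union> A = space K \<and> (\<forall>a\<in>A. emeasure K a \<noteq> \<infinity>)" by blast
qed

text \<open>The behaviour of \<open>M\<close> outside \<open>I\<close> is unrestricted, so only its
  restriction to \<open>I\<close> is asked to have the density. A real-valued \<open>d\<close> can
  multiply complex integrands directly.\<close>

definition has_density :: "real set \<Rightarrow> real measure \<Rightarrow> real measure \<Rightarrow> (real \<Rightarrow> real) \<Rightarrow> bool" where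
  "has_density I \<mu> M d \<longleftrightarrow> sets M = sets borel \<and> d \<in> borel_measurable borel \<and> (\<forall>x. 0 \<le> d x) \<and>
     density M (\<lambda>x. ennreal (indicat_real I x)) = density \<mu> (\<lambda>x. ennreal (d x))"

text \<open>\<mu> is the sum of the restrictions to \<open>I\<close>, so each of them is absolutely
  continuous with respect to it and Radon-Nikodym applies. The restrictions are sigma-finite, hence
  the densities are finite a.e. and can be taken real.\<close>

lemma ex_dominating_measure:
  fixes M :: "'i \<Rightarrow> real measure"
  assumes J: "finite J" and I: "open I" "is_interval I" and M: "\<And>i. i \<in> J \<Longrightarrow> locfin I (M i)"
  obtains \<mu> d where "locfin_ivl I \<mu>" "\<And>i. i \<in> J \<Longrightarrow> has_density I \<mu> (M i) (d i)"
proof -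
  have sM: "sets (M i) = sets borel" if "i \<in> J" for i using M[OF that] unfolding locfin_def by auto
  have Ib: "I \<in> sets borel" using I by auto
  define m where "m = (\<lambda>A. \<Sum>i\<in>J. emeasure (M i) (A \<inter> I))"
  define \<mu> where "\<mu> = measure_of UNIV (sets (borel :: real measure)) m"
  have s\<mu>: "sets \<mu> = sets borel" unfolding \<mu>_def
    by (simp add: sets_measure_of_conv) (metis sets.sigma_sets_eq space_borel)
  have e\<mu>: "emeasure \<mu> A = m A" if "A \<in> sets borel" for A
  proof (rule emeasure_measure_of[OF \<mu>_def])
    show "countably_additive (sets \<mu>) m"
    proof (rule countably_additiveI)
      fix A :: "nat \<Rightarrow> real set" assume A: "range A \<subseteq> sets \<mu>" "disjoint_family A"
      have "(\<Sum>n. m (A n)) = (\<Sum>i\<in>J. \<Sum>n. emeasure (M i) (A n \<inter> I))"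
        unfolding m_def by (rule suminf_sum) auto
      also have "\<dots> = m (\<Union>n. A n)" unfolding m_def
      proof (rule sum.cong[OF refl])
        fix i assume i: "i \<in> J"
        have "(\<Sum>n. emeasure (M i) (A n \<inter> I)) = emeasure (M i) (\<Union>n. A n \<inter> I)"
          using A Ib sM[OF i] s\<mu> by (intro suminf_emeasure) (auto simp: disjoint_family_on_def)
        then show "(\<Sum>n. emeasure (M i) (A n \<inter> I)) = emeasure (M i) ((\<Union>n. A n) \<inter> I)" by simp
      qed
      finally show "(\<Sum>n. m (A n)) = m (\<Union>n. A n)" .
    qed
  qed (use that s\<mu> in \<open>auto simp: positive_def m_def\<close>)
  have sub: "{x..y} \<subseteq> I" if "x \<in> I" "y \<in> I" for x y
    using that I(2) unfolding is_interval_1 by (meson atLeastAtMost_iff subsetI)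
  have fin: "emeasure \<mu> {x..y} < \<infinity>" if "x \<in> I" "y \<in> I" for x y
    using that M J sub[OF that] by (auto simp: e\<mu> m_def locfin_def less_top Int_absorb2)
  have sf: "sigma_finite_measure \<mu>"
    by (rule sigma_finite_ivl[OF I s\<mu> _ fin]) (use Ib in \<open>auto simp: e\<mu> m_def\<close>)
  have lf: "locfin_ivl I \<mu>"
    by (rule locfin_ivl.intro) (use I s\<mu> sf fin in auto)
  have "\<exists>d. has_density I \<mu> (M i) d" if i: "i \<in> J" for i
  proof -
    let ?N = "density (M i) (\<lambda>x. ennreal (indicat_real I x))"
    have sN: "sets ?N = sets \<mu>" using sM[OF i] s\<mu> by simp
    have eN: "emeasure ?N A = emeasure (M i) (A \<inter> I)" if "A \<in> sets borel" for A
      using emeasure_restr[OF sM[OF i] Ib that] .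
    have "absolutely_continuous \<mu> ?N"
      unfolding absolutely_continuous_def
    proof
      fix A assume A: "A \<in> null_sets \<mu>"
      then have "m A = 0" "A \<in> sets borel" using s\<mu> e\<mu> by (auto simp: null_sets_def)
      then show "A \<in> null_sets ?N" using i J eN sN s\<mu> by (auto simp: m_def null_sets_def)
    qed
    from sigma_finite_measure.Radon_Nikodym[OF sf this sN]
    obtain f where f: "f \<in> borel_measurable \<mu>" "density \<mu> f = ?N" by blast
    have "sigma_finite_measure ?N"
      by (rule sigma_finite_ivl[OF I]) (use M[OF i] i Ib sM[OF i] sub in \<open>auto simp: eN locfin_def Int_absorb2\<close>)
    then have "AE x in \<mu>. f x \<noteq> \<infinity>"
      using sigma_finite_measure.sigma_finite_iff_density_finite[OF sf f(1)] f(2) by simp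
    then have "density \<mu> f = density \<mu> (\<lambda>x. ennreal (enn2real (f x)))"
      using f(1) by (intro density_cong) (auto simp: less_top)
    then have "has_density I \<mu> (M i) (\<lambda>x. enn2real (f x))"
      unfolding has_density_def using f sM[OF i] s\<mu> measurable_cong_sets[OF s\<mu> refl]
      by (auto intro!: borel_measurable_enn2real)
    then show ?thesis by blast
  qed
  then obtain d where "\<And>i. i \<in> J \<Longrightarrow> has_density I \<mu> (M i) (d i)" by metis
  with lf show ?thesis using that by blast
qed

section \<open>Transfer of integrals, null sets and atoms to the dominating measure\<close>

context locfin_ivl
begin

lemma density_integral:
  fixes h :: "real \<Rightarrow> complex"
  assumes D: "has_density I \<mu> M d" and A: "A \<in> sets borel" "A \<subseteq> I" and h: "set_integrable M A h"
  shows "set_integrable \<mu> A (\<lambda>t. of_real (d t) * h t)"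
    and "(LINT t:A|\<mu>. of_real (d t) * h t) = (LINT t:A|M. h t)"
proof -
  let ?H = "\<lambda>t. indicator A t *\<^sub>R h t"
  have sM[measurable_cong]: "sets M = sets borel" and d[measurable]: "d \<in> borel_measurable borel" and density_nonneg: "\<And>x. 0 \<le> d x"
   and eq: "density M (\<lambda>x. ennreal (indicat_real I x)) = density \<mu> (\<lambda>x. ennreal (d x))"
    using D unfolding has_density_def by auto
  have Hi: "integrable M ?H" using h unfolding set_integrable_def .
  then have [measurable]: "?H \<in> borel_measurable M" by simp
  then have H\<mu>[measurable]: "?H \<in> borel_measurable \<mu>" using measurable_cong_sets[OF sM refl] measurable_cong_sets[OF sets_mu refl] by blast
  have dM: "d \<in> borel_measurable \<mu>" by measurable
  have c: "(\<lambda>t. indicat_real I t *\<^sub>R ?H t) = ?H" using A(2) by (auto simp: indicator_def fun_eq_iff)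
  have c2: "(\<lambda>t. d t *\<^sub>R ?H t) = (\<lambda>t. indicat_real A t *\<^sub>R (of_real (d t) * h t))"
    by (auto simp: indicator_def scaleR_conv_of_real)
  have i1: "integrable (density M (\<lambda>x. ennreal (indicat_real I x))) ?H \<longleftrightarrow> integrable M (\<lambda>t. indicat_real I t *\<^sub>R ?H t)"
    by (rule integrable_density) auto
  have i2: "integrable (density \<mu> (\<lambda>x. ennreal (d x))) ?H \<longleftrightarrow> integrable \<mu> (\<lambda>t. d t *\<^sub>R ?H t)"
    by (rule integrable_density[OF H\<mu> dM]) (use density_nonneg in auto)
  have j1: "integral\<^sup>L (density M (\<lambda>x. ennreal (indicat_real I x))) ?H = integral\<^sup>L M (\<lambda>t. indicat_real I t *\<^sub>R ?H t)"
    by (rule integral_density) auto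
  have j2: "integral\<^sup>L (density \<mu> (\<lambda>x. ennreal (d x))) ?H = integral\<^sup>L \<mu> (\<lambda>t. d t *\<^sub>R ?H t)"
    by (rule integral_density[OF H\<mu> dM]) (use density_nonneg in auto)
  show "set_integrable \<mu> A (\<lambda>t. of_real (d t) * h t)"
    using i1 i2 Hi unfolding eq c c2 set_integrable_def by simp
  show "(LINT t:A|\<mu>. of_real (d t) * h t) = (LINT t:A|M. h t)"
    using j1 j2 unfolding eq c c2 set_lebesgue_integral_def by simp
qed

lemma density_AE:
  assumes D: "has_density I \<mu> M d"
  shows "(AE t in M. t \<in> I \<longrightarrow> P t) \<longleftrightarrow> (AE t in \<mu>. d t > 0 \<longrightarrow> P t)"
proof -
  have sM[measurable_cong]: "sets M = sets borel" and d[measurable]: "d \<in> borel_measurable borel"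
   and eq: "density M (\<lambda>x. ennreal (indicat_real I x)) = density \<mu> (\<lambda>x. ennreal (d x))"
    using D unfolding has_density_def by auto
  have "(AE t in density M (\<lambda>x. ennreal (indicat_real I x)). P t) \<longleftrightarrow> (AE t in M. 0 < ennreal (indicat_real I t) \<longrightarrow> P t)"
    by (rule AE_density) measurable
  moreover have "(AE t in density \<mu> (\<lambda>x. ennreal (d x)). P t) \<longleftrightarrow> (AE t in \<mu>. 0 < ennreal (d t) \<longrightarrow> P t)"
    by (rule AE_density) measurable
  moreover have "0 < ennreal (indicat_real I t) \<longleftrightarrow> t \<in> I" for t by (simp add: indicator_def)
  ultimately show ?thesis unfolding eq by simp
qed

lemma density_locint:
  assumes D: "has_density I \<mu> M d" and h: "locint I M h"
  shows "locint I \<mu> (\<lambda>t. of_real (d t) * h t)"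
  unfolding locint_def
proof (intro ballI)
  fix x y assume xy: "x \<in> I" "y \<in> I"
  show "set_integrable \<mu> {x..y} (\<lambda>t. of_real (d t) * h t)"
    by (rule density_integral(1)[OF D _ Icc_sub[OF xy]]) (use h xy in \<open>auto simp: locint_def\<close>)
qed

text \<open>The constant 1 is integrated over a single point. This translates (H4), a condition on
  masses, into one on densities.\<close>

lemma density_atom:
  assumes D: "has_density I \<mu> M d" and l: "locfin I M" and t: "t \<in> I"
  shows "measure M {t} = d t * measure \<mu> {t}"
proof -
  have sM: "sets M = sets borel" using D unfolding has_density_def by auto
  have "set_integrable M {t..t} (\<lambda>_. 1::complex)" using locfin_locint_1[OF l] t unfolding locint_def by blast
  then have i: "set_integrable M {t} (\<lambda>_. 1::complex)" by simp
  have "(LINT v:{t}|M. (1::complex)) = of_real (measure M {t})"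
    using sM unfolding set_lebesgue_integral_def by (simp add: scaleR_conv_of_real sets_eq_imp_space_eq[OF sM])
  then have "of_real (measure M {t}) = (LINT v:{t}|\<mu>. complex_of_real (d v) * 1)"
    using density_integral(2)[OF D _ _ i] t by simp
  also have "\<dots> = of_real (d t * measure \<mu> {t})"
    unfolding integral_sing(2)[OF t] by (simp add: scaleR_conv_of_real)
  finally show ?thesis using of_real_eq_iff by blast
qed

lemma pint_diff:
  assumes l: "locint I M h" and sM: "sets M = sets borel" and c: "c \<in> I" and xy: "x \<in> I" "y \<in> I" "x \<le> y"
  shows "pint M c y h - pint M c x h = (LINT t:{x..<y}|M. h t)"
proof -
  have i: "set_integrable M {u..<v} h" if "u \<in> I" "v \<in> I" for u v
    by (rule set_integrable_subset[of _ "{u..v}"]) (use l that sM in \<open>auto simp: locint_def\<close>)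
  have split: "(LINT t:{u..<v}|M. h t) = (LINT t:{u..<w}|M. h t) + (LINT t:{w..<v}|M. h t)"
    if "u \<in> I" "v \<in> I" "w \<in> I" "u \<le> w" "w \<le> v" for u v w
  proof -
    have e: "{u..<v} = {u..<w} \<union> {w..<v}" using that by auto
    show ?thesis unfolding e by (rule set_integral_Un) (use that i in auto)
  qed
  have p: "pint M c u h = (if c \<le> u then (LINT t:{c..<u}|M. h t) else - (LINT t:{u..<c}|M. h t))" for u
    unfolding pint_def by (auto simp: set_lebesgue_integral_def)
  consider "c \<le> x" | "x < c" "c \<le> y" | "y < c" by linarith
  then show ?thesis
  proof cases
    case 1 then show ?thesis unfolding p using split[of c y x] c xy by simp
  next
    case 2 then show ?thesis unfolding p using split[of x y c] c xy by simp
  next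
    case 3 then show ?thesis unfolding p using split[of x c y] c xy by simp
  qed
qed

lemma pint_self: "pint M c c h = 0" unfolding pint_def by simp

lemma pint_ac:
  assumes D: "has_density I \<mu> M d" and l: "locint I M h" and c: "c \<in> I"
  shows "ac (\<lambda>x. pint M c x h) (\<lambda>t. of_real (d t) * h t)"
  unfolding ac_def
proof (intro conjI ballI impI density_locint[OF D l])
  fix x y assume xy: "x \<in> I" "y \<in> I" "x \<le> y"
  have sM: "sets M = sets borel" using D unfolding has_density_def by auto
  have "{x..<y} \<subseteq> I" using Icc_sub[OF xy(1,2)] by auto
  moreover have "set_integrable M {x..<y} h"
    by (rule set_integrable_subset[of _ "{x..y}"]) (use l xy sM in \<open>auto simp: locint_def\<close>)
  ultimately show "pint M c y h - pint M c x h = (LINT t:{x..<y}|\<mu>. of_real (d t) * h t)"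
    using pint_diff[OF l sM c xy] density_integral(2)[OF D] by simp
qed

end

text \<open>\<open>d1\<close> and \<open>d2\<close> belong to the positive and negative part of
  \<sigma>, \<open>e1\<close> and \<open>e2\<close> to those of chi. The coefficients
  \<open>s\<close> and \<open>k\<close> of the system become \<open>d1 - d2\<close> and
  \<open>e1 - e2\<close>.\<close>

locale sl_problem =
  fixes a b :: ereal and \<rho> :: "real measure" and \<sigma> chi :: smeasure
    and \<mu> :: "real measure" and d1 d2 e1 e2 r :: "real \<Rightarrow> real"
  assumes lfi: "locfin_ivl (ival a b) \<mu>"
    and H1: "locfin (ival a b) \<rho>"
    and H2: "real_meas (ival a b) chi"
    and H3: "real_meas (ival a b) \<sigma>" "ssupp (ival a b) \<sigma> = ival a b"
    and H4: "\<forall>x\<in>ival a b. pmass \<sigma> x * pmass chi x = 0 \<and> pmass \<sigma> x * measure \<rho> {x} = 0"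
    and d1: "has_density (ival a b) \<mu> (fst \<sigma>) d1" and d2: "has_density (ival a b) \<mu> (snd \<sigma>) d2"
    and e1: "has_density (ival a b) \<mu> (fst chi) e1" and e2: "has_density (ival a b) \<mu> (snd chi) e2"
    and rr: "has_density (ival a b) \<mu> \<rho> r"
begin

abbreviation "I \<equiv> ival a b"

lemma locfin_parts: "locfin I (fst \<sigma>)" "locfin I (snd \<sigma>)" "locfin I (fst chi)" "locfin I (snd chi)"
  using H2 H3 unfolding real_meas_def by auto

lemma sets_rho: "sets \<rho> = sets borel" using H1 unfolding locfin_def by auto

sublocale locfin_ivl I \<mu> by (rule lfi)

lemma density_nonneg: "0 \<le> d1 t" "0 \<le> d2 t" using d1 d2 unfolding has_density_def by auto

text \<open>Mutual singularity of the Jordan parts, read off the densities. It prevents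
  cancellation: where \<open>d1 - d2\<close> vanishes both parts vanish a.e., so the support
  condition on |\<sigma>| passes to the signed density.\<close>

lemma singular: "AE t in \<mu>. d1 t = 0 \<or> d2 t = 0"
proof -
  obtain A where A: "A \<in> sets borel" "emeasure (fst \<sigma>) (I - A) = 0" "emeasure (snd \<sigma>) (I \<inter> A) = 0"
    using H3(1) unfolding real_meas_def by blast
  have s: "sets (fst \<sigma>) = sets borel" "sets (snd \<sigma>) = sets borel" using locfin_parts unfolding locfin_def by auto
  have n: "I - A \<in> null_sets (fst \<sigma>)" "I \<inter> A \<in> null_sets (snd \<sigma>)" using A s by (auto simp: null_sets_def)
  have "AE t in fst \<sigma>. t \<in> I \<longrightarrow> t \<in> A" using AE_not_in[OF n(1)] by (rule AE_mp) auto
  then have 1: "AE t in \<mu>. d1 t > 0 \<longrightarrow> t \<in> A" unfolding density_AE[OF d1] .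
  have "AE t in snd \<sigma>. t \<in> I \<longrightarrow> t \<notin> A" using AE_not_in[OF n(2)] by (rule AE_mp) auto
  then have 2: "AE t in \<mu>. d2 t > 0 \<longrightarrow> t \<notin> A" unfolding density_AE[OF d2] .
  show ?thesis using 1 2 density_nonneg by (auto elim!: eventually_elim2 simp: less_le)
qed

lemma locint_density: "has_density I \<mu> M d \<Longrightarrow> locfin I M \<Longrightarrow> locint I \<mu> (\<lambda>t. complex_of_real (d t))"
  using density_locint[OF _ locfin_locint_1, of M d] by simp

sublocale sl_system I \<mu> "\<lambda>t. d1 t - d2 t" "\<lambda>t. e1 t - e2 t" r
proof
  show "locint I \<mu> (\<lambda>t. complex_of_real (d1 t - d2 t))"
    using locint_add[OF locint_density[OF d1 locfin_parts(1)] locint_cmult[OF locint_density[OF d2 locfin_parts(2)], of "-1"]] by simp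
  show "locint I \<mu> (\<lambda>t. complex_of_real (e1 t - e2 t))"
    using locint_add[OF locint_density[OF e1 locfin_parts(3)] locint_cmult[OF locint_density[OF e2 locfin_parts(4)], of "-1"]] by simp
  show "locint I \<mu> (\<lambda>t. complex_of_real (r t))" by (rule locint_density[OF rr H1])
  fix t assume t: "t \<in> I"
  have p: "pmass \<sigma> t = (d1 t - d2 t) * measure \<mu> {t}" "pmass chi t = (e1 t - e2 t) * measure \<mu> {t}"
    "measure \<rho> {t} = r t * measure \<mu> {t}"
    unfolding pmass_def using density_atom[OF d1 locfin_parts(1) t] density_atom[OF d2 locfin_parts(2) t] density_atom[OF e1 locfin_parts(3) t]
     density_atom[OF e2 locfin_parts(4) t] density_atom[OF rr H1 t] by (auto simp: left_diff_distrib)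
  show "(d1 t - d2 t) * (e1 t - e2 t) * measure \<mu> {t} = 0" "(d1 t - d2 t) * r t * measure \<mu> {t} = 0"
    using H4[rule_format, OF t] unfolding p by auto
next
  fix x y assume xy: "x \<in> I" "y \<in> I" "x < y"
  show "\<not> (AE t in \<mu>. t \<in> {x<..<y} \<longrightarrow> d1 t - d2 t = 0)"
  proof
    assume "AE t in \<mu>. t \<in> {x<..<y} \<longrightarrow> d1 t - d2 t = 0"
    then have z: "AE t in \<mu>. t \<in> {x<..<y} \<longrightarrow> d1 t = 0 \<and> d2 t = 0"
      using singular by (auto elim!: eventually_elim2)
    \<comment> \<open>Midpoint and half-length, so that the ball in the definition of
      \<open>ssupp\<close> is exactly the given interval.\<close>
    define c e where "c = (x + y) / 2" and "e = (y - x) / 2"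
    have b: "ball c e \<inter> I = {x<..<y}"
      using Icc_sub[OF xy(1,2)] xy(3) by (auto simp: dist_real_def c_def e_def abs_less_iff field_simps)
    have xyI: "{x<..<y} \<subseteq> I" using b by blast
    have "c \<in> I" "e > 0" using between_I[OF xy(1,2), of c] xy unfolding c_def e_def by auto
    then have pos: "emeasure (fst \<sigma>) {x<..<y} > 0 \<or> emeasure (snd \<sigma>) {x<..<y} > 0"
    proof -
      have "c \<in> ssupp I \<sigma>" using H3(2) \<open>c \<in> I\<close> by simp
      then have "emeasure (fst \<sigma>) (ball c e \<inter> I) > 0 \<or> emeasure (snd \<sigma>) (ball c e \<inter> I) > 0"
        using \<open>e > 0\<close> unfolding ssupp_def by simp
      then show ?thesis unfolding b .
    qed
    have "AE t in fst \<sigma>. t \<in> I \<longrightarrow> t \<notin> {x<..<y}"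
      unfolding density_AE[OF d1] using z by (rule AE_mp) auto
    then have "AE t in fst \<sigma>. \<not> t \<in> {x<..<y}" by (rule AE_mp, intro AE_I2) (use xyI in blast)
    then have 1: "emeasure (fst \<sigma>) {t \<in> space (fst \<sigma>). t \<in> {x<..<y}} = 0" by (rule emeasure_eq_0_AE)
    have "AE t in snd \<sigma>. t \<in> I \<longrightarrow> t \<notin> {x<..<y}"
      unfolding density_AE[OF d2] using z by (rule AE_mp) auto
    then have "AE t in snd \<sigma>. \<not> t \<in> {x<..<y}" by (rule AE_mp, intro AE_I2) (use xyI in blast)
    then have 2: "emeasure (snd \<sigma>) {t \<in> space (snd \<sigma>). t \<in> {x<..<y}} = 0" by (rule emeasure_eq_0_AE)
    have "space (fst \<sigma>) = UNIV" "space (snd \<sigma>) = UNIV"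
      using locfin_parts(1,2) sets_eq_imp_space_eq unfolding locfin_def by (metis space_borel)+
    then show False using pos 1 2 by (simp del: greaterThanLessThan_iff)
  qed
qed

section \<open>Equivalence of the measure equation with the first-order system\<close>

lemma sint_ac:
  assumes f: "ac f \<alpha>" and c: "c \<in> I"
  shows "ac (\<lambda>x. sint chi c x f) (\<lambda>t. of_real (e1 t - e2 t) * f t)"
    "ac (\<lambda>x. sint \<sigma> c x f) (\<lambda>t. of_real (d1 t - d2 t) * f t)"
proof -
  have "ac (\<lambda>x. sint chi c x f) (\<lambda>t. of_real (e1 t) * f t - of_real (e2 t) * f t)"
    unfolding sint_def by (intro ac_diff pint_ac e1 e2 ac_locint_self[OF f] locfin_parts c)
  then show "ac (\<lambda>x. sint chi c x f) (\<lambda>t. of_real (e1 t - e2 t) * f t)" by (simp add: left_diff_distrib)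
  have "ac (\<lambda>x. sint \<sigma> c x f) (\<lambda>t. of_real (d1 t) * f t - of_real (d2 t) * f t)"
    unfolding sint_def by (intro ac_diff pint_ac d1 d2 ac_locint_self[OF f] locfin_parts c)
  then show "ac (\<lambda>x. sint \<sigma> c x f) (\<lambda>t. of_real (d1 t - d2 t) * f t)" by (simp add: left_diff_distrib)
qed

text \<open>The given \<open>h\<close> agrees with \<open>q\<close> only |\<sigma>|-a.e. After
  multiplication by \<open>d1 - d2\<close> the two agree \<mu>-a.e. on \<open>I\<close>, so
  \<open>q\<close> may replace \<open>h\<close> as the derivative of \<open>f\<close>.\<close>

lemma tau_data_sys:
  assumes "tau_data a b \<rho> \<sigma> chi f g c h F"
  shows "sys f (\<lambda>x. sint chi c x f - F x) g"
proof -
  define q where "q = (\<lambda>x. sint chi c x f - F x)"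
  have c: "c \<in> I" and h: "locint I (fst \<sigma>) h" "locint I (snd \<sigma>) h" and f: "\<And>x. x \<in> I \<Longrightarrow> f x = f c + sint \<sigma> c x h"
   and g: "locint I \<rho> g" and F: "\<And>x. x \<in> I \<Longrightarrow> F x = F c + pint \<rho> c x g"
   and p1: "AE y in fst \<sigma>. y \<in> I \<longrightarrow> F y = - h y + sint chi c y f"
   and p2: "AE y in snd \<sigma>. y \<in> I \<longrightarrow> F y = - h y + sint chi c y f"
    using assms unfolding tau_data_def slocint_def by blast+
  have q1: "AE y in fst \<sigma>. y \<in> I \<longrightarrow> q y = h y"
    by (rule AE_mp[OF p1], rule AE_I2) (simp add: q_def)
  have q2: "AE y in snd \<sigma>. y \<in> I \<longrightarrow> q y = h y"
    by (rule AE_mp[OF p2], rule AE_I2) (simp add: q_def)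
  have "ac (\<lambda>x. f c + (pint (fst \<sigma>) c x h - pint (snd \<sigma>) c x h)) (\<lambda>t. 0 + (of_real (d1 t) * h t - of_real (d2 t) * h t))"
    by (intro ac_add ac_diff ac_const pint_ac d1 d2 h c)
  then have af: "ac f (\<lambda>t. of_real (d1 t - d2 t) * h t)"
    by (rule ac_cong) (use f in \<open>auto simp: sint_def left_diff_distrib\<close>)
  have "ac (\<lambda>x. F c + pint \<rho> c x g) (\<lambda>t. 0 + of_real (r t) * g t)"
    by (intro ac_add ac_const pint_ac rr g c)
  then have aF: "ac F (\<lambda>t. of_real (r t) * g t)" by (rule ac_cong) (use F in auto)
  have aq: "ac q (\<lambda>t. of_real (e1 t - e2 t) * f t - of_real (r t) * g t)"
    unfolding q_def by (intro ac_diff sint_ac(1)[OF af c] aF)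
  have "AE t in \<mu>. t \<in> I \<longrightarrow> of_real (d1 t - d2 t) * h t = of_real (d1 t - d2 t) * q t"
    using q1[unfolded density_AE[OF d1]] q2[unfolded density_AE[OF d2]]
  proof eventually_elim
    case (elim t)
    then show ?case using density_nonneg[of t] by (cases "d1 t = 0"; cases "d2 t = 0") auto
  qed
  from ac_cong_AE[OF af _ this] ac_locint[OF sint_ac(2)[OF aq c]]
  have "ac f (\<lambda>t. of_real (d1 t - d2 t) * q t)" by simp
  then show ?thesis using aq unfolding sys_def q_def by simp
qed

text \<open>The function \<open>q\<close> itself serves as the \<sigma>-derivative, so the a.e.
  conditions hold everywhere; the two integral equations follow from uniqueness of primitives, for
  any base point.\<close>

lemma sys_tau_data:
  assumes s: "sys f q g" and g: "locint I \<rho> g" and c: "c \<in> I"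
  shows "tau_data a b \<rho> \<sigma> chi f g c q (\<lambda>x. sint chi c x f - q x)"
proof -
  have af: "ac f (\<lambda>t. of_real (d1 t - d2 t) * q t)" and aq: "ac q (\<lambda>t. of_real (e1 t - e2 t) * f t - of_real (r t) * g t)"
    using s unfolding sys_def by auto
  have "ac (\<lambda>x. f c + sint \<sigma> c x q) (\<lambda>t. 0 + of_real (d1 t - d2 t) * q t)"
    by (intro ac_add ac_const sint_ac(2)[OF aq c])
  then have 1: "f x = f c + sint \<sigma> c x q" if "x \<in> I" for x
    using ac_unique[OF af _ c _ that] by (simp add: sint_def pint_self)
  have "ac (\<lambda>x. sint chi c x f - (sint chi c c f - q c + pint \<rho> c x g)) (\<lambda>t. of_real (e1 t - e2 t) * f t - (0 + of_real (r t) * g t))"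
    by (intro ac_diff ac_add ac_const sint_ac(1)[OF af c] pint_ac[OF rr g c])
  then have 2: "q x = sint chi c x f - (sint chi c c f - q c + pint \<rho> c x g)" if "x \<in> I" for x
    using ac_unique[OF aq _ c _ that] by (simp add: sint_def pint_self)
  have 3: "sint chi c x f - q x = (sint chi c c f - q c) + pint \<rho> c x g" if "x \<in> I" for x
    using 2[OF that] by (simp add: algebra_simps)
  show ?thesis unfolding tau_data_def slocint_def
  proof (intro conjI ballI c g ac_locint_self[OF aq locfin_parts(1)] ac_locint_self[OF aq locfin_parts(2)])
    show "f x = f c + sint \<sigma> c x q" if "x \<in> I" for x by (rule 1[OF that])
    show "sint chi c x f - q x = sint chi c c f - q c + pint \<rho> c x g" if "x \<in> I" for x by (rule 3[OF that])
  qed simp_all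
qed

lemma sys_tau_rel:
  assumes s: "sys f q g" and g: "locint I \<rho> g" and c: "c \<in> I"
  shows "tau_rel a b \<rho> \<sigma> chi f g"
  using sys_tau_data[OF assms] unfolding tau_rel_def by blast

text \<open>The cut to 0 off \<open>I\<close> in the definition of \<open>qd\<close>, together with
  \<open>q_unique\<close>, leaves exactly one candidate, so any companion \<open>q\<close> computes
  the quasi-derivative on \<open>I\<close>.\<close>

lemma qd_eq:
  assumes s: "sys f q g" and g: "locint I \<rho> g" and x: "x \<in> I"
  shows "qd a b \<rho> \<sigma> chi f x = q x"
proof -
  have "qd a b \<rho> \<sigma> chi f = (\<lambda>x. if x \<in> I then q x else 0)"
    unfolding qd_def
  proof (rule the_equality)
    show "\<exists>g c h F. tau_data a b \<rho> \<sigma> chi f g c h F \<and>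
       (\<lambda>x. if x \<in> I then q x else 0) = (\<lambda>x. if x \<in> I then sint chi c x f - F x else 0)"
      using sys_tau_data[OF s g x] by (intro exI conjI) (auto simp: fun_eq_iff)
    fix q' assume "\<exists>g c h F. tau_data a b \<rho> \<sigma> chi f g c h F \<and> q' = (\<lambda>x. if x \<in> I then sint chi c x f - F x else 0)"
    then obtain g' c h F where t: "tau_data a b \<rho> \<sigma> chi f g' c h F" and q': "q' = (\<lambda>x. if x \<in> I then sint chi c x f - F x else 0)" by blast
    show "q' = (\<lambda>x. if x \<in> I then q x else 0)"
      unfolding q' using q_unique[OF tau_data_sys[OF t] s] by auto
  qed
  then show ?thesis using x by simp
qed

lemma tau_relD:
  assumes "tau_rel a b \<rho> \<sigma> chi f g"
  shows "sys f (qd a b \<rho> \<sigma> chi f) g" "locint I \<rho> g"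
proof -
  obtain c h F where t: "tau_data a b \<rho> \<sigma> chi f g c h F" using assms unfolding tau_rel_def by blast
  show g: "locint I \<rho> g" using t unfolding tau_data_def by blast
  note s = tau_data_sys[OF t]
  show "sys f (qd a b \<rho> \<sigma> chi f) g" unfolding sys_def
  proof
    show "ac f (\<lambda>t. of_real (d1 t - d2 t) * qd a b \<rho> \<sigma> chi f t)"
      by (rule ac_cong[OF _ refl]) (use s qd_eq[OF s g] in \<open>auto simp: sys_def\<close>)
    show "ac (qd a b \<rho> \<sigma> chi f) (\<lambda>t. of_real (e1 t - e2 t) * f t - of_real (r t) * g t)"
      by (rule ac_cong[OF _ _ refl]) (use s qd_eq[OF s g] in \<open>auto simp: sys_def\<close>)
  qed
qed

end

section \<open>Square integrability and boundary limits\<close>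

lemma L2_density_measurable:
  assumes "(\<lambda>t. indicat_real A t *\<^sub>R f t) \<in> borel_measurable M"
  shows "(\<lambda>t. indicator A t * ennreal ((cmod (f t))\<^sup>2)) \<in> borel_measurable M"
proof -
  have "(\<lambda>t. indicator A t * ennreal ((cmod (f t))\<^sup>2)) = (\<lambda>t. ennreal ((cmod (indicat_real A t *\<^sub>R f t))\<^sup>2))"
    by (auto simp: indicator_def)
  moreover have "\<dots> \<in> borel_measurable M" using assms by measurable
  ultimately show ?thesis by (simp only:)
qed

lemma L2_mult_integrable:
  assumes f: "L2_on M A f" and g: "L2_on M A g"
  shows "set_integrable M A (\<lambda>t. f t * g t)"
  unfolding set_integrable_def
proof (rule integrableI_bounded)
  have m: "(\<lambda>t. indicat_real A t *\<^sub>R f t) \<in> borel_measurable M" "(\<lambda>t. indicat_real A t *\<^sub>R g t) \<in> borel_measurable M"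
    using f g unfolding L2_on_def set_borel_measurable_def by auto
  have e: "(\<lambda>t. indicat_real A t *\<^sub>R (f t * g t)) = (\<lambda>t. (indicat_real A t *\<^sub>R f t) * (indicat_real A t *\<^sub>R g t))"
    by (auto simp: indicator_def)
  show "(\<lambda>t. indicat_real A t *\<^sub>R (f t * g t)) \<in> borel_measurable M"
    unfolding e using m by (rule borel_measurable_times)
  have "(\<integral>\<^sup>+t. ennreal (norm (indicat_real A t *\<^sub>R (f t * g t))) \<partial>M)
     \<le> (\<integral>\<^sup>+t. indicator A t * ennreal ((cmod (f t))\<^sup>2) + indicator A t * ennreal ((cmod (g t))\<^sup>2) \<partial>M)"
  proof (rule nn_integral_mono)
    fix t
    have "2 * (cmod (f t) * cmod (g t)) \<le> (cmod (f t))\<^sup>2 + (cmod (g t))\<^sup>2"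
      using sum_squares_bound[of "cmod (f t)" "cmod (g t)"] by (simp add: mult.assoc)
    moreover have "0 \<le> cmod (f t) * cmod (g t)" by simp
    ultimately have "cmod (f t) * cmod (g t) \<le> (cmod (f t))\<^sup>2 + (cmod (g t))\<^sup>2" by linarith
    then show "ennreal (norm (indicat_real A t *\<^sub>R (f t * g t))) \<le> indicator A t * ennreal ((cmod (f t))\<^sup>2) + indicator A t * ennreal ((cmod (g t))\<^sup>2)"
      by (auto simp: indicator_def norm_mult simp flip: ennreal_plus intro!: ennreal_leI)
  qed
  also have "\<dots> = (\<integral>\<^sup>+t. indicator A t * ennreal ((cmod (f t))\<^sup>2) \<partial>M) + (\<integral>\<^sup>+t. indicator A t * ennreal ((cmod (g t))\<^sup>2) \<partial>M)"
    using L2_density_measurable[OF m(1)] L2_density_measurable[OF m(2)] by (intro nn_integral_add) auto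
  also have "\<dots> < \<infinity>" using f g unfolding L2_on_def by (simp add: less_top)
  finally show "(\<integral>\<^sup>+t. ennreal (norm (indicat_real A t *\<^sub>R (f t * g t))) \<partial>M) < \<infinity>" .
qed

lemma L2_on_mono:
  assumes "L2_on M A f" "B \<in> sets M" "B \<subseteq> A"
  shows "L2_on M B f"
  unfolding L2_on_def set_borel_measurable_def
proof
  have "(\<lambda>t. indicat_real B t *\<^sub>R (indicat_real A t *\<^sub>R f t)) \<in> borel_measurable M"
    by (rule borel_measurable_scaleR[OF borel_measurable_indicator[OF assms(2)]])
      (use assms(1) in \<open>simp add: L2_on_def set_borel_measurable_def\<close>)
  moreover have "(\<lambda>t. indicat_real B t *\<^sub>R (indicat_real A t *\<^sub>R f t)) = (\<lambda>t. indicat_real B t *\<^sub>R f t)"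
    using assms(3) by (auto simp: indicator_def fun_eq_iff)
  ultimately show "(\<lambda>t. indicat_real B t *\<^sub>R f t) \<in> borel_measurable M" by simp
  have "(\<integral>\<^sup>+t. indicator B t * ennreal ((cmod (f t))\<^sup>2) \<partial>M) \<le> (\<integral>\<^sup>+t. indicator A t * ennreal ((cmod (f t))\<^sup>2) \<partial>M)"
    by (rule nn_integral_mono) (use assms(3) in \<open>auto simp: indicator_def\<close>)
  then show "(\<integral>\<^sup>+t. indicator B t * ennreal ((cmod (f t))\<^sup>2) \<partial>M) < \<infinity>"
    using assms(1) unfolding L2_on_def by (simp add: le_less_trans)
qed

lemma L2_on_Un:
  assumes f: "L2_on M A f" "L2_on M B f" and B: "B \<in> sets M"
  shows "L2_on M (A \<union> B) f"
  unfolding L2_on_def set_borel_measurable_def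
proof
  have m: "(\<lambda>t. indicat_real A t *\<^sub>R f t) \<in> borel_measurable M" "(\<lambda>t. indicat_real B t *\<^sub>R f t) \<in> borel_measurable M"
    using f unfolding L2_on_def set_borel_measurable_def by auto
  have "(\<lambda>t. indicat_real (A \<union> B) t *\<^sub>R f t) = (\<lambda>t. indicat_real B t *\<^sub>R f t + indicat_real (- B) t *\<^sub>R (indicat_real A t *\<^sub>R f t))"
    by (auto simp: indicator_def fun_eq_iff)
  moreover have "(\<lambda>t. indicat_real (- B) t) \<in> borel_measurable M"
    using borel_measurable_diff[OF borel_measurable_const[of 1] borel_measurable_indicator[OF B]]
    by (rule measurable_cong[THEN iffD1, rotated]) (auto simp: indicator_def)
  ultimately show "(\<lambda>t. indicat_real (A \<union> B) t *\<^sub>R f t) \<in> borel_measurable M"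
    using borel_measurable_add[OF m(2) borel_measurable_scaleR[OF _ m(1)]] by simp
  have "(\<integral>\<^sup>+t. indicator (A \<union> B) t * ennreal ((cmod (f t))\<^sup>2) \<partial>M)
     \<le> (\<integral>\<^sup>+t. indicator A t * ennreal ((cmod (f t))\<^sup>2) + indicator B t * ennreal ((cmod (f t))\<^sup>2) \<partial>M)"
    by (rule nn_integral_mono) (auto simp: indicator_def)
  also have "\<dots> = (\<integral>\<^sup>+t. indicator A t * ennreal ((cmod (f t))\<^sup>2) \<partial>M) + (\<integral>\<^sup>+t. indicator B t * ennreal ((cmod (f t))\<^sup>2) \<partial>M)"
    using L2_density_measurable[OF m(1)] L2_density_measurable[OF m(2)] by (intro nn_integral_add) auto
  also have "\<dots> < \<infinity>" using f unfolding L2_on_def by (simp add: less_top)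
  finally show "(\<integral>\<^sup>+t. indicator (A \<union> B) t * ennreal ((cmod (f t))\<^sup>2) \<partial>M) < \<infinity>" .
qed

lemma L2_on_cong:
  assumes "L2_on M A f" "\<And>t. t \<in> A \<Longrightarrow> f t = g t"
  shows "L2_on M A g"
proof -
  have "(\<lambda>t. indicat_real A t *\<^sub>R f t) = (\<lambda>t. indicat_real A t *\<^sub>R g t)"
    "(\<lambda>t. indicator A t * ennreal ((cmod (f t))\<^sup>2)) = (\<lambda>t. indicator A t * ennreal ((cmod (g t))\<^sup>2))"
    using assms(2) by (auto simp: indicator_def fun_eq_iff)
  then show ?thesis using assms(1) unfolding L2_on_def set_borel_measurable_def by simp
qed

lemma L2_on_zero: "L2_on M A (\<lambda>_. 0)"
  unfolding L2_on_def set_borel_measurable_def by simp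

lemma L2_on_cnj:
  assumes "L2_on M A f" shows "L2_on M A (\<lambda>t. cnj (f t))"
proof -
  have "(\<lambda>t. indicat_real A t *\<^sub>R f t) \<in> borel_measurable M"
    using assms unfolding L2_on_def set_borel_measurable_def by auto
  then have "(\<lambda>t. cnj (indicat_real A t *\<^sub>R f t)) \<in> borel_measurable M"
    by (intro borel_measurable_continuous_on[OF continuous_on_cnj[OF continuous_on_id]])
  then show ?thesis using assms unfolding L2_on_def set_borel_measurable_def complex_cnj_scaleR by simp
qed

lemma L2_on_cmult:
  assumes "L2_on M A f" shows "L2_on M A (\<lambda>t. c * f t)"
  unfolding L2_on_def set_borel_measurable_def
proof
  have m: "(\<lambda>t. indicat_real A t *\<^sub>R f t) \<in> borel_measurable M" 
    using assms unfolding L2_on_def set_borel_measurable_def by auto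
  then have "(\<lambda>t. c * (indicat_real A t *\<^sub>R f t)) \<in> borel_measurable M" by measurable
  then show "(\<lambda>t. indicat_real A t *\<^sub>R (c * f t)) \<in> borel_measurable M" by simp
  have "(\<lambda>t. indicator A t * ennreal ((cmod (c * f t))\<^sup>2)) = (\<lambda>t. ennreal ((cmod c)\<^sup>2) * (indicator A t * ennreal ((cmod (f t))\<^sup>2)))"
    by (auto simp: norm_mult power_mult_distrib ennreal_mult' indicator_def)
  then show "(\<integral>\<^sup>+t. indicator A t * ennreal ((cmod (c * f t))\<^sup>2) \<partial>M) < \<infinity>"
    using assms L2_density_measurable[OF m] unfolding L2_on_def by (simp add: nn_integral_cmult ennreal_mult_less_top)
qed

lemma L2_on_add:
  assumes f: "L2_on M A f" and g: "L2_on M A g" shows "L2_on M A (\<lambda>t. f t + g t)"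
  unfolding L2_on_def set_borel_measurable_def
proof
  have m: "(\<lambda>t. indicat_real A t *\<^sub>R f t) \<in> borel_measurable M" "(\<lambda>t. indicat_real A t *\<^sub>R g t) \<in> borel_measurable M"
    using f g unfolding L2_on_def set_borel_measurable_def by auto
  then show "(\<lambda>t. indicat_real A t *\<^sub>R (f t + g t)) \<in> borel_measurable M"
    unfolding scaleR_add_right by (rule borel_measurable_add)
  have "(\<integral>\<^sup>+t. indicator A t * ennreal ((cmod (f t + g t))\<^sup>2) \<partial>M)
     \<le> (\<integral>\<^sup>+t. 2 * (indicator A t * ennreal ((cmod (f t))\<^sup>2)) + 2 * (indicator A t * ennreal ((cmod (g t))\<^sup>2)) \<partial>M)"
  proof (rule nn_integral_mono)
    fix t
    have "(cmod (f t + g t))\<^sup>2 \<le> (cmod (f t) + cmod (g t))\<^sup>2"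
      by (intro power_mono norm_triangle_ineq) simp
    also have "\<dots> \<le> 2 * (cmod (f t))\<^sup>2 + 2 * (cmod (g t))\<^sup>2"
      using sum_squares_bound[of "cmod (f t)" "cmod (g t)"] by (simp add: power2_sum)
    finally have "ennreal ((cmod (f t + g t))\<^sup>2) \<le> ennreal (2 * (cmod (f t))\<^sup>2 + 2 * (cmod (g t))\<^sup>2)" by (rule ennreal_leI)
    then show "indicator A t * ennreal ((cmod (f t + g t))\<^sup>2) \<le> 2 * (indicator A t * ennreal ((cmod (f t))\<^sup>2)) + 2 * (indicator A t * ennreal ((cmod (g t))\<^sup>2))"
      by (auto simp: indicator_def ennreal_plus ennreal_mult')
  qed
  also have "\<dots> = (\<integral>\<^sup>+t. 2 * (indicator A t * ennreal ((cmod (f t))\<^sup>2)) \<partial>M) + (\<integral>\<^sup>+t. 2 * (indicator A t * ennreal ((cmod (g t))\<^sup>2)) \<partial>M)"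
    using L2_density_measurable[OF m(1)] L2_density_measurable[OF m(2)] by (intro nn_integral_add) auto
  also have "\<dots> < \<infinity>" using f g L2_density_measurable[OF m(1)] L2_density_measurable[OF m(2)] unfolding L2_on_def
    by (simp add: nn_integral_cmult less_top[symmetric] ennreal_mult_eq_top_iff)
  finally show "(\<integral>\<^sup>+t. indicator A t * ennreal ((cmod (f t + g t))\<^sup>2) \<partial>M) < \<infinity>" .
qed

lemma L2_on_bounded:
  assumes s[measurable_cong]: "sets M = sets borel" and f: "set_borel_measurable borel A f" and A: "A \<in> sets borel" "emeasure M A < \<infinity>"
    and K: "\<And>t. t \<in> A \<Longrightarrow> cmod (f t) \<le> K"
  shows "L2_on M A f"
  unfolding L2_on_def
proof
  show "set_borel_measurable M A f" using f measurable_cong_sets[OF s refl] unfolding set_borel_measurable_def by simp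
  have "(\<integral>\<^sup>+t. indicator A t * ennreal ((cmod (f t))\<^sup>2) \<partial>M) \<le> (\<integral>\<^sup>+t. ennreal (K\<^sup>2) * indicator A t \<partial>M)"
    by (rule nn_integral_mono) (use K in \<open>auto simp: indicator_def intro!: ennreal_leI power_mono\<close>)
  also have "\<dots> = ennreal (K\<^sup>2) * emeasure M A" using A s by (intro nn_integral_cmult_indicator) simp
  also have "\<dots> < \<infinity>" using A by (simp add: ennreal_mult_less_top)
  finally show "(\<integral>\<^sup>+t. indicator A t * ennreal ((cmod (f t))\<^sup>2) \<partial>M) < \<infinity>" .
qed

section \<open>Filters at the endpoints and convergence of tails\<close>

lemma eventually_left_end:
  assumes "c \<in> ival a b" shows "\<forall>\<^sub>F x in left_end a. x \<in> ival a b \<and> x < c"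
proof (cases a)
  case (real r)
  have "\<forall>\<^sub>F x in at_right r. x \<in> {r<..<c}"
    using assms real by (intro eventually_at_right_real) (simp add: ival_def)
  then show ?thesis unfolding left_end_def real
    by (simp, elim eventually_mono) (use assms in \<open>auto simp: ival_def real intro: less_trans[of _ "ereal c"]\<close>)
next
  case MInf
  show ?thesis unfolding left_end_def MInf
    by (simp, rule eventually_mono[OF eventually_gt_at_bot[of c]])
      (use assms in \<open>auto simp: ival_def MInf intro: less_trans[of _ "ereal c"]\<close>)
qed (use assms in \<open>auto simp: ival_def\<close>)

lemma eventually_right_end:
  assumes "c \<in> ival a b" shows "\<forall>\<^sub>F x in right_end b. x \<in> ival a b \<and> c < x"
proof (cases b)
  case (real r)
  have "\<forall>\<^sub>F x in at_left r. x \<in> {c<..<r}"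
    using assms real by (intro eventually_at_left_real) (simp add: ival_def)
  then show ?thesis unfolding right_end_def real
    by (simp, elim eventually_mono) (use assms in \<open>auto simp: ival_def real intro: less_trans[of _ "ereal c"]\<close>)
next
  case PInf
  show ?thesis unfolding right_end_def PInf
    by (simp, rule eventually_mono[OF eventually_gt_at_top[of c]])
      (use assms in \<open>auto simp: ival_def PInf intro: less_trans[of _ "ereal c"]\<close>)
qed (use assms in \<open>auto simp: ival_def\<close>)

lemma left_end_nontrivial[simp]: "left_end a \<noteq> bot"
  unfolding left_end_def by (simp add: trivial_limit_at_right_real)

lemma right_end_nontrivial[simp]: "right_end b \<noteq> bot"
  unfolding right_end_def by (simp add: trivial_limit_at_left_real)

text \<open>Supplies a sequence approaching the endpoint, finite or not, for use with dominated
  convergence.\<close>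

lemma ival_seq_left:
  assumes "c \<in> ival a b"
  obtains X where "\<And>n::nat. X n \<in> ival a b" "\<And>t. t \<in> ival a b \<Longrightarrow> \<forall>\<^sub>F n in sequentially. X n < t"
proof (cases a)
  case (real r)
  define X where "X = (\<lambda>n. r + (c - r) / real (Suc n))"
  have rc: "r < c" using assms real by (simp add: ival_def)
  have "r < X n" "X n \<le> c" for n
  proof -
    show "r < X n" using rc by (simp add: X_def)
    have "(c - r) / real (Suc n) \<le> (c - r) / 1" using rc by (intro divide_left_mono) auto
    then show "X n \<le> c" by (simp add: X_def)
  qed
  then have "X n \<in> ival a b" for n
    using assms real by (auto simp: ival_def intro: le_less_trans[of _ "ereal c"])
  moreover have "X \<longlonglongrightarrow> r + 0" unfolding X_def
    by (intro tendsto_add tendsto_const LIMSEQ_Suc[OF lim_const_over_n])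
  then have "\<forall>\<^sub>F n in sequentially. X n < t" if "t \<in> ival a b" for t
    using that real by (intro order_tendstoD(2)[of X r]) (auto simp: ival_def)
  ultimately show ?thesis using that by blast
next
  case MInf
  have "\<forall>\<^sub>F n in sequentially. c - real n < t" for t
    using eventually_gt_at_top[of "nat \<lceil>c - t\<rceil>"] by eventually_elim linarith
  moreover have "c - real n \<in> ival a b" for n
    using assms MInf by (auto simp: ival_def intro: le_less_trans[of _ "ereal c"])
  ultimately show ?thesis using that[of "\<lambda>n. c - real n"] by blast
qed (use assms in \<open>auto simp: ival_def\<close>)

lemma ival_seq_right:
  assumes "c \<in> ival a b"
  obtains X where "\<And>n::nat. X n \<in> ival a b" "\<And>t. t \<in> ival a b \<Longrightarrow> \<forall>\<^sub>F n in sequentially. t < X n"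
proof -
  have "- c \<in> ival (-b) (-a)" using assms unfolding ival_def
    by (auto simp flip: uminus_ereal.simps(1))
  then obtain X where X: "\<And>n::nat. X n \<in> ival (-b) (-a)" "\<And>t. t \<in> ival (-b) (-a) \<Longrightarrow> \<forall>\<^sub>F n in sequentially. X n < t"
    using ival_seq_left by blast
  have m: "- t \<in> ival (-b) (-a) \<longleftrightarrow> t \<in> ival a b" for t unfolding ival_def
    by (auto simp flip: uminus_ereal.simps(1))
  show ?thesis
  proof (rule that[of "\<lambda>n. - X n"])
    show "- X n \<in> ival a b" for n using X(1)[of n] m[of "- X n"] by simp
    show "\<forall>\<^sub>F n in sequentially. t < - X n" if "t \<in> ival a b" for t
      using X(2)[of "-t"] m[of t] that by (auto elim: eventually_mono)
  qed
qed

text \<open>Dominated convergence along one sequence produces a cut point below which the integral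
  of the modulus is less than \<open>e\<close>. Monotonicity then covers every cut further to the
  left, so the limit holds along the whole filter.\<close>

lemma tail_left:
  fixes \<phi> :: "real \<Rightarrow> complex"
  assumes s: "sets M = sets borel" and I: "ival a b \<in> sets borel" and x: "x \<in> ival a b" and i: "set_integrable M {y\<in>ival a b. y < x} \<phi>"
  shows "((\<lambda>\<alpha>. LINT t:{\<alpha>..<x}|M. \<phi> t) \<longlongrightarrow> (LINT t:{y\<in>ival a b. y < x}|M. \<phi> t)) (left_end a)"
proof (rule tendstoI)
  fix e :: real assume e: "e > 0"
  let ?A = "\<lambda>u. {y\<in>ival a b. y < u}"
  have A: "?A u \<in> sets borel" for u using I by (simp add: Int_def[symmetric] Collect_conj_eq) 
  have iu: "set_integrable M (?A u) \<phi>" if "u \<le> x" for u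
    by (rule set_integrable_subset[OF i]) (use A s that in auto)
  obtain X where X: "\<And>n::nat. X n \<in> ival a b" "\<And>t. t \<in> ival a b \<Longrightarrow> \<forall>\<^sub>F n in sequentially. X n < t"
    using ival_seq_left[OF x] by blast
  have "(\<lambda>n. LINT t|M. indicator (?A (min x (X n))) t *\<^sub>R norm (\<phi> t)) \<longlonglongrightarrow> (LINT t|M. 0)"
  proof (rule integral_dominated_convergence)
    show "integrable M (\<lambda>t. indicator (?A x) t *\<^sub>R norm (\<phi> t))"
      using set_integrable_norm[OF i] unfolding set_integrable_def .
    show "(\<lambda>t. indicator (?A (min x (X n))) t *\<^sub>R norm (\<phi> t)) \<in> borel_measurable M" for n
      using set_integrable_norm[OF iu[of "min x (X n)"]] unfolding set_integrable_def by auto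
    show "AE t in M. (\<lambda>n. indicat_real (?A (min x (X n))) t *\<^sub>R norm (\<phi> t)) \<longlonglongrightarrow> 0"
    proof (rule AE_I2)
      fix t
      have "\<forall>\<^sub>F n in sequentially. indicat_real (?A (min x (X n))) t *\<^sub>R norm (\<phi> t) = 0"
      proof (cases "t \<in> ival a b")
        case True
        show ?thesis by (rule eventually_mono[OF X(2)[OF True]]) simp
      qed simp
      then show "(\<lambda>n. indicat_real (?A (min x (X n))) t *\<^sub>R norm (\<phi> t)) \<longlonglongrightarrow> 0" by (rule tendsto_eventually)
    qed
    show "AE t in M. norm (indicat_real (?A (min x (X n))) t *\<^sub>R norm (\<phi> t)) \<le> indicat_real (?A x) t *\<^sub>R norm (\<phi> t)" for n
      by (rule AE_I2) (auto simp: indicator_def)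
  qed auto
  then have "\<forall>\<^sub>F n in sequentially. (LINT t:?A (min x (X n))|M. norm (\<phi> t)) < e"
    using order_tendstoD(2) e unfolding set_lebesgue_integral_def by fastforce
  then obtain n where n: "(LINT t:?A (min x (X n))|M. norm (\<phi> t)) < e"
    using eventually_happens'[OF sequentially_bot] by blast
  have "min x (X n) \<in> ival a b" using x X(1) by (simp add: min_def)
  from eventually_left_end[OF this]
  show "\<forall>\<^sub>F \<alpha> in left_end a. dist (LINT t:{\<alpha>..<x}|M. \<phi> t) (LINT t:?A x|M. \<phi> t) < e"
  proof eventually_elim
    case (elim \<alpha>)
    have u: "?A x = ?A \<alpha> \<union> {\<alpha>..<x}" using elim x by (auto simp: ival_def intro: less_trans[of _ "ereal x"] less_le_trans[of _ "ereal \<alpha>"])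
    have "(LINT t:?A x|M. \<phi> t) = (LINT t:?A \<alpha>|M. \<phi> t) + (LINT t:{\<alpha>..<x}|M. \<phi> t)"
      unfolding u
    proof (rule set_integral_Un)
      show "set_integrable M {\<alpha>..<x} \<phi>" by (rule set_integrable_subset[OF i]) (use u s in auto)
      show "set_integrable M (?A \<alpha>) \<phi>" by (rule iu) (use elim in auto)
    qed auto
    then have "dist (LINT t:{\<alpha>..<x}|M. \<phi> t) (LINT t:?A x|M. \<phi> t) = norm (LINT t:?A \<alpha>|M. \<phi> t)"
      by (simp add: dist_norm)
    also have "\<dots> \<le> (LINT t:?A (min x (X n))|M. norm (\<phi> t))"
    proof -
      have "norm (LINT t:?A \<alpha>|M. \<phi> t) \<le> (LINT t:?A \<alpha>|M. norm (\<phi> t))"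
        by (rule norm_set_integral_le[OF iu set_integrable_norm[OF iu]]) (use elim in auto)
      also have "\<dots> \<le> (LINT t:?A (min x (X n))|M. norm (\<phi> t))"
        using set_integrable_norm[OF iu[of \<alpha>]] set_integrable_norm[OF iu[of "min x (X n)"]] elim
        unfolding set_lebesgue_integral_def set_integrable_def
        by (intro integral_mono) (auto simp: indicator_def)
      finally show ?thesis .
    qed
    finally show ?case using n by simp
  qed
qed

lemma tail_right:
  fixes \<phi> :: "real \<Rightarrow> complex"
  assumes s: "sets M = sets borel" and I: "ival a b \<in> sets borel" and x: "x \<in> ival a b" and i: "set_integrable M {y\<in>ival a b. x \<le> y} \<phi>"
  shows "((\<lambda>\<beta>. LINT t:{x..<\<beta>}|M. \<phi> t) \<longlongrightarrow> (LINT t:{y\<in>ival a b. x \<le> y}|M. \<phi> t)) (right_end b)"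
proof (rule tendstoI)
  fix e :: real assume e: "e > 0"
  let ?A = "\<lambda>u. {y\<in>ival a b. u \<le> y}"
  have A: "?A u \<in> sets borel" for u using I by (simp add: Int_def[symmetric] Collect_conj_eq) 
  have iu: "set_integrable M (?A u) \<phi>" if "x \<le> u" for u
    by (rule set_integrable_subset[OF i]) (use A s that in auto)
  obtain X where X: "\<And>n::nat. X n \<in> ival a b" "\<And>t. t \<in> ival a b \<Longrightarrow> \<forall>\<^sub>F n in sequentially. t < X n"
    using ival_seq_right[OF x] by blast
  have "(\<lambda>n. LINT t|M. indicator (?A (max x (X n))) t *\<^sub>R norm (\<phi> t)) \<longlonglongrightarrow> (LINT t|M. 0)"
  proof (rule integral_dominated_convergence)
    show "integrable M (\<lambda>t. indicator (?A x) t *\<^sub>R norm (\<phi> t))"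
      using set_integrable_norm[OF i] unfolding set_integrable_def .
    show "(\<lambda>t. indicator (?A (max x (X n))) t *\<^sub>R norm (\<phi> t)) \<in> borel_measurable M" for n
      using set_integrable_norm[OF iu[of "max x (X n)"]] unfolding set_integrable_def by auto
    show "AE t in M. (\<lambda>n. indicat_real (?A (max x (X n))) t *\<^sub>R norm (\<phi> t)) \<longlonglongrightarrow> 0"
    proof (rule AE_I2)
      fix t
      have "\<forall>\<^sub>F n in sequentially. indicat_real (?A (max x (X n))) t *\<^sub>R norm (\<phi> t) = 0"
      proof (cases "t \<in> ival a b")
        case True
        show ?thesis by (rule eventually_mono[OF X(2)[OF True]]) simp
      qed simp
      then show "(\<lambda>n. indicat_real (?A (max x (X n))) t *\<^sub>R norm (\<phi> t)) \<longlonglongrightarrow> 0" by (rule tendsto_eventually)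
    qed
    show "AE t in M. norm (indicat_real (?A (max x (X n))) t *\<^sub>R norm (\<phi> t)) \<le> indicat_real (?A x) t *\<^sub>R norm (\<phi> t)" for n
      by (rule AE_I2) (auto simp: indicator_def)
  qed auto
  then have "\<forall>\<^sub>F n in sequentially. (LINT t:?A (max x (X n))|M. norm (\<phi> t)) < e"
    using order_tendstoD(2) e unfolding set_lebesgue_integral_def by fastforce
  then obtain n where n: "(LINT t:?A (max x (X n))|M. norm (\<phi> t)) < e"
    using eventually_happens'[OF sequentially_bot] by blast
  have "max x (X n) \<in> ival a b" using x X(1) by (simp add: max_def)
  from eventually_right_end[OF this]
  show "\<forall>\<^sub>F \<beta> in right_end b. dist (LINT t:{x..<\<beta>}|M. \<phi> t) (LINT t:?A x|M. \<phi> t) < e"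
  proof eventually_elim
    case (elim \<beta>)
    have u: "?A x = ?A \<beta> \<union> {x..<\<beta>}" using elim x by (auto simp: ival_def intro: less_trans[of _ "ereal \<beta>"] less_le_trans[of _ "ereal x"])
    have "(LINT t:?A x|M. \<phi> t) = (LINT t:?A \<beta>|M. \<phi> t) + (LINT t:{x..<\<beta>}|M. \<phi> t)"
      unfolding u
    proof (rule set_integral_Un)
      show "set_integrable M {x..<\<beta>} \<phi>" by (rule set_integrable_subset[OF i]) (use u s in auto)
      show "set_integrable M (?A \<beta>) \<phi>" by (rule iu) (use elim in auto)
    qed auto
    then have "dist (LINT t:{x..<\<beta>}|M. \<phi> t) (LINT t:?A x|M. \<phi> t) = norm (LINT t:?A \<beta>|M. \<phi> t)"
      by (simp add: dist_norm)
    also have "\<dots> \<le> (LINT t:?A (max x (X n))|M. norm (\<phi> t))"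
    proof -
      have "norm (LINT t:?A \<beta>|M. \<phi> t) \<le> (LINT t:?A \<beta>|M. norm (\<phi> t))"
        by (rule norm_set_integral_le[OF iu set_integrable_norm[OF iu]]) (use elim in auto)
      also have "\<dots> \<le> (LINT t:?A (max x (X n))|M. norm (\<phi> t))"
        using set_integrable_norm[OF iu[of \<beta>]] set_integrable_norm[OF iu[of "max x (X n)"]] elim
        unfolding set_lebesgue_integral_def set_integrable_def
        by (intro integral_mono) (auto simp: indicator_def)
      finally show ?thesis .
    qed
    finally show ?case using n by simp
  qed
qed

section \<open>Uniqueness from vanishing almost everywhere\<close>

text \<open>Points off the support have null neighbourhoods; the Lindelof property reduces the cover
  of \<open>U\<close> to countably many of them.\<close>

lemma null_off_psupp:
  assumes s: "sets M = sets borel" and U: "open U" "U \<subseteq> I" "U \<inter> psupp I M = {}" and I: "open I"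
  shows "emeasure M U = 0"
proof -
  have "\<exists>e>0. emeasure M (ball x e \<inter> I) = 0" if "x \<in> U" for x
  proof -
    have "x \<notin> psupp I M" "x \<in> I" using that U by auto
    then show ?thesis unfolding psupp_def by (auto simp: not_less)
  qed
  then obtain e where e: "\<And>x. x \<in> U \<Longrightarrow> e x > 0 \<and> emeasure M (ball x (e x) \<inter> I) = 0" by metis
  define F where "F = (\<lambda>x. ball x (e x) \<inter> I) ` U"
  have "\<And>S. S \<in> F \<Longrightarrow> open S" using I unfolding F_def by auto
  then obtain F' where F': "F' \<subseteq> F" "countable F'" "\<Union>F' = \<Union>F" by (rule Lindelof)
  have "F' \<subseteq> null_sets M"
  proof
    fix S assume "S \<in> F'"
    then obtain x where x: "x \<in> U" "S = ball x (e x) \<inter> I" using F'(1) unfolding F_def by blast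
    then show "S \<in> null_sets M" using e[OF x(1)] s I by (auto simp: null_sets_def)
  qed
  then have "\<Union>F \<in> null_sets M" using null_sets_UN'[OF F'(2), of id M] F'(3) by auto
  moreover have "U \<subseteq> \<Union>F" using e U(2) unfolding F_def by force
  ultimately have "U \<in> null_sets M" using null_sets_subset s U(1) by (metis borel_open)
  then show ?thesis by auto
qed

context sl_problem
begin

definition gap_condition :: bool where
  "gap_condition \<longleftrightarrow> (\<forall>\<alpha> \<beta>. \<alpha> \<in> psupp I \<rho> \<and> \<beta> \<in> psupp I \<rho> \<and> \<alpha> < \<beta> \<and>
               {\<alpha><..<\<beta>} \<inter> psupp I \<rho> = {} \<longrightarrow>
               (\<forall>f. Dtau a b \<rho> \<sigma> chi f \<and> (f \<longlongrightarrow> 0) (at_left \<alpha>) \<and> (f \<longlongrightarrow> 0) (at_right \<beta>)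
                    \<longrightarrow> (\<forall>x\<in>{\<alpha><..<\<beta>}. f x = 0)))"

lemma psupp_I: "x \<in> psupp I \<rho> \<Longrightarrow> x \<in> I" unfolding psupp_def by simp

lemma AE_hit:
  assumes "AE t in \<rho>. t \<in> J \<longrightarrow> f t = (0::complex)" "A \<in> sets borel" "A \<subseteq> J" "emeasure \<rho> A > 0"
  shows "\<exists>t\<in>A. f t = 0"
proof (rule ccontr)
  assume "\<not> ?thesis"
  then have "\<And>t. (t \<in> J \<longrightarrow> f t = 0) \<longrightarrow> \<not> t \<in> A" using assms(3) by blast
  then have "AE t in \<rho>. \<not> t \<in> A" by - (rule AE_mp[OF assms(1)], rule AE_I2)
  then have "emeasure \<rho> {t \<in> space \<rho>. t \<in> A} = 0" by (rule emeasure_eq_0_AE)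
  moreover have "{t \<in> space \<rho>. t \<in> A} = A" using sets_eq_imp_space_eq[OF sets_rho] by auto
  ultimately show False using assms(4) by simp
qed

text \<open>Every left neighbourhood of \<open>y\<close> has positive mass and therefore contains
  zeros of \<open>f\<close>, which rules out a nonzero limit.\<close>

lemma limit_zero_left:
  fixes f :: "real \<Rightarrow> complex"
  assumes ae: "AE t in \<rho>. t \<in> {\<alpha><..<\<beta>} \<longrightarrow> f t = 0" and y: "\<alpha> < y" "y \<le> \<beta>"
    and p: "\<And>e. e > 0 \<Longrightarrow> emeasure \<rho> {y - e<..<y} > 0" and l: "(f \<longlongrightarrow> L) (at_left y)"
  shows "L = 0"
proof (rule ccontr)
  assume "L \<noteq> 0"
  then have "\<forall>\<^sub>F t in at_left y. f t \<noteq> 0" using tendsto_imp_eventually_ne[OF l] by blast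
  then obtain c where c: "c < y" "\<And>t. c < t \<Longrightarrow> t < y \<Longrightarrow> f t \<noteq> 0"
    using eventually_at_left[OF y(1)] by auto
  have "emeasure \<rho> {y - (y - max c \<alpha>)<..<y} > 0" by (rule p) (use c y in auto)
  then have "emeasure \<rho> {max c \<alpha><..<y} > 0" by simp
  from AE_hit[OF ae _ _ this] y c show False by fastforce
qed

lemma limit_zero_right:
  fixes f :: "real \<Rightarrow> complex"
  assumes ae: "AE t in \<rho>. t \<in> {\<alpha><..<\<beta>} \<longrightarrow> f t = 0" and y: "\<alpha> \<le> y" "y < \<beta>"
    and p: "\<And>e. e > 0 \<Longrightarrow> emeasure \<rho> {y<..<y + e} > 0" and l: "(f \<longlongrightarrow> L) (at_right y)"
  shows "L = 0"
proof (rule ccontr)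
  assume "L \<noteq> 0"
  then have "\<forall>\<^sub>F t in at_right y. f t \<noteq> 0" using tendsto_imp_eventually_ne[OF l] by blast
  then obtain c where c: "c > y" "\<And>t. y < t \<Longrightarrow> t < c \<Longrightarrow> f t \<noteq> 0"
    using eventually_at_right[OF y(2)] by auto
  have "emeasure \<rho> {y<..<y + (min c \<beta> - y)} > 0" by (rule p) (use c y in auto)
  then have "emeasure \<rho> {y<..<min c \<beta>} > 0" by simp
  from AE_hit[OF ae _ _ this] y c show False by fastforce
qed

lemma pos_subset: "emeasure \<rho> A > 0 \<Longrightarrow> A \<subseteq> B \<Longrightarrow> B \<in> sets borel \<Longrightarrow> emeasure \<rho> B > 0"
  by (rule less_le_trans[OF _ emeasure_mono]) (auto simp: sets_rho)

lemma null_subset: "emeasure \<rho> B = 0 \<Longrightarrow> A \<subseteq> B \<Longrightarrow> B \<in> sets borel \<Longrightarrow> \<not> emeasure \<rho> A > 0"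
  using pos_subset[of A B] by (metis less_irrefl)

text \<open>A support point that is not an atom must be charged from at least one side.\<close>

lemma psupp_cases:
  assumes y: "y \<in> psupp I \<rho>" and e: "e > 0" and n: "emeasure \<rho> {y} = 0"
  shows "emeasure \<rho> {y - e<..<y} > 0 \<or> emeasure \<rho> {y<..<y + e} > 0"
proof (rule ccontr)
  assume "\<not> ?thesis"
  then have "{y - e<..<y} \<in> null_sets \<rho>" "{y<..<y + e} \<in> null_sets \<rho>" "{y} \<in> null_sets \<rho>"
    using n sets_rho by (auto simp: null_sets_def)
  then have "{y - e<..<y} \<union> {y<..<y + e} \<union> {y} \<in> null_sets \<rho>" by (intro null_sets.Un)
  moreover have "ball y e \<inter> I \<subseteq> {y - e<..<y} \<union> {y<..<y + e} \<union> {y}" by (auto simp: dist_real_def)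
  ultimately have "ball y e \<inter> I \<in> null_sets \<rho>" using null_sets_subset[of _ \<rho> "ball y e \<inter> I"] sets_rho by auto
  then have "emeasure \<rho> (ball y e \<inter> I) = 0" by (rule null_setsD1)
  moreover have "emeasure \<rho> (ball y e \<inter> I) > 0" using y e unfolding psupp_def by simp
  ultimately show False by simp
qed

text \<open>To apply (H5), the left limit at \<open>\<alpha>'\<close> and the right limit at
  \<open>\<beta>'\<close> must vanish. At an atom of \<rho> the value of \<open>f\<close> is zero;
  otherwise, the gap being null, \<rho> charges every neighbourhood on the outer side, and zeros of
  \<open>f\<close> accumulate there.\<close>

lemma gap_zero:
  assumes gc: gap_condition and f: "sys f q g" and g: "locint I \<rho> g"
    and ae: "AE t in \<rho>. t \<in> {\<alpha><..<\<beta>} \<longrightarrow> f t = 0"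
    and ab: "\<alpha>' \<in> psupp I \<rho>" "\<beta>' \<in> psupp I \<rho>" "\<alpha> < \<alpha>'" "\<alpha>' < \<beta>'" "\<beta>' < \<beta>"
    and gap: "{\<alpha>'<..<\<beta>'} \<inter> psupp I \<rho> = {}" and t: "t \<in> {\<alpha>'<..<\<beta>'}"
  shows "f t = 0"
proof -
  note aI = psupp_I[OF ab(1)] and bI = psupp_I[OF ab(2)]
  have af: "ac f (\<lambda>t. of_real (d1 t - d2 t) * q t)" using f unfolding sys_def by blast
  have n: "emeasure \<rho> {\<alpha>'<..<\<beta>'} = 0"
    by (rule null_off_psupp[OF sets_rho _ _ gap open_I]) (use Icc_sub[OF aI bI] in auto)
  have sub: "A \<subseteq> {\<alpha>'<..<\<beta>'} \<Longrightarrow> \<not> emeasure \<rho> A > 0" for A by (rule null_subset[OF n]) auto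
  have 1: "f \<alpha>' = 0"
  proof (cases "emeasure \<rho> {\<alpha>'} = 0")
    case False
    then show ?thesis using AE_hit[OF ae, of "{\<alpha>'}"] ab by (auto simp: zero_less_iff_neq_zero)
  next
    case True
    show ?thesis
    proof (rule limit_zero_left[OF ae ab(3) _ _ ac_left[OF af aI]])
      fix e :: real assume e: "e > 0"
      define e' where "e' = min e (\<beta>' - \<alpha>')"
      have "e' > 0" using e ab unfolding e'_def by simp
      moreover have "{\<alpha>'<..<\<alpha>' + e'} \<subseteq> {\<alpha>'<..<\<beta>'}" unfolding e'_def by auto
      ultimately have "emeasure \<rho> {\<alpha>' - e'<..<\<alpha>'} > 0"
        using psupp_cases[OF ab(1) _ True] sub by blast
      then show "emeasure \<rho> {\<alpha>' - e<..<\<alpha>'} > 0" by (rule pos_subset) (auto simp: e'_def)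
    qed (use ab in auto)
  qed
  \<comment> \<open>The left-hand side is the right limit of \<open>f\<close> at
    \<open>\<beta>'\<close>, jump included.\<close>
  have 2: "f \<beta>' + of_real (measure \<mu> {\<beta>'}) * (of_real (d1 \<beta>' - d2 \<beta>') * q \<beta>') = 0"
  proof (cases "emeasure \<rho> {\<beta>'} = 0")
    case False
    then have f0: "f \<beta>' = 0" using AE_hit[OF ae, of "{\<beta>'}"] ab by (auto simp: zero_less_iff_neq_zero)
    have "emeasure \<rho> {\<beta>'} < \<infinity>" using H1 bI unfolding locfin_def by (metis atLeastAtMost_singleton)
    then have "measure \<rho> {\<beta>'} \<noteq> 0" using False by (simp add: measure_def enn2real_eq_0_iff less_top)
    then have "r \<beta>' * measure \<mu> {\<beta>'} \<noteq> 0" using density_atom[OF rr H1 bI] by simp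
    \<comment> \<open>By (H4) \<sigma> has no mass at an atom of \<rho>, so \<open>f\<close> does
      not jump there.\<close>
    then have "d1 \<beta>' - d2 \<beta>' = 0" using sr[OF bI] by auto
    then show ?thesis using f0 by simp
  next
    case True
    show ?thesis
    proof (rule limit_zero_right[OF ae _ ab(5) _ ac_right[OF af bI]])
      fix e :: real assume e: "e > 0"
      define e' where "e' = min e (\<beta>' - \<alpha>')"
      have "e' > 0" using e ab unfolding e'_def by simp
      moreover have "{\<beta>' - e'<..<\<beta>'} \<subseteq> {\<alpha>'<..<\<beta>'}" unfolding e'_def by auto
      ultimately have "emeasure \<rho> {\<beta>'<..<\<beta>' + e'} > 0"
        using psupp_cases[OF ab(2) _ True] sub by blast
      then show "emeasure \<rho> {\<beta>'<..<\<beta>' + e} > 0" by (rule pos_subset) (auto simp: e'_def)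
    qed (use ab in auto)
  qed
  have "Dtau a b \<rho> \<sigma> chi f" unfolding Dtau_def using sys_tau_rel[OF f g aI] by blast
  moreover have "(f \<longlongrightarrow> 0) (at_left \<alpha>')" using ac_left[OF af aI] 1 by simp
  moreover have "(f \<longlongrightarrow> 0) (at_right \<beta>')" using ac_right[OF af bI] 2 by simp
  ultimately show ?thesis using gc ab gap t unfolding gap_condition_def by blast
qed

text \<open>Either \<rho> charges every interval just left of \<open>t\<close>, and left-continuity
  gives \<open>f t = 0\<close>; or some interval ending at \<open>t\<close> is null, hence part of a
  gap between support points, where \<open>gap_zero\<close> applies.\<close>

lemma zero_between:
  assumes gc: gap_condition and f: "sys f q g" and g: "locint I \<rho> g"
    and ae: "AE t in \<rho>. t \<in> {\<alpha><..<\<beta>} \<longrightarrow> f t = 0"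
    and x: "x1 \<in> psupp I \<rho>" "x2 \<in> psupp I \<rho>" "\<alpha> < x1" "x1 < x2" "x2 < \<beta>"
    and t: "t \<in> {x1<..<x2}"
  shows "f t = 0"
proof -
  note aI = psupp_I[OF x(1)] and bI = psupp_I[OF x(2)]
  have tI: "t \<in> I" using between_I[OF aI bI, of t] t by auto
  have af: "ac f (\<lambda>t. of_real (d1 t - d2 t) * q t)" using f unfolding sys_def by blast
  show ?thesis
  proof (cases "\<forall>e>0. emeasure \<rho> {t - e<..<t} > 0")
    case True
    show ?thesis by (rule limit_zero_left[OF ae _ _ _ ac_left[OF af tI]]) (use t x True in auto)
  next
    case False
    then obtain e0 where e0: "e0 > 0" "emeasure \<rho> {t - e0<..<t} = 0" by (auto simp: not_less)
    define y0 where "y0 = max x1 (t - e0)"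
    have y0: "y0 < t" "x1 \<le> y0" using e0 t unfolding y0_def by auto
    have n0: "\<not> emeasure \<rho> {y0<..<t} > 0" by (rule null_subset[OF e0(2)]) (auto simp: y0_def)
    have off: "v \<notin> psupp I \<rho>" if v: "v \<in> {y0<..<t}" for v
    proof
      assume "v \<in> psupp I \<rho>"
      then have "emeasure \<rho> (ball v (min (v - y0) (t - v)) \<inter> I) > 0" using v unfolding psupp_def by auto
      then have "emeasure \<rho> {y0<..<t} > 0" by (rule pos_subset) (auto simp: dist_real_def)
      then show False using n0 by simp
    qed
    \<comment> \<open>\<open>t\<close> may itself lie in the support, so the gap is sought around a
      point strictly to its left.\<close>
    define y where "y = (y0 + t) / 2"
    have y: "y0 < y" "y < t" using y0 unfolding y_def by auto
    \<comment> \<open>An open set whose complement in \<open>I\<close> is the support. Compactness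
      of the two pieces without \<open>N\<close> yields the nearest support point on either side of
      \<open>y\<close>.\<close>
    define N where "N = {x. \<exists>e>0. emeasure \<rho> (ball x e \<inter> I) = 0}"
    have "open N"
      unfolding open_subopen[of N]
    proof
      fix x assume "x \<in> N"
      then obtain e where e: "e > 0" "emeasure \<rho> (ball x e \<inter> I) = 0" unfolding N_def by blast
      have "ball x e \<subseteq> N"
      proof
        fix v assume v: "v \<in> ball x e"
        then obtain d where d: "d > 0" "ball v d \<subseteq> ball x e" using open_ball openE by blast
        have "\<not> emeasure \<rho> (ball v d \<inter> I) > 0" by (rule null_subset[OF e(2)]) (use d in auto)
        then show "v \<in> N" using d unfolding N_def by (auto simp: not_less)
      qed
      then show "\<exists>T. open T \<and> x \<in> T \<and> T \<subseteq> N" using e by (intro exI[of _ "ball x e"]) auto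
    qed
    have pN: "v \<in> psupp I \<rho> \<longleftrightarrow> v \<notin> N" if "v \<in> I" for v
      using that unfolding psupp_def N_def by (auto simp: zero_less_iff_neq_zero)
    have "compact ({x1..y} - N)" "compact ({y..x2} - N)"
      using \<open>open N\<close> by (auto simp: Diff_eq intro!: compact_Int_closed)
    moreover have "x1 \<in> {x1..y} - N" "x2 \<in> {y..x2} - N" using x pN[OF aI] pN[OF bI] y y0 t by auto
    ultimately obtain \<alpha>' \<beta>' where ab: "\<alpha>' \<in> {x1..y} - N" "\<And>v. v \<in> {x1..y} - N \<Longrightarrow> v \<le> \<alpha>'"
       "\<beta>' \<in> {y..x2} - N" "\<And>v. v \<in> {y..x2} - N \<Longrightarrow> \<beta>' \<le> v"
      using compact_attains_sup[of "{x1..y} - N"] compact_attains_inf[of "{y..x2} - N"] by blast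
    have ps: "\<alpha>' \<in> psupp I \<rho>" "\<beta>' \<in> psupp I \<rho>"
      using ab(1,3) pN between_I[OF aI bI, of \<alpha>'] between_I[OF aI bI, of \<beta>'] y y0 t by auto
    have "y \<notin> psupp I \<rho>" by (rule off) (use y in auto)
    then have lt: "\<alpha>' < y" "y < \<beta>'" using ab(1,3) ps by (auto simp: less_le)
    have gap: "{\<alpha>'<..<\<beta>'} \<inter> psupp I \<rho> = {}"
    proof -
      have False if v: "v \<in> {\<alpha>'<..<\<beta>'}" "v \<in> psupp I \<rho>" for v
      proof -
        have "v \<notin> N" using v(2) pN psupp_I by blast
        then show False using ab(2)[of v] ab(4)[of v] v(1) ab(1,3) by (cases "v \<le> y") auto
      qed
      then show ?thesis by blast
    qed
    have z: "f v = 0" if "v \<in> {\<alpha>'<..<\<beta>'}" for v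
      by (rule gap_zero[OF gc f g ae ps _ _ _ gap that]) (use ab(1,3) x lt in auto)
    \<comment> \<open>\<open>t\<close> lies in the gap or is its right endpoint; either way
      \<open>f\<close> vanishes just left of \<open>t\<close>, and left-continuity finishes.\<close>
    have "t \<le> \<beta>'" using off[of \<beta>'] ps(2) lt y by force
    have "\<alpha>' < t" using lt y by simp
    have "\<forall>\<^sub>F v in at_left t. f v = 0"
      by (rule eventually_mono[OF eventually_at_left_real[OF \<open>\<alpha>' < t\<close>]]) (use z \<open>t \<le> \<beta>'\<close> in auto)
    then have "(f \<longlongrightarrow> 0) (at_left t)" by (rule tendsto_eventually)
    then show ?thesis using tendsto_unique[OF trivial_limit_at_left_real ac_left[OF af tI]] by simp
  qed
qed

text \<open>Between the two support points \<open>f\<close>, and hence \<open>q\<close>, vanishes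
  identically; zero initial data at an interior point then propagate to all of \<open>I\<close>. The
  support points must be interior to the interval because limits at the ends of a gap are taken from
  outside the gap.\<close>

lemma solution_zero:
  assumes gc: gap_condition and f: "sys f q (\<lambda>t. z * f t)"
    and ae: "AE t in \<rho>. t \<in> {\<alpha><..<\<beta>} \<longrightarrow> f t = 0"
    and x: "x1 \<in> psupp I \<rho>" "x2 \<in> psupp I \<rho>" "\<alpha> < x1" "x1 < x2" "x2 < \<beta>"
    and t: "t \<in> I"
  shows "f t = 0"
proof -
  note aI = psupp_I[OF x(1)] and bI = psupp_I[OF x(2)]
  have af: "ac f (\<lambda>t. of_real (d1 t - d2 t) * q t)" using f unfolding sys_def by blast
  have g: "locint I \<rho> (\<lambda>t. z * f t)"
    using ac_locint_self[OF ac_cmult[OF af] H1] .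
  have zz: "f v = 0" if "v \<in> {x1<..<x2}" for v by (rule zero_between[OF gc f g ae x that])
  \<comment> \<open>\<open>q_zero\<close> needs \<open>f = 0\<close> on a closed interval around
    \<open>c\<close>; any \<open>c1 < c < c2\<close> strictly between \<open>x1\<close> and
    \<open>x2\<close> would do.\<close>
  define c1 c c2 where "c1 = x1 + (x2 - x1) / 4" and "c = (x1 + x2) / 2" and "c2 = x2 - (x2 - x1)/4"
  have o: "x1 < c1" "c1 < c" "c < c2" "c2 < x2" using x unfolding c1_def c_def c2_def by (auto simp: field_simps)
  have cI: "c1 \<in> I" "c \<in> I" "c2 \<in> I" using o between_I[OF aI bI, of c1] between_I[OF aI bI, of c] between_I[OF aI bI, of c2] by auto
  have "q c = 0" by (rule q_zero[OF f cI(1,3)]) (use zz o in auto)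
  moreover have "f c = 0" by (rule zz) (use o in auto)
  ultimately show ?thesis using ivp_zero(1)[OF f cI(2) _ _ t] by blast
qed

section \<open>Lagrange identity over \<rho> and boundary values of Wronskians\<close>

lemma lagrange_rho:
  assumes f: "sys f q u" and g: "sys g p v" and u: "locint I \<rho> u" and v: "locint I \<rho> v"
    and xy: "x \<in> I" "y \<in> I" "x \<le> y"
  shows "(f y * p y - q y * g y) - (f x * p x - q x * g x) = (LINT t:{x..<y}|\<rho>. g t * u t - f t * v t)"
proof -
  have af: "ac f (\<lambda>t. of_real (d1 t - d2 t) * q t)" and ag: "ac g (\<lambda>t. of_real (d1 t - d2 t) * p t)"
    using f g unfolding sys_def by blast+
  have "set_integrable \<rho> {x..y} (\<lambda>t. g t * u t)" "set_integrable \<rho> {x..y} (\<lambda>t. f t * v t)"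
    using ac_locint_mult[OF ag sets_rho u] ac_locint_mult[OF af sets_rho v] xy unfolding locint_def by auto
  then have "set_integrable \<rho> {x..y} (\<lambda>t. g t * u t - f t * v t)" by (rule set_integral_diff(1))
  then have i: "set_integrable \<rho> {x..<y} (\<lambda>t. g t * u t - f t * v t)"
    by (rule set_integrable_subset) (auto simp: sets_rho)
  have "{x..<y} \<subseteq> I" using Icc_sub[OF xy(1,2)] by auto
  then show ?thesis using acD[OF lagrange[OF f g] xy] density_integral(2)[OF rr _ _ i] by simp
qed

lemma wron_const:
  assumes f: "sys f q (\<lambda>t. z * f t)" and g: "sys g p (\<lambda>t. z * g t)" and xy: "x \<in> I" "y \<in> I"
  shows "f y * p y - q y * g y = f x * p x - q x * g x"
proof -
  have af: "ac f (\<lambda>t. of_real (d1 t - d2 t) * q t)" and ag: "ac g (\<lambda>t. of_real (d1 t - d2 t) * p t)"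
    using f g unfolding sys_def by blast+
  have l: "locint I \<rho> (\<lambda>t. z * f t)" "locint I \<rho> (\<lambda>t. z * g t)"
    using ac_locint_self[OF ac_cmult[OF af] H1] ac_locint_self[OF ac_cmult[OF ag] H1] .
  have e: "(\<lambda>t. g t * (z * f t) - f t * (z * g t)) = (\<lambda>_. 0)" by (auto simp: algebra_simps)
  have *: "f v * p v - q v * g v = f u * p u - q u * g u" if "u \<in> I" "v \<in> I" "u \<le> v" for u v
    using lagrange_rho[OF f g l that] unfolding e by simp
  show ?thesis using *[OF xy] *[OF xy(2,1)] by (cases "x \<le> y") auto
qed

lemma wron_limit_left:
  assumes f: "sys f q u" and g: "sys g p v" and u: "locint I \<rho> u" and v: "locint I \<rho> v" and x: "x \<in> I"
    and i: "set_integrable \<rho> {y\<in>I. y < x} (\<lambda>t. g t * u t - f t * v t)"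
  shows "((\<lambda>t. f t * p t - q t * g t) \<longlongrightarrow> f x * p x - q x * g x - (LINT t:{y\<in>I. y < x}|\<rho>. g t * u t - f t * v t)) (left_end a)"
proof -
  have "((\<lambda>\<alpha>. f x * p x - q x * g x - (LINT t:{\<alpha>..<x}|\<rho>. g t * u t - f t * v t))
     \<longlongrightarrow> f x * p x - q x * g x - (LINT t:{y\<in>I. y < x}|\<rho>. g t * u t - f t * v t)) (left_end a)"
    by (intro tendsto_diff tendsto_const tail_left[OF sets_rho I_sets x i])
  moreover have "\<forall>\<^sub>F \<alpha> in left_end a. f x * p x - q x * g x - (LINT t:{\<alpha>..<x}|\<rho>. g t * u t - f t * v t) = f \<alpha> * p \<alpha> - q \<alpha> * g \<alpha>"
    using eventually_left_end[OF x]
  proof eventually_elim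
    case (elim \<alpha>)
    then have "\<alpha> \<in> I" "\<alpha> \<le> x" by auto
    from lagrange_rho[OF f g u v this(1) x this(2), symmetric] show ?case by simp
  qed
  ultimately show ?thesis by (rule Lim_transform_eventually)
qed

lemma wron_limit_right:
  assumes f: "sys f q u" and g: "sys g p v" and u: "locint I \<rho> u" and v: "locint I \<rho> v" and x: "x \<in> I"
    and i: "set_integrable \<rho> {y\<in>I. x \<le> y} (\<lambda>t. g t * u t - f t * v t)"
  shows "((\<lambda>t. f t * p t - q t * g t) \<longlongrightarrow> f x * p x - q x * g x + (LINT t:{y\<in>I. x \<le> y}|\<rho>. g t * u t - f t * v t)) (right_end b)"
proof -
  have "((\<lambda>\<alpha>. f x * p x - q x * g x + (LINT t:{x..<\<alpha>}|\<rho>. g t * u t - f t * v t))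
     \<longlongrightarrow> f x * p x - q x * g x + (LINT t:{y\<in>I. x \<le> y}|\<rho>. g t * u t - f t * v t)) (right_end b)"
    by (intro tendsto_add tendsto_const tail_right[OF sets_rho I_sets x i])
  moreover have "\<forall>\<^sub>F \<alpha> in right_end b. f x * p x - q x * g x + (LINT t:{x..<\<alpha>}|\<rho>. g t * u t - f t * v t) = f \<alpha> * p \<alpha> - q \<alpha> * g \<alpha>"
    using eventually_right_end[OF x]
  proof eventually_elim
    case (elim \<alpha>)
    then have "\<alpha> \<in> I" "x \<le> \<alpha>" by auto
    from lagrange_rho[OF f g u v x this, symmetric] show ?case by simp
  qed
  ultimately show ?thesis by (rule Lim_transform_eventually)
qed

section \<open>Square integrability near an endpoint\<close>

lemma ac_L2_Icc:
  assumes f: "ac f \<alpha>" and xy: "x \<in> I" "y \<in> I"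
  shows "L2_on \<rho> {x..y} f"
proof -
  obtain K where K: "\<And>t. t \<in> {x..y} \<Longrightarrow> cmod (f t) \<le> K" using ac_bounded[OF f xy] by blast
  show ?thesis
    by (rule L2_on_bounded[OF sets_rho set_measurable_sub[OF ac_measurable[OF f] _ Icc_sub[OF xy]] _ _ K])
      (use H1 xy in \<open>auto simp: locfin_def\<close>)
qed

lemma half_sets: "{x\<in>I. x < c} \<in> sets \<rho>" "{x\<in>I. c < x} \<in> sets \<rho>" "{x\<in>I. c \<le> x} \<in> sets \<rho>"
  unfolding sets_rho by (simp_all add: Collect_conj_eq Int_def[symmetric])

lemma L2_left_extend:
  assumes f: "ac f \<alpha>" and L: "L2_on \<rho> {x\<in>I. x < c} f" and c: "c \<in> I" "c' \<in> I"
  shows "L2_on \<rho> {x\<in>I. x < c'} f"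
  by (rule L2_on_mono[OF L2_on_Un[OF L ac_L2_Icc[OF f c]] half_sets(1)]) (auto simp: sets_rho)

lemma L2_right_extend:
  assumes f: "ac f \<alpha>" and L: "L2_on \<rho> {x\<in>I. c < x} f" and c: "c \<in> I" "c' \<in> I"
  shows "L2_on \<rho> {x\<in>I. c' \<le> x} f"
  by (rule L2_on_mono[OF L2_on_Un[OF L ac_L2_Icc[OF f c(2,1)]] half_sets(3)]) (auto simp: sets_rho)

lemma L2_glue:
  assumes f: "ac f \<alpha>" and L: "L2_on \<rho> {x\<in>I. x < c} f" "L2_on \<rho> {x\<in>I. d \<le> x} f" and c: "c \<in> I" "d \<in> I"
  shows "L2_on \<rho> I f"
  by (rule L2_on_mono[OF L2_on_Un[OF L2_left_extend[OF f L(1) c] L(2) half_sets(3)]]) (auto simp: sets_rho)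

lemma locint_L2:
  assumes "L2_on \<rho> I f" shows "locint I \<rho> f"
  unfolding locint_def
proof (intro ballI)
  fix x y assume xy: "x \<in> I" "y \<in> I"
  have "L2_on \<rho> {x..y} f" by (rule L2_on_mono[OF assms]) (use Icc_sub[OF xy] sets_rho in auto)
  from L2_mult_integrable[OF ac_L2_Icc[OF ac_const[of 1] xy] this] show "set_integrable \<rho> {x..y} f" by simp
qed

end

section \<open>Cutoff functions and the resolvent\<close>

lemma set_integral_norm_zero:
  fixes f :: "real \<Rightarrow> complex"
  assumes i: "set_integrable M A (\<lambda>t. f t * cnj (f t))" and z: "(LINT t:A|M. f t * cnj (f t)) = 0"
  shows "AE t in M. t \<in> A \<longrightarrow> f t = 0"
proof -
  have e: "(\<lambda>t. indicat_real A t *\<^sub>R (f t * cnj (f t))) = (\<lambda>t. complex_of_real (indicat_real A t * (cmod (f t))\<^sup>2))"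
    by (auto simp: indicator_def complex_norm_square[symmetric])
  have i': "integrable M (\<lambda>t. indicat_real A t * (cmod (f t))\<^sup>2)"
    using i unfolding set_integrable_def e complex_of_real_integrable_eq .
  have "complex_of_real (LINT t|M. indicat_real A t * (cmod (f t))\<^sup>2) = 0"
    using z unfolding set_lebesgue_integral_def e integral_complex_of_real .
  then have "(LINT t|M. indicat_real A t * (cmod (f t))\<^sup>2) = 0" by (simp only: of_real_eq_0_iff)
  then have "AE t in M. indicat_real A t * (cmod (f t))\<^sup>2 = 0"
    using integral_nonneg_eq_0_iff_AE[OF i'] by simp
  then show ?thesis by (rule AE_mp) (auto simp: indicator_def)
qed

lemma locint_indicator:
  assumes "locint I M f" "sets M = sets borel" "J \<in> sets borel"
  shows "locint I M (\<lambda>t. indicat_real J t *\<^sub>R f t)"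
  unfolding locint_def
proof (intro ballI)
  fix x y assume "x \<in> I" "y \<in> I"
  then have "integrable M (\<lambda>t. indicat_real {x..y} t *\<^sub>R f t)"
    using assms(1) unfolding locint_def set_integrable_def by blast
  then have "integrable M (\<lambda>t. indicat_real J t *\<^sub>R (indicat_real {x..y} t *\<^sub>R f t))"
    by (rule integrable_mult_indicator[rotated]) (use assms in simp)
  then show "set_integrable M {x..y} (\<lambda>t. indicat_real J t *\<^sub>R f t)"
    unfolding set_integrable_def by (simp add: mult.commute)
qed

lemma pint_indicator_below:
  "x \<le> \<alpha> \<Longrightarrow> pint M \<alpha> x (\<lambda>t. indicat_real {\<alpha>..<\<beta>} t *\<^sub>R f t) = 0"
proof -
  have "(\<lambda>t. indicat_real {x..<\<alpha>} t *\<^sub>R (indicat_real {\<alpha>..<\<beta>} t *\<^sub>R f t)) = (\<lambda>_. 0)" by (auto simp: indicator_def)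
  then show "x \<le> \<alpha> \<Longrightarrow> ?thesis" unfolding pint_def set_lebesgue_integral_def by simp
qed

lemma pint_indicator_above:
  assumes "\<alpha> < \<beta>" "\<beta> \<le> x" shows "pint M \<alpha> x (\<lambda>t. indicat_real {\<alpha>..<\<beta>} t *\<^sub>R f t) = (LINT t:{\<alpha>..<\<beta>}|M. f t)"
proof -
  have "(\<lambda>t. indicat_real {\<alpha>..<x} t *\<^sub>R (indicat_real {\<alpha>..<\<beta>} t *\<^sub>R f t)) = (\<lambda>t. indicat_real {\<alpha>..<\<beta>} t *\<^sub>R f t)"
    using assms by (auto simp: indicator_def)
  then show ?thesis using assms unfolding pint_def set_lebesgue_integral_def by simp
qed

lemma L2_on_indicator:
  assumes "L2_on M J f" "J \<subseteq> A"
  shows "L2_on M A (\<lambda>t. indicat_real J t *\<^sub>R f t)"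
proof -
  have "(\<lambda>t. indicat_real A t *\<^sub>R (indicat_real J t *\<^sub>R f t)) = (\<lambda>t. indicat_real J t *\<^sub>R f t)"
    "(\<lambda>t. indicator A t * ennreal ((cmod (indicat_real J t *\<^sub>R f t))\<^sup>2)) = (\<lambda>t. indicator J t * ennreal ((cmod (f t))\<^sup>2))"
    using assms(2) by (auto simp: indicator_def fun_eq_iff)
  then show ?thesis using assms(1) unfolding L2_on_def set_borel_measurable_def by simp
qed

context sl_problem
begin

lemma q_zero_all:
  assumes "sys f q u" "\<And>t. t \<in> I \<Longrightarrow> f t = 0" "t \<in> I" shows "q t = 0"
proof -
  obtain y z where yz: "y \<in> I" "z \<in> I" "y < t" "t < z" using nbhd_I[OF assms(3)] .
  show ?thesis by (rule q_zero[OF assms(1) yz(1,2)]) (use yz assms(2) between_I[OF yz(1,2)] in auto)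
qed

text \<open>Variation of constants with an inhomogeneity \<open>\<kappa>\<close> supported on \<open>[\<alpha>,\<beta>)\<close>: the solution is a multiple of \<open>u\<close>
  on the left and vanishes on the right iff \<open>\<integral>u \<kappa> d\<rho> = 0 \<noteq> \<integral>v \<kappa> d\<rho>\<close>. Take \<open>\<kappa>\<close> to be the conjugate
  of the component of \<open>v\<close> orthogonal to \<open>u\<close> in \<open>L\<^sup>2([\<alpha>,\<beta>);\<rho>)\<close>.\<close>

lemma cutoff:
  assumes gc: gap_condition and u: "sys u p (\<lambda>t. z * u t)" and v: "sys v p' (\<lambda>t. z * v t)"
    and c0: "c0 \<in> I" "v c0 * p c0 - p' c0 * u c0 \<noteq> 0"
    and x: "x1 \<in> psupp I \<rho>" "x2 \<in> psupp I \<rho>" "x1 < x2"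
  obtains \<phi> q \<kappa> \<alpha> \<beta> where "sys \<phi> q (\<lambda>t. z * \<phi> t + \<kappa> t)" "L2_on \<rho> I \<kappa>" "\<alpha> \<in> I" "\<beta> \<in> I" "\<alpha> < \<beta>"
    "\<And>t. t \<in> I \<Longrightarrow> t \<le> \<alpha> \<Longrightarrow> \<phi> t = u t \<and> q t = p t" "\<And>t. t \<in> I \<Longrightarrow> \<beta> \<le> t \<Longrightarrow> \<phi> t = 0 \<and> q t = 0"
proof -
  \<comment> \<open>The interval reaches strictly beyond \<open>x1\<close> and \<open>x2\<close>, as
    \<open>solution_zero\<close> requires.\<close>
  obtain \<alpha> where \<alpha>: "\<alpha> \<in> I" "\<alpha> < x1" using nbhd_I[OF psupp_I[OF x(1)]] by blast
  obtain \<beta> where \<beta>: "\<beta> \<in> I" "x2 < \<beta>" using nbhd_I[OF psupp_I[OF x(2)]] by blast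
  have ab: "\<alpha> < \<beta>" using \<alpha> \<beta> x by simp
  let ?J = "{\<alpha>..<\<beta>}"
  have JI: "?J \<subseteq> I" using Icc_sub[OF \<alpha>(1) \<beta>(1)] by auto
  have au: "ac u (\<lambda>t. of_real (d1 t - d2 t) * p t)" and av: "ac v (\<lambda>t. of_real (d1 t - d2 t) * p' t)"
    using u v unfolding sys_def by blast+
  have iJ: "set_integrable \<rho> ?J f" if "locint I \<rho> f" for f
    by (rule set_integrable_subset[of _ "{\<alpha>..\<beta>}"]) (use that \<alpha> \<beta> in \<open>auto simp: locint_def sets_rho\<close>)
  have lprod: "locint I \<rho> (\<lambda>t. f t * g t)" if "ac f f'" "ac g g'" for f f' g g'
    using ac_locint_mult[OF that(1) sets_rho ac_locint_self[OF that(2) H1]] .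
  define A where "A = (LINT t:?J|\<rho>. u t * cnj (u t))"
  define B where "B = (LINT t:?J|\<rho>. v t * cnj (u t))"
  have cA: "cnj A = A" unfolding A_def set_integral_cnj[symmetric] by (simp add: mult.commute)
  have cB: "cnj B = (LINT t:?J|\<rho>. u t * cnj (v t))" unfolding B_def set_integral_cnj[symmetric] by (simp add: mult.commute)
  \<comment> \<open>\<open>A\<close> times the component of \<open>v\<close> orthogonal to
    \<open>u\<close>; the factor \<open>A\<close> avoids a division while
    \<open>A \<noteq> 0\<close> is not yet known.\<close>
  define f where "f = (\<lambda>t. A * v t - B * u t)"
  define \<eta> where "\<eta> = (\<lambda>t. cnj (f t))"
  have sf: "sys f (\<lambda>t. A * p' t - B * p t) (\<lambda>t. z * f t)"
    using sys_diff[OF sys_cmult[OF v, of A] sys_cmult[OF u, of B]] unfolding f_def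
    by (simp add: algebra_simps)
  then have af: "ac f (\<lambda>t. of_real (d1 t - d2 t) * (A * p' t - B * p t))" unfolding sys_def by blast
  note a\<eta> = ac_cnj[OF af, folded \<eta>_def] and acu = ac_cnj[OF au] and acv = ac_cnj[OF av]
  note luu = iJ[OF lprod[OF au acu]] and luv = iJ[OF lprod[OF au acv]] and lu\<eta> = iJ[OF lprod[OF au a\<eta>]]
    and lv\<eta> = iJ[OF lprod[OF av a\<eta>]] and lff = iJ[OF lprod[OF af a\<eta>]]
  have u\<eta>: "(LINT t:?J|\<rho>. u t * \<eta> t) = 0"
  proof -
    have "(\<lambda>t. u t * \<eta> t) = (\<lambda>t. cnj A * (u t * cnj (v t)) - cnj B * (u t * cnj (u t)))"
      by (auto simp: \<eta>_def f_def algebra_simps)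
    then have "(LINT t:?J|\<rho>. u t * \<eta> t) = cnj A * (LINT t:?J|\<rho>. u t * cnj (v t)) - cnj B * (LINT t:?J|\<rho>. u t * cnj (u t))"
      using luu luv by (simp add: set_integral_diff(2))
    then show ?thesis unfolding cA cB[symmetric] A_def[symmetric] by simp
  qed
  define D where "D = (LINT t:?J|\<rho>. v t * \<eta> t)"
  \<comment> \<open>\<open>A * D\<close> is the squared norm of \<open>f\<close>. If
    \<open>D = 0\<close>, then \<open>A * v = B * u\<close> on \<open>I\<close>; independence gives
    \<open>A = 0\<close>, so \<open>u\<close> is zero a.e. on \<open>?J\<close>, hence on
    \<open>I\<close>, contradicting the nonzero Wronskian.\<close>
  have "D \<noteq> 0"
  proof
    assume "D = 0"
    have "(\<lambda>t. f t * \<eta> t) = (\<lambda>t. A * (v t * \<eta> t) - B * (u t * \<eta> t))" by (auto simp: f_def algebra_simps)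
    then have "(LINT t:?J|\<rho>. f t * \<eta> t) = A * (LINT t:?J|\<rho>. v t * \<eta> t) - B * (LINT t:?J|\<rho>. u t * \<eta> t)"
      using lu\<eta> lv\<eta> by (simp add: set_integral_diff(2))
    then have "(LINT t:?J|\<rho>. f t * cnj (f t)) = 0" using u\<eta> \<open>D = 0\<close> unfolding D_def \<eta>_def by simp
    from set_integral_norm_zero[OF lff[unfolded \<eta>_def] this]
    have ae: "AE t in \<rho>. t \<in> {\<alpha><..<\<beta>} \<longrightarrow> f t = 0" by (rule AE_mp) auto
    have f0: "f t = 0" if "t \<in> I" for t
      by (rule solution_zero[OF gc sf ae x(1,2) \<alpha>(2) x(3) \<beta>(2) that])
    have q0: "A * p' c0 - B * p c0 = 0" by (rule q_zero_all[OF sf f0 c0(1)])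
    have "A * (v c0 * p c0 - p' c0 * u c0) = (A * v c0) * p c0 - (A * p' c0) * u c0" by (simp add: algebra_simps)
    also have "\<dots> = 0" using f0[OF c0(1)] q0 unfolding f_def by (simp add: algebra_simps)
    finally have "A = 0" using c0(2) by simp
    from set_integral_norm_zero[OF luu this[unfolded A_def]]
    have ae: "AE t in \<rho>. t \<in> {\<alpha><..<\<beta>} \<longrightarrow> u t = 0" by (rule AE_mp) auto
    have u0: "u t = 0" if "t \<in> I" for t
      by (rule solution_zero[OF gc u ae x(1,2) \<alpha>(2) x(3) \<beta>(2) that])
    then have "p c0 = 0" using q_zero_all[OF u u0 c0(1)] by simp
    then show False using c0 u0 by simp
  qed
  define w where "w = v c0 * p c0 - p' c0 * u c0"
  define \<kappa>0 where "\<kappa>0 = (\<lambda>t. indicat_real ?J t *\<^sub>R \<eta> t)"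
  have eu: "(\<lambda>t. u t * \<kappa>0 t) = (\<lambda>t. indicat_real ?J t *\<^sub>R (u t * \<eta> t))"
    and ev: "(\<lambda>t. v t * \<kappa>0 t) = (\<lambda>t. indicat_real ?J t *\<^sub>R (v t * \<eta> t))" unfolding \<kappa>0_def by auto
  \<comment> \<open>Left of \<alpha> one has \<open>P = 0\<close> and \<open>Q = D\<close>; beyond
    \<beta> both are zero, since the integral of \<open>u * \<eta>\<close> is 0 and that of
    \<open>v * \<eta>\<close> is \<open>D\<close>. Division by \<open>D\<close> later normalises the
    left piece to \<open>u\<close>.\<close>
  define P where "P = (\<lambda>x. pint \<rho> \<alpha> x (\<lambda>t. u t * \<kappa>0 t))"
  define Q where "Q = (\<lambda>x. D - pint \<rho> \<alpha> x (\<lambda>t. v t * \<kappa>0 t))"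
  have lu: "locint I \<rho> (\<lambda>t. u t * \<kappa>0 t)" and lv: "locint I \<rho> (\<lambda>t. v t * \<kappa>0 t)"
    unfolding eu ev by (intro locint_indicator lprod[OF au a\<eta>] lprod[OF av a\<eta>] sets_rho; simp)+
  have aP: "ac P (\<lambda>t. of_real (r t) * (u t * \<kappa>0 t))" unfolding P_def by (rule pint_ac[OF rr lu \<alpha>(1)])
  have "ac Q (\<lambda>t. 0 - of_real (r t) * (v t * \<kappa>0 t))" unfolding Q_def
    by (intro ac_diff ac_const pint_ac[OF rr lv \<alpha>(1)])
  then have aQ: "ac Q (\<lambda>t. - (of_real (r t) * (v t * \<kappa>0 t)))" by simp
  have w: "v t * p t - p' t * u t = w" if "t \<in> I" for t
    using wron_const[OF v u c0(1) that] unfolding w_def .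
  define \<phi> where "\<phi> = (\<lambda>t. 1 / D * (v t * P t + u t * Q t))"
  define q where "q = (\<lambda>t. 1 / D * (p' t * P t + p t * Q t))"
  define \<kappa> where "\<kappa> = (\<lambda>t. (w / D) * \<kappa>0 t)"
  from sys_cmult[OF variation_of_constants[OF u v w aP aQ], of "1 / D"]
  have s: "sys \<phi> q (\<lambda>t. z * \<phi> t + \<kappa> t)"
    unfolding \<phi>_def q_def \<kappa>_def by (simp add: algebra_simps)
  have k: "L2_on \<rho> I \<kappa>" unfolding \<kappa>_def \<kappa>0_def
    by (intro L2_on_cmult L2_on_indicator[OF _ JI] L2_on_mono[OF ac_L2_Icc[OF a\<eta> \<alpha>(1) \<beta>(1)]]) (auto simp: sets_rho)
  have below: "P t = 0" "Q t = D" if "t \<le> \<alpha>" for t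
    unfolding P_def Q_def eu ev using that by (simp_all add: pint_indicator_below)
  have above: "P t = 0" "Q t = 0" if "\<beta> \<le> t" for t
    unfolding P_def Q_def eu ev using that ab u\<eta> by (simp_all add: pint_indicator_above D_def)
  show ?thesis
  proof (rule that[OF s k \<alpha>(1) \<beta>(1) ab])
    show "\<phi> t = u t \<and> q t = p t" if "t \<le> \<alpha>" for t
      using below[OF that] \<open>D \<noteq> 0\<close> unfolding \<phi>_def q_def by simp
    show "\<phi> t = 0 \<and> q t = 0" if "\<beta> \<le> t" for t
      using above[OF that] unfolding \<phi>_def q_def by simp
  qed
qed

end

locale sl_green = sl_problem +
  fixes va vb ua ub :: "real \<Rightarrow> complex" and z :: complex
    and S :: "((real \<Rightarrow> complex) \<times> (real \<Rightarrow> complex)) set"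
  assumes gc: gap_condition
    and H6: "\<exists>x y. x \<in> psupp I \<rho> \<and> y \<in> psupp I \<rho> \<and> x \<noteq> y"
    and S_def: "S = {(f, g) \<in> Tmax a b \<rho> \<sigma> chi.
               (lc_left a b \<rho> \<sigma> chi \<longrightarrow> ((wron a b \<rho> \<sigma> chi f (\<lambda>x. cnj (va x))) \<longlongrightarrow> 0) (left_end a)) \<and>
               (lc_right a b \<rho> \<sigma> chi \<longrightarrow> ((wron a b \<rho> \<sigma> chi f (\<lambda>x. cnj (vb x))) \<longlongrightarrow> 0) (right_end b))}"
    and S_sa: "self_adjoint_rel \<rho> I S"
    and z: "z \<in> resolvent_set \<rho> I S"
    and ua_sol: "tau_rel a b \<rho> \<sigma> chi ua (\<lambda>x. z * ua x)" "\<exists>x\<in>I. ua x \<noteq> 0"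
    and ua_bc: "lc_left a b \<rho> \<sigma> chi \<Longrightarrow> ((wron a b \<rho> \<sigma> chi ua (\<lambda>x. cnj (va x))) \<longlongrightarrow> 0) (left_end a)"
    and ua_lp: "\<not> lc_left a b \<rho> \<sigma> chi \<Longrightarrow> \<forall>c\<in>I. L2_on \<rho> {x\<in>I. x < c} ua"
    and ub_sol: "tau_rel a b \<rho> \<sigma> chi ub (\<lambda>x. z * ub x)" "\<exists>x\<in>I. ub x \<noteq> 0"
    and ub_bc: "lc_right a b \<rho> \<sigma> chi \<Longrightarrow> ((wron a b \<rho> \<sigma> chi ub (\<lambda>x. cnj (vb x))) \<longlongrightarrow> 0) (right_end b)"
    and ub_lp: "\<not> lc_right a b \<rho> \<sigma> chi \<Longrightarrow> \<forall>c\<in>I. L2_on \<rho> {x\<in>I. c < x} ub"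
begin

abbreviation "quasi \<equiv> qd a b \<rho> \<sigma> chi"
abbreviation "W \<equiv> wron a b \<rho> \<sigma> chi"

lemma two_support_points: obtains x1 x2 where "x1 \<in> psupp I \<rho>" "x2 \<in> psupp I \<rho>" "x1 < x2"
  using H6 by (metis linorder_neqE)

lemma sys_ac: "sys f q g \<Longrightarrow> ac f (\<lambda>t. of_real (d1 t - d2 t) * q t)" unfolding sys_def by blast

lemmas ua_sys = tau_relD(1)[OF ua_sol(1)] and ub_sys = tau_relD(1)[OF ub_sol(1)]
lemmas ua_locint = tau_relD(2)[OF ua_sol(1)] and ub_locint = tau_relD(2)[OF ub_sol(1)]

lemma W_eq: "W f g = (\<lambda>t. f t * quasi g t - quasi f t * g t)"
  unfolding wron_def by (rule ext) simp

text \<open>At a fixed \<open>t\<close> the Wronskians are the 2x2 minors of the 2x4 matrix with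
  columns \<open>(f t, quasi f t)\<close>; this is the quadratic relation among them.\<close>

lemma plucker: "W f1 f2 t * W f3 f4 t + W f1 f3 t * W f4 f2 t + W f1 f4 t * W f2 f3 t = 0"
  unfolding W_eq by (simp add: algebra_simps)

lemma S_memI:
  assumes "sys f q g" "L2_on \<rho> I f" "L2_on \<rho> I g"
    "lc_left a b \<rho> \<sigma> chi \<Longrightarrow> ((W f (\<lambda>x. cnj (va x))) \<longlongrightarrow> 0) (left_end a)"
    "lc_right a b \<rho> \<sigma> chi \<Longrightarrow> ((W f (\<lambda>x. cnj (vb x))) \<longlongrightarrow> 0) (right_end b)"
  shows "(f, g) \<in> S"
proof -
  obtain c where c: "c \<in> I" using ua_sol(2) by blast
  show ?thesis unfolding S_def Tmax_def using assms sys_tau_rel[OF assms(1) locint_L2[OF assms(3)] c] by blast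
qed

lemma S_memD:
  assumes "(f, g) \<in> S"
  shows "sys f (quasi f) g" "locint I \<rho> g" "L2_on \<rho> I f" "L2_on \<rho> I g"
    "lc_left a b \<rho> \<sigma> chi \<Longrightarrow> ((W f (\<lambda>x. cnj (va x))) \<longlongrightarrow> 0) (left_end a)"
    "lc_right a b \<rho> \<sigma> chi \<Longrightarrow> ((W f (\<lambda>x. cnj (vb x))) \<longlongrightarrow> 0) (right_end b)"
  using assms tau_relD[of f g] unfolding S_def Tmax_def by blast+

lemma W_zero_left:
  assumes s: "sys f q g" "locint I \<rho> g" and c: "c \<in> I" and z: "\<And>t. t \<in> I \<Longrightarrow> t \<le> c \<Longrightarrow> f t = 0 \<and> q t = 0"
  shows "((W f h) \<longlongrightarrow> 0) (left_end a)"
proof (rule tendsto_eventually)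
  show "\<forall>\<^sub>F t in left_end a. W f h t = 0"
    using eventually_left_end[OF c]
  proof eventually_elim
    case (elim t)
    then show ?case using z[of t] qd_eq[OF s, of t] by (simp add: W_eq)
  qed
qed

lemma W_zero_right:
  assumes s: "sys f q g" "locint I \<rho> g" and c: "c \<in> I" and z: "\<And>t. t \<in> I \<Longrightarrow> c \<le> t \<Longrightarrow> f t = 0 \<and> q t = 0"
  shows "((W f h) \<longlongrightarrow> 0) (right_end b)"
proof (rule tendsto_eventually)
  show "\<forall>\<^sub>F t in right_end b. W f h t = 0"
    using eventually_right_end[OF c]
  proof eventually_elim
    case (elim t)
    then show ?case using z[of t] qd_eq[OF s, of t] by (simp add: W_eq)
  qed
qed

text \<open>Injectivity in \<open>resolvent_set\<close>, applied to this pair and the zero pair,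
  gives \<open>u = 0\<close> only a.e.; \<open>solution_zero\<close> between two support points
  upgrades this to every point.\<close>

lemma no_eigenvector:
  assumes u: "sys u q (\<lambda>t. z * u t)" and S: "(u, \<lambda>t. z * u t) \<in> S" and t: "t \<in> I"
  shows "u t = 0"
proof -
  have l0: "locint I \<rho> (\<lambda>_. 0)" by (rule locint_L2[OF L2_on_zero])
  have 0: "((\<lambda>_. 0), (\<lambda>_. 0)) \<in> S"
    by (rule S_memI[OF sys_zero L2_on_zero L2_on_zero]; rule W_zero_left[OF sys_zero l0 t] W_zero_right[OF sys_zero l0 t]) auto
  have "aeq \<rho> I (\<lambda>x. z * u x - z * u x) (\<lambda>x. 0 - z * 0)" unfolding aeq_def by simp
  then have "aeq \<rho> I u (\<lambda>_. 0)" using z S 0 unfolding resolvent_set_def by blast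
  then have ae: "AE x in \<rho>. x \<in> I \<longrightarrow> u x = 0" unfolding aeq_def .
  obtain x1 x2 where x: "x1 \<in> psupp I \<rho>" "x2 \<in> psupp I \<rho>" "x1 < x2" by (rule two_support_points)
  obtain \<alpha> where \<alpha>: "\<alpha> \<in> I" "\<alpha> < x1" using nbhd_I[OF psupp_I[OF x(1)]] by blast
  obtain \<beta> where \<beta>: "\<beta> \<in> I" "x2 < \<beta>" using nbhd_I[OF psupp_I[OF x(2)]] by blast
  have "AE t in \<rho>. t \<in> {\<alpha><..<\<beta>} \<longrightarrow> u t = 0"
    by (rule AE_mp[OF ae], rule AE_I2) (use between_I[OF \<alpha>(1) \<beta>(1)] in auto)
  from solution_zero[OF gc u this x(1,2) \<alpha>(2) x(3) \<beta>(2) t] show ?thesis .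
qed

lemma ua_L2: assumes c: "c \<in> I" shows "L2_on \<rho> {x\<in>I. x < c} ua"
proof (cases "lc_left a b \<rho> \<sigma> chi")
  case True
  then obtain d where d: "d \<in> I" "L2_on \<rho> {x\<in>I. x < d} ua" using ua_sol(1) unfolding lc_left_def by blast
  show ?thesis by (rule L2_left_extend[OF sys_ac[OF ua_sys] d(2,1) c])
next
  case False then show ?thesis using ua_lp c by blast
qed

lemma ub_L2: assumes c: "c \<in> I" shows "L2_on \<rho> {x\<in>I. c \<le> x} ub"
proof -
  obtain d where d: "d \<in> I" "L2_on \<rho> {x\<in>I. d < x} ub"
    using ub_sol(1) ub_lp c unfolding lc_right_def by blast
  show ?thesis by (rule L2_right_extend[OF sys_ac[OF ub_sys] d(2,1) c])
qed

text \<open>\<open>ub\<close> already meets the requirements at \<open>b\<close>; meeting those at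
  \<open>a\<close> as well would make it an eigenvector of \<open>S\<close> for
  \<open>z\<close>.\<close>

lemma ub_not_left:
  assumes c: "c \<in> I" and L: "L2_on \<rho> {x\<in>I. x < c} ub"
    and bc: "lc_left a b \<rho> \<sigma> chi \<Longrightarrow> ((W ub (\<lambda>x. cnj (va x))) \<longlongrightarrow> 0) (left_end a)"
  shows False
proof -
  have L2: "L2_on \<rho> I ub" by (rule L2_glue[OF sys_ac[OF ub_sys] L ub_L2[OF c] c c])
  have "(ub, \<lambda>t. z * ub t) \<in> S" by (rule S_memI[OF ub_sys L2 L2_on_cmult[OF L2] bc ub_bc])
  then show False using no_eigenvector[OF ub_sys] ub_sol(2) by blast
qed

lemma ua_not_right:
  assumes c: "c \<in> I" and L: "L2_on \<rho> {x\<in>I. c < x} ua"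
    and bc: "lc_right a b \<rho> \<sigma> chi \<Longrightarrow> ((W ua (\<lambda>x. cnj (vb x))) \<longlongrightarrow> 0) (right_end b)"
  shows False
proof -
  have L2: "L2_on \<rho> I ua"
    by (rule L2_glue[OF sys_ac[OF ua_sys] ua_L2[OF c] L2_right_extend[OF sys_ac[OF ua_sys] L c c] c c])
  have "(ua, \<lambda>t. z * ua t) \<in> S" by (rule S_memI[OF ua_sys L2 L2_on_cmult[OF L2] ua_bc bc])
  then show False using no_eigenvector[OF ua_sys] ua_sol(2) by blast
qed

text \<open>If the Wronskian vanished at one point, the initial data would be proportional, so
  \<open>ub\<close> would be a multiple of \<open>ua\<close> and inherit its behaviour at
  \<open>a\<close>, which \<open>ub_not_left\<close> forbids.\<close>

lemma wronskian_nonzero: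
  assumes x: "x \<in> I" shows "W ub ua x \<noteq> 0"
proof
  assume "W ub ua x = 0"
  then have w0: "ub x * quasi ua x = quasi ub x * ua x" by (simp add: W_eq)
  have "\<exists>\<kappa>. ub x = \<kappa> * ua x \<and> quasi ub x = \<kappa> * quasi ua x"
  proof (cases "ua x = 0")
    case True
    then have "quasi ua x \<noteq> 0" using ivp_zero(1)[OF ua_sys x] ua_sol(2) by blast
    then show ?thesis using w0 True by (intro exI[of _ "quasi ub x / quasi ua x"]) simp
  next
    case False
    then show ?thesis using w0 by (intro exI[of _ "ub x / ua x"]) (simp add: field_simps)
  qed
  then obtain \<kappa> where \<kappa>: "ub x = \<kappa> * ua x" "quasi ub x = \<kappa> * quasi ua x" by blast
  have "sys (\<lambda>t. ub t - \<kappa> * ua t) (\<lambda>t. quasi ub t - \<kappa> * quasi ua t) (\<lambda>t. z * (ub t - \<kappa> * ua t))"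
    using sys_diff[OF ub_sys sys_cmult[OF ua_sys, of \<kappa>]] by (simp add: algebra_simps)
  from ivp_zero[OF this x]
  have eq: "ub t = \<kappa> * ua t" "quasi ub t = \<kappa> * quasi ua t" if "t \<in> I" for t using \<kappa> that by auto
  have L: "L2_on \<rho> {y\<in>I. y < x} ub" by (rule L2_on_cong[OF L2_on_cmult[OF ua_L2[OF x], of \<kappa>]]) (use eq in auto)
  show False
  proof (rule ub_not_left[OF x L])
    assume "lc_left a b \<rho> \<sigma> chi"
    from tendsto_mult_right_zero[OF ua_bc[OF this], of \<kappa>]
    show "((W ub (\<lambda>x. cnj (va x))) \<longlongrightarrow> 0) (left_end a)"
    proof (rule Lim_transform_eventually)
      show "\<forall>\<^sub>F t in left_end a. \<kappa> * W ua (\<lambda>x. cnj (va x)) t = W ub (\<lambda>x. cnj (va x)) t"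
        using eventually_left_end[OF x] by eventually_elim (simp add: W_eq eq algebra_simps)
    qed
  qed
qed

lemma W_const: "x \<in> I \<Longrightarrow> y \<in> I \<Longrightarrow> W ub ua y = W ub ua x"
  unfolding W_eq by (rule wron_const[OF ub_sys ua_sys])

lemma L2_lagrange_integrable:
  assumes "L2_on \<rho> A f" "L2_on \<rho> A u" "L2_on \<rho> A g" "L2_on \<rho> A v"
  shows "set_integrable \<rho> A (\<lambda>t. g t * u t - f t * v t)"
  by (intro set_integral_diff(1) L2_mult_integrable assms)

text \<open>The limit exists for every solution that is square-integrable near \<open>a\<close>,
  whatever its boundary behaviour. For \<open>ub\<close> in the limit circle case only its
  finiteness matters.\<close>

lemma S_left_limit:
  assumes f: "(f, h) \<in> S" and u: "sys u (quasi u) (\<lambda>t. z * u t)" "locint I \<rho> (\<lambda>t. z * u t)" and L: "L2_on \<rho> {t\<in>I. t < x} u" and x: "x \<in> I"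
  shows "((W f u) \<longlongrightarrow> W f u x - (LINT t:{y\<in>I. y < x}|\<rho>. u t * h t - f t * (z * u t))) (left_end a)"
  unfolding W_eq
  by (rule wron_limit_left[OF S_memD(1)[OF f] u(1) S_memD(2)[OF f] u(2) x L2_lagrange_integrable[OF _ _ L L2_on_cmult[OF L]]])
    (auto intro: L2_on_mono[OF S_memD(3)[OF f] half_sets(1)] L2_on_mono[OF S_memD(4)[OF f] half_sets(1)])

lemma S_right_limit:
  assumes f: "(f, h) \<in> S" and u: "sys u (quasi u) (\<lambda>t. z * u t)" "locint I \<rho> (\<lambda>t. z * u t)" and L: "L2_on \<rho> {t\<in>I. x \<le> t} u" and x: "x \<in> I"
  shows "((W f u) \<longlongrightarrow> W f u x + (LINT t:{y\<in>I. x \<le> y}|\<rho>. u t * h t - f t * (z * u t))) (right_end b)"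
  unfolding W_eq
  by (rule wron_limit_right[OF S_memD(1)[OF f] u(1) S_memD(2)[OF f] u(2) x L2_lagrange_integrable[OF _ _ L L2_on_cmult[OF L]]])
    (auto intro: L2_on_mono[OF S_memD(3)[OF f] half_sets(3)] L2_on_mono[OF S_memD(4)[OF f] half_sets(3)])

text \<open>The second slot of \<open>l2inner\<close> is conjugated, so pairing with a conjugated
  element of \<open>S\<close> gives an identity free of conjugates. It is split at \<open>x\<close>
  because the Wronskian limits at the two ends come from the two halves.\<close>

lemma S_symmetric:
  assumes f: "(f, h) \<in> S" and g: "((\<lambda>t. cnj (\<phi> t)), (\<lambda>t. cnj (m t))) \<in> S" and x: "x \<in> I"
    and L: "L2_on \<rho> I \<phi>" "L2_on \<rho> I m"
  shows "(LINT t:{y\<in>I. y < x}|\<rho>. \<phi> t * h t - f t * m t) + (LINT t:{y\<in>I. x \<le> y}|\<rho>. \<phi> t * h t - f t * m t) = 0"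
proof -
  have "\<exists>(u, v)\<in>S. aeq \<rho> I u f \<and> aeq \<rho> I v h" by (rule bexI[OF _ f]) (simp add: aeq_def)
  then have "\<forall>(u, v)\<in>S. l2inner \<rho> I h u = l2inner \<rho> I f v"
    using S_sa S_memD(3,4)[OF f] unfolding self_adjoint_rel_def by blast
  then have e: "(LINT t:I|\<rho>. h t * \<phi> t) = (LINT t:I|\<rho>. f t * m t)"
    using g unfolding l2inner_def by fastforce
  have i: "set_integrable \<rho> I (\<lambda>t. \<phi> t * h t - f t * m t)"
    by (rule L2_lagrange_integrable[OF S_memD(3,4)[OF f] L])
  have I: "I = {y\<in>I. y < x} \<union> {y\<in>I. x \<le> y}" by auto
  have "(LINT t:I|\<rho>. \<phi> t * h t - f t * m t) = 0"
    using e L2_mult_integrable[OF L(1) S_memD(4)[OF f]] L2_mult_integrable[OF S_memD(3)[OF f] L(2)]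
    by (simp add: set_integral_diff(2) mult.commute)
  moreover have "(LINT t:I|\<rho>. \<phi> t * h t - f t * m t) =
     (LINT t:{y\<in>I. y < x}|\<rho>. \<phi> t * h t - f t * m t) + (LINT t:{y\<in>I. x \<le> y}|\<rho>. \<phi> t * h t - f t * m t)"
    by (subst I, rule set_integral_Un) (auto intro: set_integrable_subset[OF i] half_sets)
  ultimately show ?thesis by simp
qed

lemma bc_left:
  assumes f: "(f, h) \<in> S" shows "((W f ua) \<longlongrightarrow> 0) (left_end a)"
proof -
  obtain x where x: "x \<in> I" using ua_sol(2) by blast
  show ?thesis
  proof (cases "lc_left a b \<rho> \<sigma> chi")
    case True
    define L where "L = W f ua x - (LINT t:{y\<in>I. y < x}|\<rho>. ua t * h t - f t * (z * ua t))"
    have L: "((W f ua) \<longlongrightarrow> L) (left_end a)"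
      unfolding L_def by (rule S_left_limit[OF f ua_sys ua_locint ua_L2[OF x] x])
    obtain d where d: "d \<in> I" "L2_on \<rho> {x\<in>I. x < d} ub" using ub_sol(1) True unfolding lc_left_def by blast
    note Lb = S_left_limit[OF f ub_sys ub_locint d(2,1)]
    have wc: "((W ub ua) \<longlongrightarrow> W ub ua x) (left_end a)"
      by (rule tendsto_eventually, rule eventually_mono[OF eventually_left_end[OF x]]) (use W_const[OF x] in auto)
    have "L = 0"
    proof (rule ccontr)
      assume L0: "L \<noteq> 0"
      let ?v = "\<lambda>x. cnj (va x)"
      \<comment> \<open>Pluecker solved for \<open>W ub ?v\<close>: the numerator is a finite limit
        times 0 plus 0 times the constant \<open>W ub ua\<close>, so with
        \<open>L \<noteq> 0\<close> the quotient tends to 0.\<close>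
      note lim = tendsto_divide[OF tendsto_add[OF tendsto_mult[OF Lb ua_bc[OF True]] tendsto_mult[OF S_memD(5)[OF f True] wc]] L L0]
      have "((W ub ?v) \<longlongrightarrow> 0) (left_end a)"
      proof (rule Lim_transform_eventually)
        show "((\<lambda>t. (W f ub t * W ua ?v t + W f ?v t * W ub ua t) / W f ua t) \<longlongrightarrow> 0) (left_end a)"
          using lim by simp
        show "\<forall>\<^sub>F t in left_end a. (W f ub t * W ua ?v t + W f ?v t * W ub ua t) / W f ua t = W ub ?v t"
          using tendsto_imp_eventually_ne[OF L L0]
        proof eventually_elim
          case (elim t)
          have "W f ub t * W ua ?v t + W f ?v t * W ub ua t = W ub ?v t * W f ua t"
            using plucker[of f ua t ub ?v] unfolding W_eq by (simp add: algebra_simps)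
          then show ?case using elim by simp
        qed
      qed
      then show False using ub_not_left[OF d] by blast
    qed
    then show ?thesis using L by simp
  next
    case False
    obtain x1 x2 where xs: "x1 \<in> psupp I \<rho>" "x2 \<in> psupp I \<rho>" "x1 < x2" by (rule two_support_points)
    have w: "ub x * quasi ua x - quasi ub x * ua x \<noteq> 0" using wronskian_nonzero[OF x] by (simp add: W_eq)
    obtain \<phi> q \<kappa> \<alpha> \<beta> where c: "sys \<phi> q (\<lambda>t. z * \<phi> t + \<kappa> t)" "L2_on \<rho> I \<kappa>" "\<alpha> \<in> I" "\<beta> \<in> I" "\<alpha> < \<beta>"
      and ca: "\<And>t. t \<in> I \<Longrightarrow> t \<le> \<alpha> \<Longrightarrow> \<phi> t = ua t \<and> q t = quasi ua t" and cb: "\<And>t. t \<in> I \<Longrightarrow> \<beta> \<le> t \<Longrightarrow> \<phi> t = 0 \<and> q t = 0"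
      using cutoff[OF gc ua_sys ub_sys x w xs] by blast
    define m where "m = (\<lambda>t. z * \<phi> t + \<kappa> t)"
    have L\<phi>: "L2_on \<rho> I \<phi>"
    proof (rule L2_glue[OF sys_ac[OF c(1)] _ _ c(3,4)])
      show "L2_on \<rho> {x\<in>I. x < \<alpha>} \<phi>" by (rule L2_on_cong[OF ua_L2[OF c(3)]]) (use ca in auto)
      show "L2_on \<rho> {x\<in>I. \<beta> \<le> x} \<phi>" by (rule L2_on_cong[OF L2_on_zero]) (use cb in auto)
    qed
    have Lm: "L2_on \<rho> I m" unfolding m_def by (intro L2_on_add L2_on_cmult L\<phi> c(2))
    note s\<phi> = c(1)[folded m_def]
    \<comment> \<open>In the limit point case \<open>S\<close> imposes no condition at
      \<open>a\<close>; a condition at \<open>b\<close> holds because the function vanishes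
      there.\<close>
    have "((\<lambda>t. cnj (\<phi> t)), (\<lambda>t. cnj (m t))) \<in> S"
      by (rule S_memI[OF sys_cnj[OF s\<phi>] L2_on_cnj[OF L\<phi>] L2_on_cnj[OF Lm]], use False in blast,
        rule W_zero_right[OF sys_cnj[OF s\<phi>] locint_L2[OF L2_on_cnj[OF Lm]] c(4)]) (use cb in auto)
    note sym = S_symmetric[OF f this x L\<phi> Lm]
    let ?V = "\<lambda>t. f t * q t - quasi f t * \<phi> t"
    have i: "set_integrable \<rho> I (\<lambda>t. \<phi> t * h t - f t * m t)"
      by (rule L2_lagrange_integrable[OF S_memD(3,4)[OF f] L\<phi> Lm])
    have "(?V \<longlongrightarrow> ?V x + (LINT t:{y\<in>I. x \<le> y}|\<rho>. \<phi> t * h t - f t * m t)) (right_end b)"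
      by (rule wron_limit_right[OF S_memD(1)[OF f] s\<phi> S_memD(2)[OF f] locint_L2[OF Lm] x set_integrable_subset[OF i half_sets(3)]]) auto
    moreover have "(?V \<longlongrightarrow> 0) (right_end b)"
      by (rule tendsto_eventually, rule eventually_mono[OF eventually_right_end[OF c(4)]]) (use cb in auto)
    ultimately have "?V x + (LINT t:{y\<in>I. x \<le> y}|\<rho>. \<phi> t * h t - f t * m t) = 0"
      using tendsto_unique[OF right_end_nontrivial] by blast
    moreover have "(?V \<longlongrightarrow> ?V x - (LINT t:{y\<in>I. y < x}|\<rho>. \<phi> t * h t - f t * m t)) (left_end a)"
      by (rule wron_limit_left[OF S_memD(1)[OF f] s\<phi> S_memD(2)[OF f] locint_L2[OF Lm] x set_integrable_subset[OF i half_sets(1)]]) auto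
    \<comment> \<open>The limit at \<open>a\<close> is minus the sum of the two half integrals, and
      \<open>sym\<close> says that this sum is zero.\<close>
    ultimately have "(?V \<longlongrightarrow> 0) (left_end a)" using sym by (simp add: algebra_simps add_eq_0_iff)
    then show ?thesis
    proof (rule Lim_transform_eventually)
      show "\<forall>\<^sub>F t in left_end a. ?V t = W f ua t"
        using eventually_left_end[OF c(3)] by eventually_elim (use ca in \<open>simp add: W_eq\<close>)
    qed
  qed
qed

text \<open>Mirror image of \<open>bc_left\<close>, except that \<open>cutoff\<close> preserves a
  solution at the left end only.\<close>

lemma bc_right:
  assumes f: "(f, h) \<in> S" shows "((W f ub) \<longlongrightarrow> 0) (right_end b)"
proof -
  obtain x where x: "x \<in> I" using ua_sol(2) by blast
  show ?thesis
  proof (cases "lc_right a b \<rho> \<sigma> chi")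
    case True
    define L where "L = W f ub x + (LINT t:{y\<in>I. x \<le> y}|\<rho>. ub t * h t - f t * (z * ub t))"
    have L: "((W f ub) \<longlongrightarrow> L) (right_end b)"
      unfolding L_def by (rule S_right_limit[OF f ub_sys ub_locint ub_L2[OF x] x])
    obtain d where d: "d \<in> I" "L2_on \<rho> {x\<in>I. d < x} ua" using ua_sol(1) True unfolding lc_right_def by blast
    note Lb = S_right_limit[OF f ua_sys ua_locint L2_right_extend[OF sys_ac[OF ua_sys] d(2,1,1)] d(1)]
    have wc: "((W ub ua) \<longlongrightarrow> W ub ua x) (right_end b)"
      by (rule tendsto_eventually, rule eventually_mono[OF eventually_right_end[OF x]]) (use W_const[OF x] in auto)
    have "L = 0"
    proof (rule ccontr)
      assume L0: "L \<noteq> 0"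
      let ?v = "\<lambda>x. cnj (vb x)"
      note lim = tendsto_divide[OF tendsto_diff[OF tendsto_mult[OF Lb ub_bc[OF True]] tendsto_mult[OF S_memD(6)[OF f True] wc]] L L0]
      have "((W ua ?v) \<longlongrightarrow> 0) (right_end b)"
      proof (rule Lim_transform_eventually)
        show "((\<lambda>t. (W f ua t * W ub ?v t - W f ?v t * W ub ua t) / W f ub t) \<longlongrightarrow> 0) (right_end b)"
          using lim by simp
        show "\<forall>\<^sub>F t in right_end b. (W f ua t * W ub ?v t - W f ?v t * W ub ua t) / W f ub t = W ua ?v t"
          using tendsto_imp_eventually_ne[OF L L0]
        proof eventually_elim
          case (elim t)
          have "W f ua t * W ub ?v t - W f ?v t * W ub ua t = W ua ?v t * W f ub t"
            using plucker[of f ub t ua ?v] unfolding W_eq by (simp add: algebra_simps)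
          then show ?case using elim by simp
        qed
      qed
      then show False using ua_not_right[OF d] by blast
    qed
    then show ?thesis using L by simp
  next
    case False
    obtain x1 x2 where xs: "x1 \<in> psupp I \<rho>" "x2 \<in> psupp I \<rho>" "x1 < x2" by (rule two_support_points)
    have w: "ua x * quasi ub x - quasi ua x * ub x \<noteq> 0" using wronskian_nonzero[OF x] by (auto simp: W_eq algebra_simps)
    obtain \<phi>' q' \<kappa> \<alpha> \<beta> where c: "sys \<phi>' q' (\<lambda>t. z * \<phi>' t + \<kappa> t)" "L2_on \<rho> I \<kappa>" "\<alpha> \<in> I" "\<beta> \<in> I" "\<alpha> < \<beta>"
      and ca': "\<And>t. t \<in> I \<Longrightarrow> t \<le> \<alpha> \<Longrightarrow> \<phi>' t = ub t \<and> q' t = quasi ub t" and cb': "\<And>t. t \<in> I \<Longrightarrow> \<beta> \<le> t \<Longrightarrow> \<phi>' t = 0 \<and> q' t = 0"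
      using cutoff[OF gc ub_sys ua_sys x w xs] by blast
    \<comment> \<open>Subtracting the cutoff from \<open>ub\<close> removes it near \<open>a\<close>
      and leaves \<open>ub\<close> near \<open>b\<close>.\<close>
    define \<phi> where "\<phi> = (\<lambda>t. ub t - \<phi>' t)"
    define q where "q = (\<lambda>t. quasi ub t - q' t)"
    define m where "m = (\<lambda>t. z * \<phi> t + (-1) * \<kappa> t)"
    have ca: "\<phi> t = 0 \<and> q t = 0" if "t \<in> I" "t \<le> \<alpha>" for t using ca'[OF that] unfolding \<phi>_def q_def by simp
    have cb: "\<phi> t = ub t \<and> q t = quasi ub t" if "t \<in> I" "\<beta> \<le> t" for t using cb'[OF that] unfolding \<phi>_def q_def by simp
    have s\<phi>: "sys \<phi> q m" using sys_diff[OF ub_sys c(1)] unfolding \<phi>_def q_def m_def by (simp add: algebra_simps)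
    have L\<phi>: "L2_on \<rho> I \<phi>"
    proof (rule L2_glue[OF sys_ac[OF s\<phi>] _ _ c(3,4)])
      show "L2_on \<rho> {x\<in>I. x < \<alpha>} \<phi>" by (rule L2_on_cong[OF L2_on_zero]) (use ca in auto)
      show "L2_on \<rho> {x\<in>I. \<beta> \<le> x} \<phi>" by (rule L2_on_cong[OF ub_L2[OF c(4)]]) (use cb in auto)
    qed
    have Lm: "L2_on \<rho> I m" unfolding m_def by (intro L2_on_add L2_on_cmult L\<phi> c(2))
    have "((\<lambda>t. cnj (\<phi> t)), (\<lambda>t. cnj (m t))) \<in> S"
      by (rule S_memI[OF sys_cnj[OF s\<phi>] L2_on_cnj[OF L\<phi>] L2_on_cnj[OF Lm]],
        rule W_zero_left[OF sys_cnj[OF s\<phi>] locint_L2[OF L2_on_cnj[OF Lm]] c(3)]) (use ca False in auto)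
    note sym = S_symmetric[OF f this x L\<phi> Lm]
    let ?V = "\<lambda>t. f t * q t - quasi f t * \<phi> t"
    have i: "set_integrable \<rho> I (\<lambda>t. \<phi> t * h t - f t * m t)"
      by (rule L2_lagrange_integrable[OF S_memD(3,4)[OF f] L\<phi> Lm])
    have "(?V \<longlongrightarrow> ?V x - (LINT t:{y\<in>I. y < x}|\<rho>. \<phi> t * h t - f t * m t)) (left_end a)"
      by (rule wron_limit_left[OF S_memD(1)[OF f] s\<phi> S_memD(2)[OF f] locint_L2[OF Lm] x set_integrable_subset[OF i half_sets(1)]]) auto
    moreover have "(?V \<longlongrightarrow> 0) (left_end a)"
      by (rule tendsto_eventually, rule eventually_mono[OF eventually_left_end[OF c(3)]]) (use ca in auto)
    ultimately have "?V x - (LINT t:{y\<in>I. y < x}|\<rho>. \<phi> t * h t - f t * m t) = 0"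
      using tendsto_unique[OF left_end_nontrivial] by blast
    moreover have "(?V \<longlongrightarrow> ?V x + (LINT t:{y\<in>I. x \<le> y}|\<rho>. \<phi> t * h t - f t * m t)) (right_end b)"
      by (rule wron_limit_right[OF S_memD(1)[OF f] s\<phi> S_memD(2)[OF f] locint_L2[OF Lm] x set_integrable_subset[OF i half_sets(3)]]) auto
    ultimately have "(?V \<longlongrightarrow> 0) (right_end b)" using sym by simp
    then show ?thesis
    proof (rule Lim_transform_eventually)
      show "\<forall>\<^sub>F t in right_end b. ?V t = W f ub t"
        using eventually_right_end[OF c(4)] by eventually_elim (use cb in \<open>simp add: W_eq\<close>)
    qed
  qed
qed

section \<open>The kernel formula\<close>

lemma set_integral_AE_eq:
  fixes \<phi> \<psi> :: "real \<Rightarrow> complex"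
  assumes "set_integrable \<rho> A \<phi>" "set_integrable \<rho> A \<psi>" "AE t in \<rho>. t \<in> A \<longrightarrow> \<phi> t = \<psi> t"
  shows "(LINT t:A|\<rho>. \<phi> t) = (LINT t:A|\<rho>. \<psi> t)"
  unfolding set_lebesgue_integral_def
proof (rule integral_cong_AE)
  show "AE t in \<rho>. indicat_real A t *\<^sub>R \<phi> t = indicat_real A t *\<^sub>R \<psi> t"
    by (rule AE_mp[OF assms(3)], rule AE_I2) (auto simp: indicator_def)
qed (use assms(1,2) in \<open>auto simp: set_integrable_def\<close>)

text \<open>Elements of \<open>S\<close> are genuine functions, so the value of \<open>f\<close> at
  the single point \<open>x\<close> is meaningful; the a.e. equation relating \<open>f\<close>,
  \<open>h\<close> and \<open>g\<close> enters only under integrals.\<close>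

lemma resolvent_formula:
  assumes g: "L2_on \<rho> I g" and f: "(f, h) \<in> S" and fg: "aeq \<rho> I (\<lambda>x. h x - z * f x) g" and x: "x \<in> I"
  defines "G \<equiv> \<lambda>y. (if y < x then ua y * ub x else ua x * ub y) / W ub ua x"
  shows "set_integrable \<rho> I (\<lambda>y. G y * g y)" "f x = (LINT y:I|\<rho>. G y * g y)"
proof -
  \<comment> \<open>The point \<open>x\<close> belongs to \<open>?B\<close>, in accordance with the
    half-open integrals and the case \<open>y \<ge> x\<close> of the kernel.\<close>
  let ?A = "{y\<in>I. y < x}" and ?B = "{y\<in>I. x \<le> y}"
  have w: "W ub ua x \<noteq> 0" by (rule wronskian_nonzero[OF x])
  have ae: "AE t in \<rho>. t \<in> I \<longrightarrow> h t - z * f t = g t" using fg unfolding aeq_def .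
  have iA: "set_integrable \<rho> ?A (\<lambda>y. ua y * g y)"
    by (intro L2_mult_integrable ua_L2[OF x] L2_on_mono[OF g half_sets(1)]) auto
  have iB: "set_integrable \<rho> ?B (\<lambda>y. ub y * g y)"
    by (intro L2_mult_integrable ub_L2[OF x] L2_on_mono[OF g half_sets(3)]) auto
  have GA: "G y * g y = ub x / W ub ua x * (ua y * g y)" if "y \<in> ?A" for y using that unfolding G_def by simp
  have GB: "G y * g y = ua x / W ub ua x * (ub y * g y)" if "y \<in> ?B" for y using that unfolding G_def by simp
  have iGA: "set_integrable \<rho> ?A (\<lambda>y. G y * g y)"
    by (subst set_integrable_cong[OF refl refl GA]) (use iA in auto)
  have iGB: "set_integrable \<rho> ?B (\<lambda>y. G y * g y)"
    by (subst set_integrable_cong[OF refl refl GB]) (use iB in auto)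
  have I: "I = ?A \<union> ?B" by auto
  show "set_integrable \<rho> I (\<lambda>y. G y * g y)"
    by (subst I, rule set_integrable_Un[OF iGA iGB half_sets(1,3)])
  have "(LINT y:I|\<rho>. G y * g y) = (LINT y:?A|\<rho>. G y * g y) + (LINT y:?B|\<rho>. G y * g y)"
    by (subst I, rule set_integral_Un[OF _ iGA iGB]) auto
  also have "(LINT y:?A|\<rho>. G y * g y) = ub x / W ub ua x * (LINT y:?A|\<rho>. ua y * g y)"
    by (subst set_lebesgue_integral_cong[OF half_sets(1), of x _ "\<lambda>y. ub x / W ub ua x * (ua y * g y)"])
      (use GA in \<open>auto simp only: set_integral_mult_right\<close>)
  also have "(LINT y:?B|\<rho>. G y * g y) = ua x / W ub ua x * (LINT y:?B|\<rho>. ub y * g y)"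
    by (subst set_lebesgue_integral_cong[OF half_sets(3), of x _ "\<lambda>y. ua x / W ub ua x * (ub y * g y)"])
      (use GB in \<open>auto simp only: set_integral_mult_right\<close>)
  finally have e: "(LINT y:I|\<rho>. G y * g y) = ub x / W ub ua x * (LINT y:?A|\<rho>. ua y * g y) + ua x / W ub ua x * (LINT y:?B|\<rho>. ub y * g y)" .
  have "W f ua x - (LINT t:?A|\<rho>. ua t * h t - f t * (z * ua t)) = 0"
    by (rule tendsto_unique[OF left_end_nontrivial S_left_limit[OF f ua_sys ua_locint ua_L2[OF x] x] bc_left[OF f]])
  moreover have "(LINT t:?A|\<rho>. ua t * h t - f t * (z * ua t)) = (LINT y:?A|\<rho>. ua y * g y)"
  proof (rule set_integral_AE_eq[OF L2_lagrange_integrable iA])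
    show "AE t in \<rho>. t \<in> ?A \<longrightarrow> ua t * h t - f t * (z * ua t) = ua t * g t"
      by (rule AE_mp[OF ae], rule AE_I2) (auto simp: algebra_simps)
  qed (auto intro: ua_L2[OF x] L2_on_cmult L2_on_mono[OF S_memD(3)[OF f] half_sets(1)] L2_on_mono[OF S_memD(4)[OF f] half_sets(1)])
  ultimately have WA: "(LINT y:?A|\<rho>. ua y * g y) = W f ua x" by simp
  have "W f ub x + (LINT t:?B|\<rho>. ub t * h t - f t * (z * ub t)) = 0"
    by (rule tendsto_unique[OF right_end_nontrivial S_right_limit[OF f ub_sys ub_locint ub_L2[OF x] x] bc_right[OF f]])
  moreover have "(LINT t:?B|\<rho>. ub t * h t - f t * (z * ub t)) = (LINT y:?B|\<rho>. ub y * g y)"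
  proof (rule set_integral_AE_eq[OF L2_lagrange_integrable iB])
    show "AE t in \<rho>. t \<in> ?B \<longrightarrow> ub t * h t - f t * (z * ub t) = ub t * g t"
      by (rule AE_mp[OF ae], rule AE_I2) (auto simp: algebra_simps)
  qed (auto intro: ub_L2[OF x] L2_on_cmult L2_on_mono[OF S_memD(3)[OF f] half_sets(3)] L2_on_mono[OF S_memD(4)[OF f] half_sets(3)])
  ultimately have WB: "(LINT y:?B|\<rho>. ub y * g y) = - W f ub x" by (simp add: add_eq_0_iff)
  have "ub x * W f ua x - ua x * W f ub x = f x * W ub ua x" unfolding W_eq by (simp add: algebra_simps)
  then show "f x = (LINT y:I|\<rho>. G y * g y)" unfolding e WA WB using w by (simp add: field_simps)
qed

end

lemma open_ival: "open (ival a b)"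
proof -
  have "ival a b = ereal -` {a<..<b}" unfolding ival_def by auto
  then show ?thesis by (simp add: open_ereal_vimage)
qed

lemma is_interval_ival: "is_interval (ival a b)"
  unfolding is_interval_1 ival_def
  by auto (metis ereal_less_eq(3) less_le_trans, metis ereal_less_eq(3) le_less_trans)

text \<open>\<open>R_z g\<close> is represented by every pair \<open>(f, h)\<close> in
  \<open>S\<close> with \<open>h - z f = g\<close> a.e.; such a pair exists because \<open>z\<close>
  lies in the resolvent set. Integrability is part of the conclusion, as the integral of a
  non-integrable function is 0 by default.\<close>

theorem theorem8p3:
  fixes a b :: ereal and \<rho> :: "real measure" and \<sigma> chi :: smeasure
    and va vb ua ub :: "real \<Rightarrow> complex" and z :: complex
    and S :: "((real \<Rightarrow> complex) \<times> (real \<Rightarrow> complex)) set"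
  assumes ab: "a < b"
    and H1: "locfin (ival a b) \<rho>"
    and H2: "real_meas (ival a b) chi"
    and H3: "real_meas (ival a b) \<sigma>" "ssupp (ival a b) \<sigma> = ival a b"
    and H4: "\<forall>x\<in>ival a b. pmass \<sigma> x * pmass chi x = 0 \<and> pmass \<sigma> x * measure \<rho> {x} = 0"
    and H5: "\<forall>\<alpha> \<beta>. \<alpha> \<in> psupp (ival a b) \<rho> \<and> \<beta> \<in> psupp (ival a b) \<rho> \<and> \<alpha> < \<beta> \<and>
               {\<alpha><..<\<beta>} \<inter> psupp (ival a b) \<rho> = {} \<longrightarrow>
               (\<forall>f. Dtau a b \<rho> \<sigma> chi f \<and> (f \<longlongrightarrow> 0) (at_left \<alpha>) \<and> (f \<longlongrightarrow> 0) (at_right \<beta>)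
                    \<longrightarrow> (\<forall>x\<in>{\<alpha><..<\<beta>}. f x = 0))"
    and H6: "\<exists>x y. x \<in> psupp (ival a b) \<rho> \<and> y \<in> psupp (ival a b) \<rho> \<and> x \<noteq> y"
    and va: "lc_left a b \<rho> \<sigma> chi \<Longrightarrow>
               (\<exists>g. (va, g) \<in> Tmax a b \<rho> \<sigma> chi) \<and> \<not> (\<exists>g. (va, g) \<in> Tmin a b \<rho> \<sigma> chi) \<and>
               ((wron a b \<rho> \<sigma> chi va (\<lambda>x. cnj (va x))) \<longlongrightarrow> 0) (left_end a)"
    and vb: "lc_right a b \<rho> \<sigma> chi \<Longrightarrow>
               (\<exists>g. (vb, g) \<in> Tmax a b \<rho> \<sigma> chi) \<and> \<not> (\<exists>g. (vb, g) \<in> Tmin a b \<rho> \<sigma> chi) \<and>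
               ((wron a b \<rho> \<sigma> chi vb (\<lambda>x. cnj (vb x))) \<longlongrightarrow> 0) (right_end b)"
    and S_def: "S = {(f, g) \<in> Tmax a b \<rho> \<sigma> chi.
               (lc_left a b \<rho> \<sigma> chi \<longrightarrow> ((wron a b \<rho> \<sigma> chi f (\<lambda>x. cnj (va x))) \<longlongrightarrow> 0) (left_end a)) \<and>
               (lc_right a b \<rho> \<sigma> chi \<longrightarrow> ((wron a b \<rho> \<sigma> chi f (\<lambda>x. cnj (vb x))) \<longlongrightarrow> 0) (right_end b))}"
    and S_sa: "self_adjoint_rel \<rho> (ival a b) S"
    and z: "z \<in> resolvent_set \<rho> (ival a b) S"
    and ua_sol: "tau_rel a b \<rho> \<sigma> chi ua (\<lambda>x. z * ua x)" "\<exists>x\<in>ival a b. ua x \<noteq> 0"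
    and ua_bc: "lc_left a b \<rho> \<sigma> chi \<Longrightarrow> ((wron a b \<rho> \<sigma> chi ua (\<lambda>x. cnj (va x))) \<longlongrightarrow> 0) (left_end a)"
    and ua_lp: "\<not> lc_left a b \<rho> \<sigma> chi \<Longrightarrow> \<forall>c\<in>ival a b. L2_on \<rho> {x\<in>ival a b. x < c} ua"
    and ub_sol: "tau_rel a b \<rho> \<sigma> chi ub (\<lambda>x. z * ub x)" "\<exists>x\<in>ival a b. ub x \<noteq> 0"
    and ub_bc: "lc_right a b \<rho> \<sigma> chi \<Longrightarrow> ((wron a b \<rho> \<sigma> chi ub (\<lambda>x. cnj (vb x))) \<longlongrightarrow> 0) (right_end b)"
    and ub_lp: "\<not> lc_right a b \<rho> \<sigma> chi \<Longrightarrow> \<forall>c\<in>ival a b. L2_on \<rho> {x\<in>ival a b. c < x} ub"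
  shows "\<forall>g f h. L2_on \<rho> (ival a b) g \<and> (f, h) \<in> S \<and> aeq \<rho> (ival a b) (\<lambda>x. h x - z * f x) g \<longrightarrow>
           (\<forall>x\<in>ival a b.
              (let G = (\<lambda>y. (if y < x then ua y * ub x else ua x * ub y) / wron a b \<rho> \<sigma> chi ub ua x)
               in set_integrable \<rho> (ival a b) (\<lambda>y. G y * g y) \<and>
                  f x = set_lebesgue_integral \<rho> (ival a b) (\<lambda>y. G y * g y)))"
proof -
  \<comment> \<open>The five measures form one finite family, so that a single \<mu> dominates all
    of them.\<close>
  define Ms where "Ms = (!) [fst \<sigma>, snd \<sigma>, fst chi, snd chi, \<rho>]"
  have "locfin (ival a b) (Ms i)" if "i \<in> {..<5}" for i
  proof -
    have "i = 0 \<or> i = 1 \<or> i = 2 \<or> i = 3 \<or> i = 4" using that by auto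
    then show ?thesis using H1 H2 H3(1) unfolding Ms_def real_meas_def by (auto simp: numeral_eq_Suc)
  qed
  then obtain \<mu> d where \<mu>: "locfin_ivl (ival a b) \<mu>" and d: "\<And>i. i \<in> {..<5} \<Longrightarrow> has_density (ival a b) \<mu> (Ms i) (d i)"
    using ex_dominating_measure[of "{..<5::nat}" "ival a b" Ms, OF finite_lessThan open_ival is_interval_ival] by blast
  have D: "has_density (ival a b) \<mu> (fst \<sigma>) (d 0)" "has_density (ival a b) \<mu> (snd \<sigma>) (d 1)"
    "has_density (ival a b) \<mu> (fst chi) (d 2)" "has_density (ival a b) \<mu> (snd chi) (d 3)" "has_density (ival a b) \<mu> \<rho> (d 4)"
    using d[of 0] d[of 1] d[of 2] d[of 3] d[of 4] by (simp_all add: Ms_def)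
  interpret sl_problem a b \<rho> \<sigma> chi \<mu> "d 0" "d 1" "d 2" "d 3" "d 4"
    by (rule sl_problem.intro[OF \<mu> H1 H2 H3 H4 D])
  have gc: gap_condition using H5 unfolding gap_condition_def .
  interpret sl_green a b \<rho> \<sigma> chi \<mu> "d 0" "d 1" "d 2" "d 3" "d 4" va vb ua ub z S
    by (rule sl_green.intro[OF sl_problem_axioms], rule sl_green_axioms.intro)
      (rule gc H6 S_def S_sa z ua_sol ub_sol | erule ua_bc ua_lp ub_bc ub_lp)+
  show ?thesis unfolding Let_def by (intro allI impI ballI conjI) (use resolvent_formula in blast)+
qed

end
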